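(* Let $\kappa$ be an uncountable cardinal, let $(\Upsilon_\alpha)_\alpha$ be trees as described in the context, and let $A,B\subset\kappa$ be subsets of cardinality $\kappa$, with associated trees $\Upsilon^A$ and $\Upsilon^B$ as described in the context. If $A\neq B$, then $P(K[\Upsilon^A,\kappa])$ is not homeomorphic to $P(K[\Upsilon^B,\kappa])$.
   Context: A tree is a partially ordered set in which every initial segment $\{s: s<t\}$ is well ordered and which has a minimum element, called its root. The $\beta$-th level of a tree is the set of its elements $t$ such that $\{s: s<t\}$ has order type $\beta$; the height of the tree is the least ordinal $\beta$ whose $\beta$-th level is empty. A branch is a maximal linearly ordered subset, and its length is its order type. An immediate successor of $t$ is an $s>t$ with no element strictly between $t$ and $s$. For a tree $T$ and an uncountable set $\Gamma$, $K[T,\Gamma]\subset 2^{T\times\Gamma}$ is the compact space (with the topology inherited from the product topology) of all subsets $x\subset T\times\Gamma$ of cardinality at most $2$ such that the first coordinates of the elements of $x$ are contained in a branch of $T$. For a compact space $K$, $P(K)$ is the space of (regular Borel) probability measures on $K$ with the weak$^*$ topology. For every ordinal $\alpha$, $\Upsilon_\alpha$ is a tree with the following properties. (1) The root of $\Upsilon_\alpha$ is the ordinal $\alpha$. (2) $\Upsilon_\alpha$ is ever branching, that is, every element has at least two immediate successors. (3) The height of $\Upsilon_\alpha$ equals $\omega\cdot\alpha$ (ordinal product, meaning the concatenation of $\alpha$ many copies of the ordinal $\omega$). (4) $\Upsilon_\alpha$ has a branch of length $\omega\cdot\alpha$. (5) For every $\beta<\alpha$, the $\beta$-th level of $\Upsilon_\alpha$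 has cardinality $|\beta|$. In particular $|\Upsilon_\alpha|=\max(|\alpha|,\omega)$. (6) $\Upsilon_\alpha$ is a Hausdorff tree, that is, for every node $t$ which is not an immediate successor, $t=\sup\{s: s<t\}$. To every subset $A\subset\kappa$ of cardinality $\kappa$ one associates a tree $\Upsilon^A$ with root $0$ such that the set of immediate successors of the root $0$ equals the set $A$, and for every $\alpha\in A$ the subtree $\{t\in\Upsilon^A: t\geq\alpha\}$ equals the tree $\Upsilon_\alpha$.
   Formalization: Property (5) fails for finite β (level 0 is the root alone), so |β| is required only for infinite β<α, finite levels are countable, and |Υ_α|=max(|α|,ω) is assumed outright; Υ_0 cannot exist (height 0), so trees are taken for 0<α<κ and A,B⊂κ∖{0}. *)

theory Defs
  imports "HOL-Probability.Probability"
begin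

unbundle cardinal_syntax

text \<open>
  Ordinals are represented by well-orders up to \<^term>\<open>ordIso\<close>. The cardinal kappa is a relation
  with \<^term>\<open>Card_order kappa\<close>; the elements of its field play the role of the ordinals below
  kappa, and such an element \<open>a\<close> stands for the ordinal \<open>ord_below kappa a\<close> of its predecessors.
\<close>

definition ord_below :: "'a rel \<Rightarrow> 'a \<Rightarrow> 'a rel" where
  "ord_below r a = Restr r (underS r a)"

definition ord_zero :: "'a rel \<Rightarrow> 'a" where
  "ord_zero r = wo_rel.minim r (Field r)"

text \<open>
  Ordinal product \<open>r \<cdot> s\<close>: the concatenation of \<open>s\<close> many copies of \<open>r\<close>, so the second
  coordinate is the more significant one.
\<close>

definition ord_prod :: "'a rel \<Rightarrow> 'b rel \<Rightarrow> ('a \<times> 'b) rel" where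
  "ord_prod r s =
     {((x, y), (x', y')). x \<in> Field r \<and> x' \<in> Field r \<and> y \<in> Field s \<and> y' \<in> Field s \<and>
        (((y, y') \<in> s \<and> y \<noteq> y') \<or> (y = y' \<and> (x, x') \<in> r))}"

text \<open>
  A tree is given by its reflexive order relation; its nodes are the elements of the field.
\<close>

definition is_root :: "'a rel \<Rightarrow> 'a \<Rightarrow> bool" where
  "is_root T r \<longleftrightarrow> r \<in> Field T \<and> (\<forall>t\<in>Field T. (r, t) \<in> T)"

definition is_tree :: "'a rel \<Rightarrow> bool" where
  "is_tree T \<longleftrightarrow>
     Partial_order T \<and>
     (\<forall>t\<in>Field T. Well_order (Restr T (underS T t))) \<and>
     (\<exists>r. is_root T r)"

definition tree_level :: "'a rel \<Rightarrow> 'b rel \<Rightarrow> 'a set" where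
  "tree_level T b = {t \<in> Field T. Restr T (underS T t) =o b}"

text \<open>
  Every ordinal smaller than \<open>h\<close> is represented by a well-order on the type underlying \<open>h\<close>, so
  the quantifier over \<open>b\<close> ranges over all ordinals below \<open>h\<close>.
\<close>

definition tree_height :: "'a rel \<Rightarrow> 'b rel \<Rightarrow> bool" where
  "tree_height T h \<longleftrightarrow>
     Well_order h \<and> tree_level T h = {} \<and> (\<forall>b::'b rel. b <o h \<longrightarrow> tree_level T b \<noteq> {})"

definition branches :: "'a rel \<Rightarrow> 'a set set" where
  "branches T = {C \<in> Chains T. \<forall>D\<in>Chains T. C \<subseteq> D \<longrightarrow> D = C}"

definition imm_succs :: "'a rel \<Rightarrow> 'a \<Rightarrow> 'a set" where
  "imm_succs T t = {s \<in> aboveS T t. aboveS T t \<inter> underS T s = {}}"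

definition ever_branching :: "'a rel \<Rightarrow> bool" where
  "ever_branching T \<longleftrightarrow>
     (\<forall>t\<in>Field T. \<exists>s s'. s \<in> imm_succs T t \<and> s' \<in> imm_succs T t \<and> s \<noteq> s')"

definition is_sup :: "'a rel \<Rightarrow> 'a set \<Rightarrow> 'a \<Rightarrow> bool" where
  "is_sup T S t \<longleftrightarrow> t \<in> Above T S \<and> (\<forall>u\<in>Above T S. (t, u) \<in> T)"

definition hausdorff_tree :: "'a rel \<Rightarrow> bool" where
  "hausdorff_tree T \<longleftrightarrow>
     (\<forall>t\<in>Field T. (\<nexists>s. s \<in> Field T \<and> t \<in> imm_succs T s) \<longrightarrow> is_sup T (underS T t) t)"

text \<open>
  The trees \<open>\<Upsilon>\<^sub>\<alpha>\<close>, for \<open>\<alpha>\<close> a nonzero ordinal below kappa. An ever branching tree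
  cannot have finite levels of size \<open>\<bar>\<beta>\<bar>\<close> for finite \<open>\<beta>\<close> (level \<open>0\<close> is the root alone, and level
  \<open>1\<close> has at least two elements). The size of level \<open>\<beta>\<close> is therefore prescribed to be \<open>\<bar>\<beta>\<bar>\<close> for
  infinite \<open>\<beta>\<close> only, while levels with finite index are countable.
\<close>

definition upsilon_tree :: "'a rel \<Rightarrow> 'a \<Rightarrow> 'a rel \<Rightarrow> bool" where
  "upsilon_tree kappa \<alpha> T \<longleftrightarrow>
     is_tree T \<and>
     is_root T \<alpha> \<and>
     ever_branching T \<and>
     tree_height T (ord_prod natLeq (ord_below kappa \<alpha>)) \<and>
     (\<exists>C\<in>branches T. Restr T C =o ord_prod natLeq (ord_below kappa \<alpha>)) \<and>
     (\<forall>\<beta>\<in>underS kappa \<alpha>.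
        if finite (underS kappa \<beta>)
        then countable (tree_level T (ord_below kappa \<beta>))
        else |tree_level T (ord_below kappa \<beta>)| =o |underS kappa \<beta>| ) \<and>
     (if finite (underS kappa \<alpha>)
      then |Field T| =o natLeq
      else |Field T| =o |underS kappa \<alpha>| ) \<and>
     hausdorff_tree T"

text \<open>
  \<open>T\<close> is the tree \<open>\<Upsilon>\<^sup>A\<close> built from the family \<open>Ups\<close>. The conditions determine \<open>T\<close>, since every
  node other than the root lies above some immediate successor of the root.
\<close>

definition upsilon_sum :: "'a rel \<Rightarrow> ('a \<Rightarrow> 'a rel) \<Rightarrow> 'a set \<Rightarrow> 'a rel \<Rightarrow> bool" where
  "upsilon_sum kappa Ups A T \<longleftrightarrow>
     is_tree T \<and>
     is_root T (ord_zero kappa) \<and>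
     imm_succs T (ord_zero kappa) = A \<and>
     (\<forall>\<alpha>\<in>A. Restr T (above T \<alpha>) = Ups \<alpha>)"

text \<open>
  The Cantor cube \<open>2\<^sup>I\<close> with subsets of \<open>I\<close> as points, identified with their characteristic
  functions.
\<close>

definition cantor_cube :: "'i set \<Rightarrow> 'i set topology" where
  "cantor_cube I =
     pullback_topology (Pow I) (\<lambda>x. restrict (\<lambda>i. i \<in> x) I)
       (product_topology (\<lambda>_. discrete_topology (UNIV :: bool set)) I)"

definition K_space :: "'a rel \<Rightarrow> 'g set \<Rightarrow> ('a \<times> 'g) set topology" where
  "K_space T \<Gamma> =
     subtopology (cantor_cube (Field T \<times> \<Gamma>))
       {x. x \<subseteq> Field T \<times> \<Gamma> \<and> finite x \<and> card x \<le> 2 \<and> (\<exists>C\<in>branches T. fst ` x \<subseteq> C)}"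

definition borel_sigma :: "'b topology \<Rightarrow> 'b measure" where
  "borel_sigma X = sigma (topspace X) {U. openin X U}"

definition regular_measure :: "'b topology \<Rightarrow> 'b measure \<Rightarrow> bool" where
  "regular_measure X M \<longleftrightarrow>
     (\<forall>E\<in>sets M.
        emeasure M E = (SUP C\<in>{C. C \<subseteq> E \<and> compactin X C}. emeasure M C) \<and>
        emeasure M E = (INF U\<in>{U. E \<subseteq> U \<and> openin X U}. emeasure M U))"

definition prob_measures :: "'b topology \<Rightarrow> 'b measure set" where
  "prob_measures X =
     {M. space M = topspace X \<and> sets M = sets (borel_sigma X) \<and> prob_space M \<and> regular_measure X M}"

text \<open>
  \<open>P(X)\<close> for a compact Hausdorff space \<open>X\<close>, with the weak* topology: the coarsest topology making
  \<open>M \<mapsto> \<integral> f dM\<close> continuous for every continuous real function \<open>f\<close> on \<open>X\<close>.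
\<close>

definition P_space :: "'b topology \<Rightarrow> 'b measure topology" where
  "P_space X =
     topology_generated_by
       {{M \<in> prob_measures X. (LINT x|M. f x) \<in> U} | f U. continuous_map X euclideanreal f \<and> open U}"

lemma topspace_cantor_cube: "topspace (cantor_cube I) = Pow I"
  by (auto simp: cantor_cube_def topspace_pullback_topology)

lemma topspace_P_space: "topspace (P_space X) = prob_measures X"
proof -
  have "{M \<in> prob_measures X. (LINT x|M. (0::real)) \<in> UNIV} \<in>
      {{M \<in> prob_measures X. (LINT x|M. f x) \<in> U} | f U. continuous_map X euclideanreal f \<and> open U}"
    by (rule CollectI, rule exI[of _ "\<lambda>_. 0"], rule exI[of _ UNIV]) auto
  then have "prob_measures X \<in>
      {{M \<in> prob_measures X. (LINT x|M. f x) \<in> U} | f U. continuous_map X euclideanreal f \<and> open U}"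
    by simp
  then show ?thesis
    unfolding P_space_def topology_generated_by_topspace by blast
qed

end

theory Submission
  imports Defs
begin

text \<open>
  The points of \<open>K[T, \<Gamma>]\<close> are sets of at most two points of \<open>T \<times> \<Gamma>\<close> over comparable nodes. This
  space has three layers, by cardinality, and compact subsets of the layers of one- and two-element
  sets are finite; so regular probability measures are discrete and \<open>P(K[T, \<Gamma>])\<close> is the space of
  probability mass functions on \<open>K[T, \<Gamma>]\<close>, with closeness tested in finite windows
  (\<open>pmf_space_homeomorphic\<close>).

  The order of the tree is recovered from the topology of this space as follows. Fix a window
  \<open>D = S \<times> \<Delta>\<close>, with \<open>S\<close> a set of nodes and \<open>\<Delta>\<close> a set of labels, and call two distributions
  equivalent if they have the same image under \<open>m \<mapsto> m \<inter> D\<close>. The quotient map orders the points: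
  \<open>x\<close> is below \<open>y\<close> if each neighborhood of \<open>y\<close> takes all the values in the quotient that some
  neighborhood of \<open>x\<close> takes (\<open>fiber_le\<close>). A small perturbation can enlarge a set that carries mass
  by points of \<open>D\<close>, wherever there is room and the nodes are comparable. So the position of \<open>x\<close> in
  the order tells which mass of \<open>x\<close> can still be completed, and over which nodes
  (\<open>fiber_le_atom_bound\<close>, \<open>fiber_le_transport\<close>). The points on top of a linear, nontrivial class turn out
  to be those with exactly one one-element atom \<open>{q}\<close> and two-element atoms otherwise, all inside \<open>D\<close>
  (\<open>linear_pointI\<close>, \<open>linear_pointD\<close>). Use this for a larger window, and compare such points within
  one class for \<open>D\<close>: if \<open>q\<close> is outside \<open>D\<close>, they are ordered by the mass at \<open>{q}\<close> and by the cone of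
  nodes of \<open>S\<close> comparable to the node of \<open>q\<close> (\<open>le_iff\<close>). Further order conditions force the
  mass to be full. What remains is the tree order, reversed (\<open>le_real_iff\<close>); its coatoms are the
  children of the root (\<open>coatom_real\<close>, \<open>coatomD\<close>).

  A homeomorphism has no reason to respect a given window. But continuous functions on the space of
  distributions depend on countably many coordinates (\<open>countable_dependence\<close>), so every set of
  coordinates of infinite size \<open>\<tau>\<close> can be enlarged to one of size \<open>\<tau>\<close> whose windows are matched by
  the homeomorphism (\<open>dependence_transfer\<close>, \<open>small_closure\<close>). With \<open>\<tau> = max (|\<alpha>|, \<omega>) < \<kappa>\<close>, labels
  outside the windows remain.

  If \<open>\<alpha> \<in> A - B\<close>, such a homeomorphism sends the child \<open>\<alpha>\<close> of the root of \<open>\<Upsilon>\<^sup>A\<close> to a child \<open>\<beta> \<in> B\<close> of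
  the root of \<open>\<Upsilon>\<^sup>B\<close>, and chains of the window in \<open>\<Upsilon>\<^sub>\<alpha>\<close> strictly increasingly into \<open>\<Upsilon>\<^sub>\<beta>\<close>, or
  conversely (\<open>chain_transfer\<close>). Now \<open>\<Upsilon>\<^sub>\<alpha>\<close> has height \<open>\<omega> \<cdot> \<alpha>\<close> and a branch of that length, and
  likewise for \<open>\<beta>\<close>. Since \<open>\<alpha> \<noteq> \<beta>\<close>, a chain in the higher tree does not embed into the other
  (\<open>upsilon_chain_obstruction\<close>), a contradiction.
\<close>

section \<open>Probability mass functions on a family of finite sets\<close>

definition restr_pmf :: "'i set \<Rightarrow> 'i set pmf \<Rightarrow> 'i set pmf" where
  "restr_pmf D x = map_pmf (\<lambda>m. m \<inter> D) x"

text \<open>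
  The finite window \<open>G\<close> can only tell apart sets with different traces on \<open>G\<close>. On distributions
  that live on a compact family of finite sets, closeness in all finite windows is weak*
  closeness, since every continuous function is uniformly close to one that depends on a trace.
\<close>

definition close_pmf :: "'i set \<Rightarrow> real \<Rightarrow> 'i set pmf \<Rightarrow> 'i set pmf \<Rightarrow> bool" where
  "close_pmf G \<eta> x y \<longleftrightarrow> (\<forall>A. \<bar>measure (restr_pmf G x) A - measure (restr_pmf G y) A\<bar> < \<eta>)"

definition pmfs_on :: "'i set set \<Rightarrow> 'i set pmf set" where
  "pmfs_on K = {x. set_pmf x \<subseteq> K}"

definition pmf_nhd :: "'i set set \<Rightarrow> 'i set \<Rightarrow> real \<Rightarrow> 'i set pmf \<Rightarrow> 'i set pmf set" where
  "pmf_nhd K G \<eta> x = {y \<in> pmfs_on K. close_pmf G \<eta> x y}"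

definition pmf_space :: "'i set set \<Rightarrow> 'i set pmf topology" where
  "pmf_space K = topology (\<lambda>U. U \<subseteq> pmfs_on K \<and>
     (\<forall>x\<in>U. \<exists>G \<eta>. finite G \<and> \<eta> > 0 \<and> pmf_nhd K G \<eta> x \<subseteq> U))"

lemma measure_restr_pmf: "measure (restr_pmf D x) A = measure x {m. m \<inter> D \<in> A}"
  by (simp add: restr_pmf_def vimage_def)

lemma close_pmf_mono:
  assumes "close_pmf G' \<eta>' x y" "G \<subseteq> G'" "\<eta>' \<le> \<eta>"
  shows "close_pmf G \<eta> x y"
  unfolding close_pmf_def
proof
  fix A
  have eq: "measure (restr_pmf G z) A = measure (restr_pmf G' z) {m. m \<inter> G \<in> A}" for z :: "'a set pmf"
    using assms(2) by (simp add: measure_restr_pmf Int_assoc Int_absorb1)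
  show "\<bar>measure (restr_pmf G x) A - measure (restr_pmf G y) A\<bar> < \<eta>"
    unfolding eq using assms(1,3) unfolding close_pmf_def by (meson less_le_trans)
qed

lemma close_pmf_refl: "\<eta> > 0 \<Longrightarrow> close_pmf G \<eta> x x"
  by (simp add: close_pmf_def)

lemma close_pmfD:
  "close_pmf G \<eta> x y \<Longrightarrow> \<bar>measure x {m. m \<inter> G \<in> A} - measure y {m. m \<inter> G \<in> A}\<bar> < \<eta>"
  by (simp add: close_pmf_def measure_restr_pmf)

text \<open>
  Both distributions have total mass one, so a lower bound on every set is also an upper bound,
  by passing to complements.
\<close>

lemma close_pmfI:
  fixes x y :: "'i set pmf"
  assumes "\<And>A. measure y {m. m \<inter> G \<in> A} > measure x {m. m \<inter> G \<in> A} - \<eta>"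
  shows "close_pmf G \<eta> x y"
  unfolding close_pmf_def measure_restr_pmf
proof
  fix A
  have c: "measure z {m. m \<inter> G \<in> - A} = 1 - measure z {m. m \<inter> G \<in> A}" for z :: "'i set pmf"
    using measure_pmf.prob_compl[of "{m. m \<inter> G \<in> A}" z]
    by (simp add: Compl_eq_Diff_UNIV[symmetric] Collect_neg_eq)
  show "\<bar>measure x {m. m \<inter> G \<in> A} - measure y {m. m \<inter> G \<in> A}\<bar> < \<eta>"
    using assms[of A] assms[of "- A"] unfolding c by linarith
qed

lemma istopology_pmf_space:
  "istopology (\<lambda>U. U \<subseteq> pmfs_on K \<and>
     (\<forall>x\<in>U. \<exists>G \<eta>. finite G \<and> \<eta> > 0 \<and> pmf_nhd K G \<eta> x \<subseteq> U))"
  unfolding istopology_def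
proof (intro conjI allI impI)
  fix S T
  assume S: "S \<subseteq> pmfs_on K \<and> (\<forall>x\<in>S. \<exists>G \<eta>. finite G \<and> \<eta> > 0 \<and> pmf_nhd K G \<eta> x \<subseteq> S)"
    and T: "T \<subseteq> pmfs_on K \<and> (\<forall>x\<in>T. \<exists>G \<eta>. finite G \<and> \<eta> > 0 \<and> pmf_nhd K G \<eta> x \<subseteq> T)"
  show "S \<inter> T \<subseteq> pmfs_on K" using S by blast
  show "\<forall>x\<in>S \<inter> T. \<exists>G \<eta>. finite G \<and> \<eta> > 0 \<and> pmf_nhd K G \<eta> x \<subseteq> S \<inter> T"
  proof
    fix x assume x: "x \<in> S \<inter> T"
    obtain G1 e1 where 1: "finite G1" "e1 > 0" "pmf_nhd K G1 e1 x \<subseteq> S" using S x by blast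
    obtain G2 e2 where 2: "finite G2" "e2 > 0" "pmf_nhd K G2 e2 x \<subseteq> T" using T x by blast
    have "pmf_nhd K (G1 \<union> G2) (min e1 e2) x \<subseteq> pmf_nhd K G1 e1 x"
      "pmf_nhd K (G1 \<union> G2) (min e1 e2) x \<subseteq> pmf_nhd K G2 e2 x"
      by (auto simp: pmf_nhd_def intro: close_pmf_mono)
    then show "\<exists>G \<eta>. finite G \<and> \<eta> > 0 \<and> pmf_nhd K G \<eta> x \<subseteq> S \<inter> T"
      using 1 2 by (intro exI[of _ "G1 \<union> G2"] exI[of _ "min e1 e2"]) auto
  qed
next
  fix \<K> assume K: "\<forall>S\<in>\<K>. S \<subseteq> pmfs_on K \<and> (\<forall>x\<in>S. \<exists>G \<eta>. finite G \<and> \<eta> > 0 \<and> pmf_nhd K G \<eta> x \<subseteq> S)"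
  show "\<Union>\<K> \<subseteq> pmfs_on K" using K by blast
  show "\<forall>x\<in>\<Union>\<K>. \<exists>G \<eta>. finite G \<and> \<eta> > 0 \<and> pmf_nhd K G \<eta> x \<subseteq> \<Union>\<K>"
    using K by (meson Union_iff Union_upper order_trans)
qed

lemma openin_pmf_space:
  "openin (pmf_space K) U \<longleftrightarrow> U \<subseteq> pmfs_on K \<and>
     (\<forall>x\<in>U. \<exists>G \<eta>. finite G \<and> \<eta> > 0 \<and> pmf_nhd K G \<eta> x \<subseteq> U)"
  unfolding pmf_space_def topology_inverse'[OF istopology_pmf_space] ..

lemma topspace_pmf_space [simp]: "topspace (pmf_space K) = pmfs_on K"
proof -
  have "openin (pmf_space K) (pmfs_on K)"
    unfolding openin_pmf_space pmf_nhd_def by (auto intro!: exI[of _ "{}"] exI[of _ 1])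
  then show ?thesis
    using openin_subset openin_topspace unfolding openin_pmf_space
    by (metis openin_pmf_space subset_antisym)
qed

text \<open>
  A finite window has only finitely many events, so the largest deviation is attained and is
  strictly below \<open>\<eta>\<close>; the gap is the radius that remains around a nearby point.
\<close>

lemma openin_pmf_nhd:
  assumes "finite G"
  shows "openin (pmf_space K) (pmf_nhd K G \<eta> x)"
  unfolding openin_pmf_space
proof (intro conjI ballI)
  show "pmf_nhd K G \<eta> x \<subseteq> pmfs_on K" by (auto simp: pmf_nhd_def)
  fix y assume y: "y \<in> pmf_nhd K G \<eta> x"
  define \<delta> where "\<delta> A = \<bar>measure (restr_pmf G x) A - measure (restr_pmf G y) A\<bar>" for A
  define e where "e = \<eta> - Max (\<delta> ` Pow (Pow G))"
  have fin: "finite (Pow (Pow G))" using assms by simp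
  have \<delta>: "\<delta> A < \<eta>" for A using y by (auto simp: pmf_nhd_def close_pmf_def \<delta>_def)
  have "Max (\<delta> ` Pow (Pow G)) \<in> \<delta> ` Pow (Pow G)"
    using fin by (intro Max_in) auto
  then have "e > 0" using \<delta> by (auto simp: e_def)
  have le: "\<delta> A \<le> \<eta> - e" for A
  proof -
    have "\<delta> A = \<delta> (A \<inter> Pow G)"
    proof -
      have "measure (restr_pmf G z) (A \<inter> Pow G) = measure (restr_pmf G z) A" for z :: "'a set pmf"
        by (simp add: measure_restr_pmf)
      then show ?thesis by (simp add: \<delta>_def)
    qed
    also have "\<dots> \<le> Max (\<delta> ` Pow (Pow G))" using fin by (intro Max_ge) auto
    finally show ?thesis by (simp add: e_def)
  qed
  have "pmf_nhd K G e y \<subseteq> pmf_nhd K G \<eta> x"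
  proof
    fix z assume z: "z \<in> pmf_nhd K G e y"
    have "\<bar>measure (restr_pmf G x) A - measure (restr_pmf G z) A\<bar> < \<eta>" for A
      using le[of A] z unfolding \<delta>_def pmf_nhd_def close_pmf_def mem_Collect_eq
      by (smt (verit))
    then show "z \<in> pmf_nhd K G \<eta> x" using z by (auto simp: pmf_nhd_def close_pmf_def)
  qed
  then show "\<exists>G' \<eta>'. finite G' \<and> \<eta>' > 0 \<and> pmf_nhd K G' \<eta>' y \<subseteq> pmf_nhd K G \<eta> x"
    using assms \<open>e > 0\<close> by blast
qed

text \<open>
  A distribution has countably many atoms, so finite sets of atoms exhaust its mass.
\<close>

lemma pmf_finite_approx:
  fixes x :: "'b pmf"
  assumes "e > 0"
  obtains F where "finite F" "F \<subseteq> set_pmf x" "measure x F > 1 - e"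
proof -
  have "\<exists>F. finite F \<and> F \<subseteq> set_pmf x \<and> measure x F > 1 - e"
  proof -
    define A where "A n = from_nat_into (set_pmf x) ` {..n}" for n
    have ne: "set_pmf x \<noteq> {}" by (rule set_pmf_not_empty)
    have sub: "A n \<subseteq> set_pmf x" for n
      using from_nat_into[OF ne] by (auto simp: A_def)
    have fin: "finite (A n)" for n by (simp add: A_def)
    have "(\<Union>n. A n) = range (from_nat_into (set_pmf x))" by (auto simp: A_def)
    then have un: "(\<Union>n. A n) = set_pmf x"
      using range_from_nat_into[OF ne countable_set_pmf] by simp
    have "incseq A" unfolding A_def incseq_def by (intro allI impI image_mono) simp
    then have "(\<lambda>n. measure x (A n)) \<longlonglongrightarrow> measure x (\<Union>n. A n)"
      by (intro measure_pmf.finite_Lim_measure_incseq) auto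
    moreover have "measure x (\<Union>n. A n) = 1" unfolding un
      by (simp add: measure_pmf.prob_eq_1 AE_measure_pmf_iff)
    ultimately have "(\<lambda>n. measure x (A n)) \<longlonglongrightarrow> 1" by simp
    then have "eventually (\<lambda>n. measure x (A n) > 1 - e) sequentially"
      using assms by (intro order_tendstoD(1)) auto
    then obtain n where "measure x (A n) > 1 - e"
      by (meson eventually_happens trivial_limit_sequentially)
    then show ?thesis using fin sub by blast
  qed
  then show ?thesis using that by blast
qed

lemma measure_bind_pmf: "measure (bind_pmf M N) X = (\<integral>x. measure (N x) X \<partial>measure_pmf M)"
proof -
  have "ennreal (measure (bind_pmf M N) X) = (\<integral>\<^sup>+x. ennreal (measure (N x) X) \<partial>measure_pmf M)"
    by (simp add: measure_pmf.emeasure_eq_measure[symmetric])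
  also have "\<dots> = ennreal (\<integral>x. measure (N x) X \<partial>measure_pmf M)"
    by (rule nn_integral_eq_integral)
      (auto intro!: measure_pmf.integrable_const_bound[where B = 1])
  finally show ?thesis
    by (simp add: integral_nonneg_AE)
qed

lemma integrable_weighted_indicators:
  "integrable (measure_pmf x) (\<lambda>m. \<Sum>j\<in>F. c j * indicator (S j) m :: real)"
  by (intro Bochner_Integration.integrable_sum Bochner_Integration.integrable_mult_right)
    (auto intro: measure_pmf.integrable_const_bound[where B = 1])

lemma integral_weighted_indicators:
  "(\<integral>m. (\<Sum>j\<in>F. c j * indicator (S j) m) \<partial>measure_pmf x) = (\<Sum>j\<in>F. c j * measure x (S j))"
proof -
  have "(\<integral>m. (\<Sum>j\<in>F. c j * indicator (S j) m) \<partial>measure_pmf x) =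
      (\<Sum>j\<in>F. \<integral>m. c j * indicator (S j) m \<partial>measure_pmf x)"
    by (intro Bochner_Integration.integral_sum Bochner_Integration.integrable_mult_right)
      (auto intro: measure_pmf.integrable_const_bound[where B = 1])
  then show ?thesis by simp
qed

section \<open>The order on the fibers of a window\<close>

definition same_restr :: "'i set \<Rightarrow> 'i set pmf \<Rightarrow> 'i set pmf \<Rightarrow> bool" where
  "same_restr D x y \<longleftrightarrow> restr_pmf D x = restr_pmf D y"

text \<open>
  Compares the values of the quotient map by \<open>E\<close> near \<open>x\<close> and near \<open>y\<close>: the values taken close to \<open>x\<close>
  are also taken close to \<open>y\<close>. The order is expressed by the topology and \<open>E\<close> alone, so every
  homeomorphism that respects \<open>E\<close> preserves it. When \<open>E\<close> compares restrictions to a window \<open>D\<close>,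
  mass that a distribution puts on a set \<open>k\<close> can be moved by an arbitrarily small perturbation to
  sets \<open>insert d k\<close>, with \<open>d \<in> D\<close> outside a large finite set. The order therefore records how
  much mass may be completed in which ways inside \<open>D\<close>.
\<close>

definition fiber_le :: "'b topology \<Rightarrow> ('b \<Rightarrow> 'b \<Rightarrow> bool) \<Rightarrow> 'b \<Rightarrow> 'b \<Rightarrow> bool" where
  "fiber_le X E x y \<longleftrightarrow>
     (\<forall>U. openin X U \<and> y \<in> U \<longrightarrow> (\<exists>V. openin X V \<and> x \<in> V \<and> (\<forall>v\<in>V. \<exists>u\<in>U. E v u)))"

lemma same_restrD:
  "same_restr D x y \<Longrightarrow> measure x {m. m \<inter> D \<in> A} = measure y {m. m \<inter> D \<in> A}"
  by (metis measure_restr_pmf same_restr_def)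

lemma same_restr_set_pmf:
  assumes "same_restr D x y" "m \<in> set_pmf x"
  obtains m' where "m' \<in> set_pmf y" "m' \<inter> D = m \<inter> D"
proof -
  have "m \<inter> D \<in> set_pmf (restr_pmf D x)" using assms(2) by (simp add: restr_pmf_def)
  then have "m \<inter> D \<in> set_pmf (restr_pmf D y)" using assms(1) by (simp add: same_restr_def)
  then show ?thesis using that by (auto simp: restr_pmf_def)
qed

lemma pmf_eq_measure_singleton: "pmf x k = measure x {k}"
  by (simp add: measure_pmf_single)

lemma pmf_le_measure: "k \<in> S \<Longrightarrow> pmf x k \<le> measure x S"
  unfolding pmf_eq_measure_singleton by (rule measure_pmf.finite_measure_mono) auto

lemma measure_pmf_mono_on:
  assumes "\<And>m. m \<in> set_pmf x \<Longrightarrow> m \<in> A \<Longrightarrow> m \<in> B"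
  shows "measure x A \<le> measure x B"
proof -
  have "measure x A = measure x (A \<inter> set_pmf x)"
    by (simp add: measure_Int_set_pmf)
  also have "\<dots> \<le> measure x B"
    by (rule measure_pmf.finite_measure_mono) (use assms in auto)
  finally show ?thesis .
qed

text \<open>
  Marks a part of size \<open>c\<close> of the atom \<open>l\<close>, by a biased coin that is tossed on that atom only.
\<close>

lemma pmf_spread:
  fixes x :: "'b pmf"
  assumes "c \<le> pmf x l" "0 \<le> c"
  obtains Y where "map_pmf snd Y = x"
    and "\<And>S. measure Y {y. fst y \<and> snd y \<in> S} = c * indicator S l"
    and "\<And>y. y \<in> set_pmf Y \<Longrightarrow> fst y \<Longrightarrow> snd y = l"
proof -
  define p where "p = c / pmf x l"
  have p: "0 \<le> p" "p \<le> 1" using assms by (auto simp: p_def divide_le_eq)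
  have pc: "p * pmf x l = c" using assms by (auto simp: p_def)
  define g where "g m = (if m = l then map_pmf (\<lambda>b. (b, m)) (bernoulli_pmf p) else return_pmf (False, m))" for m
  define Y where "Y = bind_pmf x g"
  have "map_pmf snd (g m) = return_pmf m" for m
    by (auto simp: g_def map_pmf_comp)
  then have "map_pmf snd Y = x"
    unfolding Y_def map_bind_pmf by (simp add: bind_return_pmf')
  moreover have "measure Y {y. fst y \<and> snd y \<in> S} = c * indicator S l" for S
  proof -
    have gm: "measure (g m) {y. fst y \<and> snd y \<in> S} = p * indicator S l * indicator {l} m" for m
    proof (cases "m = l")
      case True
      have "measure (g m) {y. fst y \<and> snd y \<in> S} = measure (bernoulli_pmf p) {b. b \<and> l \<in> S}"
        by (simp add: g_def True vimage_def)
      also have "{b. b \<and> l \<in> S} = (if l \<in> S then {True} else {})" by auto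
      finally show ?thesis using p True by (auto simp: measure_pmf_single)
    next
      case False
      then show ?thesis by (simp add: g_def)
    qed
    have "measure Y {y. fst y \<and> snd y \<in> S} = (\<integral>m. p * indicator S l * indicator {l} m \<partial>measure_pmf x)"
      unfolding Y_def measure_bind_pmf gm ..
    also have "\<dots> = p * indicator S l * pmf x l"
      by (simp add: measure_pmf_single)
    finally show ?thesis using pc by (simp add: mult_ac)
  qed
  moreover have "snd y = l" if "y \<in> set_pmf Y" "fst y" for y
    using that by (auto simp: Y_def g_def split: if_splits)
  ultimately show ?thesis using that by blast
qed

text \<open>
  Over each trace on \<open>D\<close> both distributions have the same mass, so the conditional distributions
  of \<open>x'\<close> given the trace define a kernel from \<open>x\<close> to \<open>x'\<close>. To make it send \<open>k\<close> to \<open>l\<close>, a part of the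
  atom \<open>l\<close> as large as the atom \<open>k\<close> is marked beforehand, and the mark is added to the trace.
\<close>

lemma fiber_transport_kernel:
  fixes x x' :: "'i set pmf"
  assumes same: "same_restr D x x'"
    and kl: "k \<inter> D = l \<inter> D" "pmf x k \<le> pmf x' l"
  obtains \<kappa> where "bind_pmf x \<kappa> = x'"
    and "k \<in> set_pmf x \<Longrightarrow> \<kappa> k = return_pmf l"
    and "\<And>m m'. m \<in> set_pmf x \<Longrightarrow> m' \<in> set_pmf (\<kappa> m) \<Longrightarrow> m' \<inter> D = m \<inter> D"
proof -
  obtain Y where Y: "map_pmf snd Y = x'"
    and Ym: "\<And>S. measure Y {y. fst y \<and> snd y \<in> S} = pmf x k * indicator S l"
    and Yl: "\<And>y. y \<in> set_pmf Y \<Longrightarrow> fst y \<Longrightarrow> snd y = l"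
    using pmf_spread[OF kl(2)] by auto
  define R where "R m y \<longleftrightarrow> fst y = (m = k) \<and> snd y \<inter> D = m \<inter> D" for m and y :: "bool \<times> 'i set"
  define X where "X = map_pmf (\<lambda>m. (m = k, m)) x"
  define RX where "RX v y \<longleftrightarrow> fst y = fst v \<and> snd y \<inter> D = snd v \<inter> D"
    for v and y :: "bool \<times> 'i set"
  have total: "measure Y {y. snd y \<inter> D = e} = measure x {m. m \<inter> D = e}" for e
  proof -
    have "measure Y {y. snd y \<inter> D = e} = measure x' {m. m \<inter> D \<in> {e}}"
      unfolding Y[symmetric] by (simp add: vimage_def)
    also have "\<dots> = measure x {m. m \<inter> D \<in> {e}}" using same_restrD[OF same] by metis
    finally show ?thesis by simp
  qed
  \<comment> \<open>marked or not, the mass over each trace is the same on both sides\<close>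
  have meq: "measure Y {y. fst y = b \<and> snd y \<inter> D = e} = measure X {v. fst v = b \<and> snd v \<inter> D = e}" for b e
  proof -
    have t: "measure Y {y. fst y = True \<and> snd y \<inter> D = e} = measure X {v. fst v = True \<and> snd v \<inter> D = e}" for e
    proof -
      have "measure Y {y. fst y = True \<and> snd y \<inter> D = e} = pmf x k * indicator {m. m \<inter> D = e} l"
        using Ym[of "{m. m \<inter> D = e}"] by simp
      also have "\<dots> = measure x {m. m = k \<and> m \<inter> D = e}"
      proof (cases "k \<inter> D = e")
        case True
        then have "{m. m = k \<and> m \<inter> D = e} = {k}" by auto
        then show ?thesis using True kl by (simp add: measure_pmf_single)
      next
        case False
        then have zero: "measure x {m. m = k \<and> m \<inter> D = e} = 0"
          by (auto simp: measure_pmf_zero_iff)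
        have "l \<inter> D \<noteq> e" using False kl(1) by simp
        then show ?thesis unfolding zero by simp
      qed
      also have "\<dots> = measure X {v. fst v = True \<and> snd v \<inter> D = e}"
        by (simp add: X_def vimage_def)
      finally show ?thesis .
    qed
    have X_total: "measure X {y. snd y \<inter> D = e} = measure x {m. m \<inter> D = e}"
      by (simp add: X_def vimage_def)
    have split: "measure Z {y. snd y \<inter> D = e} =
        measure Z {y. fst y = True \<and> snd y \<inter> D = e} + measure Z {y. fst y = False \<and> snd y \<inter> D = e}"
      for Z :: "(bool \<times> 'i set) pmf"
    proof -
      have "{y. snd y \<inter> D = e} = {y. fst y = True \<and> snd y \<inter> D = e} \<union> {y. fst y = False \<and> snd y \<inter> D = e}"
        by auto
      then show ?thesis
        by (metis (no_types, lifting) Collect_empty_eq_bot disjoint_iff mem_Collect_eq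
            measure_pmf.finite_measure_Union sets_measure_pmf UNIV_I)
    qed
    show ?thesis
    proof (cases b)
      case True
      then show ?thesis using t[of e] by simp
    next
      case False
      then show ?thesis using t[of e] split[of Y] split[of X] total[of e] X_total by simp
    qed
  qed
  have A1: "{y. RX v y} = {y. fst y = fst v \<and> snd y \<inter> D = snd v \<inter> D}" for v
    by (simp add: RX_def)
  have A2: "{u. RX u y} = {u. fst u = fst y \<and> snd u \<inter> D = snd y \<inter> D}" for y
    by (auto simp: RX_def)
  have RXm: "measure Y {y. RX v y} = measure X {u. RX u y}" if "RX v y" for v y
  proof -
    have v: "fst y = fst v" "snd y \<inter> D = snd v \<inter> D" using that by (auto simp: RX_def)
    show ?thesis unfolding A1 A2 v by (rule meq)
  qed
  have ne1: "set_pmf Y \<inter> {y. RX v y} \<noteq> {}" if "v \<in> set_pmf X" for v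
  proof -
    have "measure X {u. fst u = fst v \<and> snd u \<inter> D = snd v \<inter> D} \<noteq> 0"
      using that by (auto simp: measure_pmf_zero_iff)
    then show ?thesis unfolding A1 measure_pmf_zero_iff[symmetric] meq .
  qed
  have ne2: "set_pmf X \<inter> {v. RX v y} \<noteq> {}" if "y \<in> set_pmf Y" for y
  proof -
    have "measure Y {z. fst z = fst y \<and> snd z \<inter> D = snd y \<inter> D} \<noteq> 0"
      using that by (auto simp: measure_pmf_zero_iff)
    then show ?thesis unfolding A2 measure_pmf_zero_iff[symmetric] meq .
  qed
  define \<kappa> where "\<kappa> m = map_pmf snd (cond_pmf Y {y. RX (m = k, m) y})" for m
  have "bind_pmf X (\<lambda>v. cond_pmf Y {y. RX v y}) = Y"
    by (rule bind_cond_pmf_cancel) (use ne1 ne2 RXm in auto)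
  then have "bind_pmf x \<kappa> = x'"
    unfolding \<kappa>_def Y[symmetric] X_def map_bind_pmf[symmetric] bind_map_pmf by simp
  moreover have in_set: "set_pmf (\<kappa> m) = snd ` (set_pmf Y \<inter> {y. RX (m = k, m) y})" if "m \<in> set_pmf x" for m
  proof -
    have "(m = k, m) \<in> set_pmf X" using that by (auto simp: X_def)
    then show ?thesis unfolding \<kappa>_def by (simp add: set_cond_pmf[OF ne1])
  qed
  have "\<kappa> k = return_pmf l" if "k \<in> set_pmf x"
  proof -
    have "set_pmf (\<kappa> k) \<subseteq> {l}" unfolding in_set[OF that] using Yl by (auto simp: RX_def)
    then show ?thesis by (simp add: set_pmf_subset_singleton)
  qed
  moreover have "m' \<inter> D = m \<inter> D" if "m \<in> set_pmf x" "m' \<in> set_pmf (\<kappa> m)" for m m'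
    using that in_set[of m] by (auto simp: RX_def)
  ultimately show ?thesis using that by blast
qed

locale pair_family =
  fixes K :: "'i set set"
  assumes finite_mem: "m \<in> K \<Longrightarrow> finite m"
    and card_mem: "m \<in> K \<Longrightarrow> card m \<le> 2"
    and down: "m \<in> K \<Longrightarrow> m' \<subseteq> m \<Longrightarrow> m' \<in> K"
    and empty_mem: "{} \<in> K"
begin

abbreviation fle :: "'i set \<Rightarrow> 'i set pmf \<Rightarrow> 'i set pmf \<Rightarrow> bool" where
  "fle D \<equiv> fiber_le (pmf_space K) (same_restr D)"

lemma finite_approx_support:
  assumes "x \<in> pmfs_on K" "e > 0"
  obtains F where "finite F" "F \<subseteq> set_pmf x" "measure x F > 1 - e" "finite (\<Union>F)"
proof -
  obtain F where "finite F" "F \<subseteq> set_pmf x" "measure x F > 1 - e"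
    using pmf_finite_approx[OF assms(2)] by blast
  moreover from this have "finite (\<Union>F)"
    using assms(1) finite_mem by (auto simp: pmfs_on_def)
  ultimately show ?thesis using that by blast
qed

text \<open>
  Moving the mass of \<open>k\<close> to \<open>insert d k\<close>, for some \<open>d \<in> Z\<close> that the given windows do not see,
  stays in every prescribed neighborhood of \<open>x\<close>. A distribution near \<open>y\<close> with the same restriction
  carries this mass on sets that contain \<open>d\<close>; without \<open>d\<close>, these sets look like some \<open>l\<close> in \<open>B\<close>.
  So \<open>y\<close> already carries the mass on \<open>B\<close>.
\<close>

lemma fiber_le_atom_bound:
  assumes x: "x \<in> pmfs_on K" and y: "y \<in> pmfs_on K" and le: "fle D x y"
    and k: "k \<in> K" and Z: "Z \<subseteq> D" "infinite Z" "\<And>d. d \<in> Z \<Longrightarrow> insert d k \<in> K"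
    and B: "\<And>l d. l \<in> K \<Longrightarrow> l \<inter> D = k \<inter> D \<Longrightarrow> d \<in> Z \<Longrightarrow> d \<notin> l \<Longrightarrow> insert d l \<in> K \<Longrightarrow> l \<in> B"
  shows "pmf x k \<le> measure y B"
proof (rule ccontr)
  assume neg: "\<not> ?thesis"
  define \<eta> where "\<eta> = (pmf x k - measure y B) / 2"
  have \<eta>: "\<eta> > 0" using neg by (simp add: \<eta>_def)
  obtain F where F: "finite F" "F \<subseteq> set_pmf y" "measure y F > 1 - \<eta>" "finite (\<Union>F)"
    using finite_approx_support[OF y \<eta>] by blast
  define G where "G = \<Union>F \<union> k"
  have G: "finite G" "k \<subseteq> G" using F finite_mem[OF k] by (auto simp: G_def)
  have "y \<in> pmf_nhd K G \<eta> y" using y \<eta> by (simp add: pmf_nhd_def close_pmf_refl)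
  then obtain V where V: "openin (pmf_space K) V" "x \<in> V"
    and VU: "\<And>v. v \<in> V \<Longrightarrow> \<exists>u\<in>pmf_nhd K G \<eta> y. same_restr D v u"
    using le openin_pmf_nhd[OF G(1)] unfolding fiber_le_def by meson
  obtain G1 \<eta>1 where G1: "finite G1" "\<eta>1 > 0" "pmf_nhd K G1 \<eta>1 x \<subseteq> V"
    using V unfolding openin_pmf_space by blast
  obtain d where d: "d \<in> Z" "d \<notin> G" "d \<notin> G1"
    using Z(2) G(1) G1(1) by (metis Diff_iff UnCI finite_Diff2 finite_UnI finite.emptyI infinite_imp_nonempty all_not_in_conv)
  \<comment> \<open>the perturbation of \<open>x\<close>, which the window \<open>G1\<close> does not notice\<close>
  define x1 where "x1 = map_pmf (\<lambda>m. if m = k then insert d m else m) x"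
  have "x1 \<in> pmfs_on K" using x Z(3)[OF d(1)] by (auto simp: x1_def pmfs_on_def)
  moreover have "restr_pmf G1 x1 = restr_pmf G1 x"
    unfolding restr_pmf_def x1_def map_pmf_comp using d(3) by (intro map_pmf_cong) auto
  ultimately have "x1 \<in> V" using G1 by (auto simp: pmf_nhd_def close_pmf_def)
  then obtain u where u: "u \<in> pmf_nhd K G \<eta> y" "same_restr D x1 u" using VU by blast
  let ?e = "insert d (k \<inter> D)"
  have dD: "d \<in> D" using d Z by blast
  have "pmf x k \<le> measure x1 {m. m \<inter> D \<in> {?e}}"
    unfolding x1_def using dD by (auto intro!: pmf_le_measure simp: vimage_def)
  also have "\<dots> = measure u {m. m \<inter> D \<in> {?e}}" using same_restrD[OF u(2)] .
  also have "\<dots> \<le> measure u {m. m \<inter> G \<in> B}"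
  proof (rule measure_pmf_mono_on)
    fix m assume "m \<in> set_pmf u" "m \<in> {m. m \<inter> D \<in> {?e}}"
    then have m: "m \<in> K" "m \<inter> D = ?e" using u(1) by (auto simp: pmf_nhd_def pmfs_on_def)
    have "m \<inter> G \<inter> D = k \<inter> D" using m(2) G(2) d(2) by auto
    moreover have "insert d (m \<inter> G) \<in> K"
      by (rule down[OF m(1)]) (use m(2) in auto)
    moreover have "m \<inter> G \<in> K" by (rule down[OF m(1)]) auto
    ultimately show "m \<in> {m. m \<inter> G \<in> B}" using B d by auto
  qed
  also have "\<dots> < measure y {m. m \<inter> G \<in> B} + \<eta>"
    using close_pmfD[of G \<eta> y u B] u(1) by (auto simp: pmf_nhd_def)
  also have "measure y {m. m \<inter> G \<in> B} \<le> measure y (B \<union> - F)"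
    by (rule measure_pmf.finite_measure_mono) (auto simp: G_def Int_absorb2 Union_upper le_supI1)
  also have "\<dots> \<le> measure y B + measure y (- F)"
    by (rule measure_subadditive) auto
  also have "measure y (- F) = 1 - measure y F"
    using measure_pmf.prob_compl[of F y] by (simp add: Compl_eq_Diff_UNIV)
  finally show False using F(3) by (simp add: \<eta>_def field_simps)
qed

text \<open>
  A converse of the previous bound, for distributions whose atoms other than \<open>k\<close> are full. Near
  \<open>x\<close>, a set that looks like a two-element atom is that atom, and is moved along a kernel from \<open>x\<close>
  to \<open>x'\<close> that respects traces. A set that looks like \<open>k\<close> is \<open>k\<close> together with at most some unseen
  points; it is moved to \<open>l\<close> together with its trace on \<open>D\<close>, which is admissible by the last
  hypothesis. The result is near \<open>x'\<close> and has the same restriction to \<open>D\<close>.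
\<close>

lemma fiber_le_transport:
  assumes x: "x \<in> pmfs_on K" and x': "x' \<in> pmfs_on K" and same: "same_restr D x x'"
    and dead: "\<And>m. m \<in> set_pmf x \<Longrightarrow> m \<noteq> k \<Longrightarrow> card m = 2"
    and k: "k \<in> K" and l: "l \<in> K"
    and kl: "k \<inter> D = l \<inter> D" "pmf x k \<le> pmf x' l"
    and ext: "\<And>e. e \<subseteq> D \<Longrightarrow> k \<union> e \<in> K \<Longrightarrow> l \<union> e \<in> K"
  shows "fle D x x'"
  unfolding fiber_le_def
proof (intro allI impI)
  fix U assume U: "openin (pmf_space K) U \<and> x' \<in> U"
  then obtain G0 \<eta> where G0: "finite G0" "\<eta> > 0" "pmf_nhd K G0 \<eta> x' \<subseteq> U"
    unfolding openin_pmf_space by blast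
  obtain \<kappa> where \<kappa>: "bind_pmf x \<kappa> = x'" "k \<in> set_pmf x \<Longrightarrow> \<kappa> k = return_pmf l"
    and \<kappa>D: "\<And>m m'. m \<in> set_pmf x \<Longrightarrow> m' \<in> set_pmf (\<kappa> m) \<Longrightarrow> m' \<inter> D = m \<inter> D"
    using fiber_transport_kernel[OF same kl] by blast
  have \<kappa>K: "set_pmf (\<kappa> m) \<subseteq> K" if "m \<in> set_pmf x" for m
    using x' that unfolding \<kappa>(1)[symmetric] pmfs_on_def by auto
  obtain F where F: "finite F" "F \<subseteq> set_pmf x" "measure x F > 1 - \<eta> / 3" "finite (\<Union>F)"
    using finite_approx_support[OF x, of "\<eta> / 3"] G0(2) by auto
  define G where "G = G0 \<union> \<Union>F \<union> k"
  define \<delta> where "\<delta> = \<eta> / (3 * (card F + 1))"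
  have \<delta>: "\<delta> > 0" "card F * \<delta> \<le> \<eta> / 3" using G0(2) by (auto simp: \<delta>_def field_simps)
  have G: "finite G" using F G0 finite_mem[OF k] by (auto simp: G_def)
  \<comment> \<open>the kernel that turns a distribution near \<open>x\<close> into one near \<open>x'\<close> with the same restriction\<close>
  define \<theta> where "\<theta> m = (if m \<inter> G = k then return_pmf (l \<union> (m \<inter> D))
      else if m \<in> set_pmf x then \<kappa> m else return_pmf m)" for m
  have "\<exists>u\<in>U. same_restr D v u" if v: "v \<in> pmf_nhd K G \<delta> x" for v
  proof (intro bexI)
    define u where "u = bind_pmf v \<theta>"
    have vK: "\<And>m. m \<in> set_pmf v \<Longrightarrow> m \<in> K" using v by (auto simp: pmf_nhd_def pmfs_on_def)
    have \<theta>K: "set_pmf (\<theta> m) \<subseteq> K" if m: "m \<in> set_pmf v" for m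
    proof (cases "m \<inter> G = k")
      case True
      have "k \<union> (m \<inter> D) \<in> K" by (rule down[OF vK[OF m]]) (use True in auto)
      then have "l \<union> (m \<inter> D) \<in> K" by (intro ext) auto
      then show ?thesis using True by (simp add: \<theta>_def)
    next
      case False
      then show ?thesis using \<kappa>K vK[OF m] by (auto simp: \<theta>_def)
    qed
    have uK: "u \<in> pmfs_on K" using \<theta>K by (auto simp: u_def pmfs_on_def)
    have "map_pmf (\<lambda>m'. m' \<inter> D) (\<theta> m) = return_pmf (m \<inter> D)" for m
    proof -
      have "set_pmf (map_pmf (\<lambda>m'. m' \<inter> D) (\<theta> m)) \<subseteq> {m \<inter> D}"
        using \<kappa>D kl(1) by (auto simp: \<theta>_def split: if_splits)
      then show ?thesis unfolding set_pmf_subset_singleton .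
    qed
    then show "same_restr D v u"
      unfolding same_restr_def restr_pmf_def u_def map_bind_pmf
      by (simp add: map_pmf_def)
    have "close_pmf G0 \<eta> x' u"
    proof (rule close_pmfI)
      fix A
      define B where "B = {m. m \<inter> G0 \<in> A}"
      define \<psi> where "\<psi> j = measure (\<kappa> j) B" for j
      have \<psi>01: "0 \<le> \<psi> j" "\<psi> j \<le> 1" for j by (auto simp: \<psi>_def)
      \<comment> \<open>within the window, \<open>\<theta>\<close> acts on a set that looks like an atom \<open>j\<close> as \<open>\<kappa>\<close> acts on \<open>j\<close>\<close>
      have hit: "measure (\<theta> m) B = \<psi> j" if m: "m \<in> set_pmf v" and j: "m \<inter> G = j" "j \<in> F" for m j
      proof (cases "j = k")
        case True
        have "l \<union> (m \<inter> D) \<in> B \<longleftrightarrow> l \<in> B"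
        proof -
          have "m \<inter> D \<inter> G0 \<subseteq> m \<inter> G \<inter> D" by (auto simp: G_def)
          also have "\<dots> \<subseteq> l" using j(1) True kl(1) by auto
          finally have "(l \<union> (m \<inter> D)) \<inter> G0 = l \<inter> G0" by auto
          then show ?thesis by (simp add: B_def)
        qed
        then show ?thesis using True j F(2) \<kappa>(2) by (auto simp: \<theta>_def \<psi>_def)
      next
        case False
        have jm: "j \<subseteq> m" "card j = 2" using j F(2) dead False by auto
        have "j = m"
          using card_subset_eq[OF finite_mem[OF vK[OF m]] jm(1)]
            card_mono[OF finite_mem[OF vK[OF m]] jm(1)] card_mem[OF vK[OF m]] jm(2) by simp
        then show ?thesis using False j F(2) by (auto simp: \<theta>_def \<psi>_def)
      qed
      have "measure x' B \<le> (\<Sum>j\<in>F. pmf x j * \<psi> j) + \<eta> / 3"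
      proof -
        have "measure x' B = (\<integral>m. \<psi> m \<partial>measure_pmf x)"
          unfolding \<kappa>(1)[symmetric] measure_bind_pmf \<psi>_def ..
        also have "\<dots> \<le> (\<integral>m. (\<Sum>j\<in>F. \<psi> j * indicator {j} m) + indicator (- F) m \<partial>measure_pmf x)"
        proof (rule integral_mono)
          show "integrable x \<psi>"
            by (rule measure_pmf.integrable_const_bound[where B = 1]) (use \<psi>01 in auto)
          show "integrable x (\<lambda>m. (\<Sum>j\<in>F. \<psi> j * indicator {j} m) + indicator (- F) m :: real)"
            by (intro Bochner_Integration.integrable_add integrable_weighted_indicators)
              (auto intro: measure_pmf.integrable_const_bound[where B = 1])
          fix m
          show "\<psi> m \<le> (\<Sum>j\<in>F. \<psi> j * indicator {j} m) + indicator (- F) m"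
          proof (cases "m \<in> F")
            case True
            then have "(\<Sum>j\<in>F. \<psi> j * indicator {j} m) = \<psi> m"
              using F(1) by (simp add: indicator_def sum.remove[of F m])
            then show ?thesis by simp
          next
            case False
            have "0 \<le> (\<Sum>j\<in>F. \<psi> j * indicator {j} m)" using \<psi>01 by (intro sum_nonneg) auto
            then show ?thesis using False \<psi>01(2)[of m] by simp
          qed
        qed
        also have "\<dots> = (\<Sum>j\<in>F. pmf x j * \<psi> j) + measure x (- F)"
          by (subst Bochner_Integration.integral_add)
            (auto intro!: integrable_weighted_indicators measure_pmf.integrable_const_bound[where B = 1]
              simp: integral_weighted_indicators measure_pmf_single mult.commute)
        also have "measure x (- F) = 1 - measure x F"
          using measure_pmf.prob_compl[of F x] by (simp add: Compl_eq_Diff_UNIV)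
        finally show ?thesis using F(3) by linarith
      qed
      also have "(\<Sum>j\<in>F. pmf x j * \<psi> j) \<le> (\<Sum>j\<in>F. measure v {m. m \<inter> G = j} * \<psi> j + \<delta>)"
      proof (rule sum_mono)
        fix j assume "j \<in> F"
        then have "pmf x j \<le> measure x {m. m \<inter> G \<in> {j}}"
          by (intro pmf_le_measure) (auto simp: G_def)
        also have "\<dots> \<le> measure v {m. m \<inter> G \<in> {j}} + \<delta>"
          using close_pmfD[of G \<delta> x v "{j}"] v by (auto simp: pmf_nhd_def)
        finally have "pmf x j * \<psi> j \<le> (measure v {m. m \<inter> G = j} + \<delta>) * \<psi> j"
          using \<psi>01(1) by (intro mult_right_mono) auto
        also have "\<dots> \<le> measure v {m. m \<inter> G = j} * \<psi> j + \<delta>"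
          using \<psi>01(2)[of j] \<delta>(1) by (simp add: distrib_right mult_left_le)
        finally show "pmf x j * \<psi> j \<le> measure v {m. m \<inter> G = j} * \<psi> j + \<delta>" .
      qed
      also have "\<dots> \<le> (\<Sum>j\<in>F. measure v {m. m \<inter> G = j} * \<psi> j) + \<eta> / 3"
        using \<delta>(2) by (simp add: sum.distrib)
      also have "(\<Sum>j\<in>F. measure v {m. m \<inter> G = j} * \<psi> j) \<le> measure u B"
      proof -
        have "(\<Sum>j\<in>F. measure v {m. m \<inter> G = j} * \<psi> j) =
            (\<integral>m. (\<Sum>j\<in>F. \<psi> j * indicator {m. m \<inter> G = j} m) \<partial>measure_pmf v)"
          by (simp add: integral_weighted_indicators mult.commute)
        also have "\<dots> \<le> (\<integral>m. measure (\<theta> m) B \<partial>measure_pmf v)"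
        proof (rule integral_mono_AE)
          show "integrable v (\<lambda>m. \<Sum>j\<in>F. \<psi> j * indicator {m. m \<inter> G = j} m :: real)"
            by (rule integrable_weighted_indicators)
          show "integrable v (\<lambda>m. measure (\<theta> m) B)"
            by (rule measure_pmf.integrable_const_bound[where B = 1]) auto
          show "AE m in v. (\<Sum>j\<in>F. \<psi> j * indicator {m. m \<inter> G = j} m) \<le> measure (\<theta> m) B"
          proof (rule AE_pmfI)
            fix m assume m: "m \<in> set_pmf v"
            have "(\<Sum>j\<in>F. \<psi> j * indicator {m. m \<inter> G = j} m) = (\<Sum>j\<in>F. if j = m \<inter> G then \<psi> j else 0)"
              by (intro sum.cong) (auto simp: indicator_def)
            also have "\<dots> = (if m \<inter> G \<in> F then \<psi> (m \<inter> G) else 0)"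
              using F(1) by simp
            also have "\<dots> \<le> measure (\<theta> m) B" using hit[OF m] by auto
            finally show "(\<Sum>j\<in>F. \<psi> j * indicator {m. m \<inter> G = j} m) \<le> measure (\<theta> m) B" .
          qed
        qed
        also have "\<dots> = measure u B" by (simp add: u_def measure_bind_pmf)
        finally show ?thesis .
      qed
      finally show "measure u {m. m \<inter> G0 \<in> A} > measure x' {m. m \<inter> G0 \<in> A} - \<eta>"
        using G0(2) by (simp add: B_def)
    qed
    then show "u \<in> U" using uK G0(3) by (auto simp: pmf_nhd_def)
  qed
  moreover have "x \<in> pmf_nhd K G \<delta> x" using x \<delta>(1) by (simp add: pmf_nhd_def close_pmf_refl)
  ultimately show "\<exists>V. openin (pmf_space K) V \<and> x \<in> V \<and> (\<forall>v\<in>V. \<exists>u\<in>U. same_restr D v u)"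
    using openin_pmf_nhd[OF G] by blast
qed

end

lemma fiber_le_refl: "(\<And>v. E v v) \<Longrightarrow> fiber_le X E x x"
  unfolding fiber_le_def by blast

section \<open>Points with a linearly ordered fiber\<close>

text \<open>
  An order-theoretic description, invariant under homeomorphisms, of the distributions with a
  single one-element atom \<open>{q}\<close> and all other atoms of size two, inside the window. The members of
  the \<open>E\<close>-class of such a point differ only in how much of the mass seen as \<open>{q}\<close> has been completed
  outside the window, so the class is linearly ordered with the point on top.
\<close>

definition linear_points :: "'b topology \<Rightarrow> ('b \<Rightarrow> 'b \<Rightarrow> bool) \<Rightarrow> 'b set" where
  "linear_points X E = {x \<in> topspace X.
     (\<forall>y\<in>topspace X. \<forall>z\<in>topspace X. E x y \<longrightarrow> E x z \<longrightarrow> fiber_le X E y z \<or> fiber_le X E z y) \<and>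
     (\<forall>y\<in>topspace X. E x y \<longrightarrow> fiber_le X E y x) \<and>
     (\<exists>y\<in>topspace X. E x y \<and> \<not> fiber_le X E x y)}"

definition compat_sets :: "'n set \<Rightarrow> ('n \<Rightarrow> 'n \<Rightarrow> bool) \<Rightarrow> 'g set \<Rightarrow> ('n \<times> 'g) set set" where
  "compat_sets N cmp \<Gamma> = {m. m \<subseteq> N \<times> \<Gamma> \<and> finite m \<and> card m \<le> 2 \<and>
     (\<forall>p\<in>m. \<forall>q\<in>m. cmp (fst p) (fst q))}"

text \<open>
  Families of at most two points with compatible first coordinates. For the tree spaces
  compatibility is comparability.
\<close>

locale compat_nodes =
  fixes N :: "'n set" and cmp :: "'n \<Rightarrow> 'n \<Rightarrow> bool" and \<Gamma> :: "'g set"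
  assumes cmp_refl: "s \<in> N \<Longrightarrow> cmp s s"
    and cmp_sym: "cmp s t \<Longrightarrow> cmp t s"
begin

abbreviation "K \<equiv> compat_sets N cmp \<Gamma>"

sublocale pair_family K
proof
  fix m m' assume "m \<in> K" "m' \<subseteq> m"
  then show "m' \<in> K"
    using card_mono[of m m'] finite_subset[of m' m] by (auto simp: compat_sets_def)
qed (auto simp: compat_sets_def)

lemma singleton_mem: "p \<in> N \<times> \<Gamma> \<Longrightarrow> {p} \<in> K"
  by (auto simp: compat_sets_def cmp_refl)

lemma doubleton_mem:
  "p \<in> N \<times> \<Gamma> \<Longrightarrow> q \<in> N \<times> \<Gamma> \<Longrightarrow> cmp (fst p) (fst q) \<Longrightarrow> {p, q} \<in> K"
  by (auto simp: compat_sets_def cmp_refl cmp_sym card_insert_if)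

lemma singleton_mem_iff: "{p} \<in> K \<longleftrightarrow> p \<in> N \<times> \<Gamma>"
  by (auto simp: compat_sets_def cmp_refl)

lemma mem_compat: "m \<in> K \<Longrightarrow> p \<in> m \<Longrightarrow> q \<in> m \<Longrightarrow> cmp (fst p) (fst q)"
  by (auto simp: compat_sets_def)

lemma doubleton_max:
  assumes "m \<in> K" "j \<subseteq> m" "card j = 2"
  shows "m = j"
  using card_subset_eq[OF finite_mem[OF assms(1)] assms(2)]
    card_mono[OF finite_mem[OF assms(1)] assms(2)] card_mem[OF assms(1)] assms(3) by simp

lemma room_imp_card_le_1:
  assumes "insert d l \<in> K" "d \<notin> l"
  shows "card l \<le> 1" "finite l"
proof -
  have "finite (insert d l)" using assms(1) by (rule finite_mem)
  then show "finite l" by simp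
  then show "card l \<le> 1" using card_mem[OF assms(1)] assms(2) by simp
qed

lemma card_cases:
  assumes "m \<in> K"
  obtains "m = {}" | p where "m = {p}" "p \<in> N \<times> \<Gamma>" | "card m = 2"
proof -
  have "card m = 0 \<or> card m = 1 \<or> card m = 2" using card_mem[OF assms] by linarith
  then show ?thesis
    using that finite_mem[OF assms] assms by (auto simp: card_1_singleton_iff singleton_mem_iff)
qed

end

text \<open>
  A window is a product of a set of nodes and a set of labels. It must leave out a label, so that
  atoms inside it can be completed outside, and it must see two incompatible nodes, so that mass
  at the empty set makes a fiber nonlinear.
\<close>

locale window = compat_nodes N cmp \<Gamma>
  for N :: "'n set" and cmp :: "'n \<Rightarrow> 'n \<Rightarrow> bool" and \<Gamma> :: "'g set" +
  fixes S :: "'n set" and \<Delta> :: "'g set" and r :: 'n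
  assumes S: "S \<subseteq> N" and \<Delta>: "\<Delta> \<subseteq> \<Gamma>" "infinite \<Delta>"
    and outside: "\<Gamma> - \<Delta> \<noteq> {}"
    and split: "\<exists>s\<in>S. \<exists>s'\<in>S. \<not> cmp s s'"
    and root: "r \<in> S" "\<And>t. t \<in> N \<Longrightarrow> cmp r t"
begin

abbreviation "D \<equiv> S \<times> \<Delta>"

lemma D_sub: "D \<subseteq> N \<times> \<Gamma>"
  using S \<Delta> by auto

text \<open>
  Adding an unseen point \<open>(fst q, \<gamma>)\<close> of the window to \<open>{q}\<close> is possible, and \<open>{q}\<close> is the only set
  with this trace that has room for it.
\<close>

lemma singleton_bound:
  assumes x: "x \<in> pmfs_on K" "y \<in> pmfs_on K" "fle D x y" and q: "q \<in> D"
  shows "pmf x {q} \<le> pmf y {q}"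
proof -
  have "pmf x {q} \<le> measure y {{q}}"
  proof (rule fiber_le_atom_bound[where Z = "{fst q} \<times> \<Delta> - {q}"])
    have "infinite ({fst q} \<times> \<Delta>)" using \<Delta>(2) by (auto simp: finite_cartesian_product_iff)
    then show "infinite ({fst q} \<times> \<Delta> - {q})" by simp
    show "{fst q} \<times> \<Delta> - {q} \<subseteq> D" using q by auto
    show "{q} \<in> K" using q D_sub by (intro singleton_mem) auto
    show "insert d {q} \<in> K" if "d \<in> {fst q} \<times> \<Delta> - {q}" for d
      using that q D_sub cmp_refl by (intro doubleton_mem) auto
    fix l d assume l: "l \<inter> D = {q} \<inter> D" "d \<notin> l" "insert d l \<in> K"
    have "q \<in> l" using l(1) q by auto
    moreover have "card l \<le> 1" "finite l" using room_imp_card_le_1[OF l(3,2)] .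
    ultimately show "l \<in> {{q}}"
      by (auto simp: card_le_Suc0_iff_eq)
  qed (use x in auto)
  then show ?thesis by (simp add: measure_pmf_single)
qed

text \<open>
  Mass on an atom outside the window may be completed by a point of the window over any compatible
  node \<open>s\<close>; in \<open>y\<close> it must then sit on sets that are compatible with \<open>s\<close> as well.
\<close>

lemma free_bound:
  assumes x: "x \<in> pmfs_on K" "y \<in> pmfs_on K" "fle D x y"
    and q: "q \<in> N \<times> \<Gamma>" "q \<notin> D" and s: "s \<in> S" "cmp s (fst q)"
  shows "pmf x {q} \<le> measure y {l. l \<inter> D = {} \<and> card l \<le> 1 \<and> (\<forall>p\<in>l. cmp s (fst p))}"
proof (rule fiber_le_atom_bound[where Z = "{s} \<times> \<Delta>" and k = "{q}"])
  show "infinite ({s} \<times> \<Delta>)" using \<Delta>(2) by (auto simp: finite_cartesian_product_iff)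
  show "{s} \<times> \<Delta> \<subseteq> D" using s by auto
  show "{q} \<in> K" using q by (intro singleton_mem)
  show "insert d {q} \<in> K" if "d \<in> {s} \<times> \<Delta>" for d
    using that q s D_sub by (intro doubleton_mem) auto
  fix l d assume l: "l \<inter> D = {q} \<inter> D" "d \<in> {s} \<times> \<Delta>" "d \<notin> l" "insert d l \<in> K"
  have "card l \<le> 1" using room_imp_card_le_1[OF l(4,3)] by simp
  moreover have "cmp s (fst p)" if "p \<in> l" for p
    using mem_compat[OF l(4), of d p] l(2) that by auto
  ultimately show "l \<in> {l. l \<inter> D = {} \<and> card l \<le> 1 \<and> (\<forall>p\<in>l. cmp s (fst p))}"
    using l(1) q(2) by auto
qed (use x in auto)

lemma same_restr_restr: "same_restr D x (restr_pmf D x)"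
  by (simp add: same_restr_def restr_pmf_def map_pmf_comp)

lemma restr_in_pmfs: "x \<in> pmfs_on K \<Longrightarrow> restr_pmf D x \<in> pmfs_on K"
  using down by (auto simp: pmfs_on_def restr_pmf_def)

lemma set_restr_pmf: "set_pmf (restr_pmf D x) = (\<lambda>m. m \<inter> D) ` set_pmf x"
  by (simp add: restr_pmf_def)

lemma same_restr_map:
  assumes "\<And>m. m \<in> set_pmf x \<Longrightarrow> g m \<inter> D = m \<inter> D"
  shows "same_restr D x (map_pmf g x)"
  unfolding same_restr_def restr_pmf_def map_pmf_comp
  using assms by (intro map_pmf_cong) auto

lemma same_restr_trans: "same_restr D x y \<Longrightarrow> same_restr D y z \<Longrightarrow> same_restr D x z"
  and same_restr_sym: "same_restr D x y \<Longrightarrow> same_restr D y x"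
  and same_restr_refl: "same_restr D x x"
  by (auto simp: same_restr_def)

text \<open>
  In every member of the fiber all atoms other than \<open>{q}\<close> have two elements, so
  \<open>fiber_le_transport\<close> compares any two members by the mass at \<open>{q}\<close>. Completing \<open>{q}\<close> by a label outside the window gives a member
  strictly below.
\<close>

lemma linear_pointI:
  assumes x: "x \<in> pmfs_on K" and q: "q \<in> D" "{q} \<in> set_pmf x"
    and atoms: "\<And>m. m \<in> set_pmf x \<Longrightarrow> m \<subseteq> D \<and> (m = {q} \<or> card m = 2)"
  shows "x \<in> linear_points (pmf_space K) (same_restr D)"
proof -
  have qK: "{q} \<in> K" using q D_sub by (intro singleton_mem) auto
  have dead: "card m = 2" if h: "y \<in> pmfs_on K" "same_restr D x y" "m \<in> set_pmf y" "m \<noteq> {q}" for y m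
  proof -
    obtain m0 where m0: "m0 \<in> set_pmf x" "m0 \<inter> D = m \<inter> D"
      using same_restr_set_pmf[OF same_restr_sym[OF h(2)] h(3)] by blast
    then have m0m: "m \<inter> D = m0" using atoms by auto
    have mK: "m \<in> K" using h by (auto simp: pmfs_on_def)
    from mK show ?thesis
    proof (cases rule: card_cases)
      case 1 then show ?thesis using m0m atoms[OF m0(1)] by auto
    next
      case (2 p)
      then have "m0 = {} \<or> m0 = {p}" using m0m by blast
      then have "m0 = {p}" using atoms[OF m0(1)] by auto
      then have "{p} = {q}" using atoms[OF m0(1)] by auto
      then show ?thesis using 2(1) h(4) by simp
    qed
  qed
  have le: "fle D y z" if "y \<in> pmfs_on K" "z \<in> pmfs_on K" "same_restr D x y" "same_restr D x z"
    "pmf y {q} \<le> pmf z {q}" for y z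
    using that dead[of y]
    by (intro fiber_le_transport[where k = "{q}" and l = "{q}"] qK)
      (auto intro: same_restr_trans same_restr_sym)
  have max: "pmf y {q} \<le> pmf x {q}" if "y \<in> pmfs_on K" "same_restr D x y" for y
  proof -
    have "pmf y {q} \<le> measure y {m. m \<inter> D \<in> {{q}}}" using q by (intro pmf_le_measure) auto
    also have "\<dots> = measure x {m. m \<inter> D \<in> {{q}}}" using same_restrD[OF that(2)] by metis
    also have "\<dots> \<le> measure x {{q}}" using atoms by (intro measure_pmf_mono_on) auto
    finally show ?thesis by (simp add: measure_pmf_single)
  qed
  obtain \<gamma> where \<gamma>: "\<gamma> \<in> \<Gamma>" "\<gamma> \<notin> \<Delta>" using outside by auto
  define o' where "o' = (fst q, \<gamma>)"
  define y where "y = map_pmf (\<lambda>m. if m = {q} then {q, o'} else m) x"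
  have "{q, o'} \<in> K" using q D_sub \<gamma> cmp_refl by (intro doubleton_mem) (auto simp: o'_def)
  then have y: "y \<in> pmfs_on K" using x by (auto simp: y_def pmfs_on_def)
  have same: "same_restr D x y"
    unfolding y_def using q \<gamma> by (intro same_restr_map) (auto simp: o'_def)
  have "\<not> fle D x y"
  proof
    assume "fle D x y"
    then have "pmf x {q} \<le> pmf y {q}" using singleton_bound x y q by blast
    moreover have "{q} \<notin> set_pmf y" using q \<gamma> by (auto simp: y_def o'_def doubleton_eq_iff)
    ultimately have "pmf x {q} \<le> 0" by (simp add: set_pmf_iff)
    then show False using q(2) pmf_positive[OF q(2)] by simp
  qed
  then have "\<exists>y\<in>pmfs_on K. same_restr D x y \<and> \<not> fle D x y" using y same by blast
  moreover have "fle D y x" if "y \<in> pmfs_on K" "same_restr D x y" for y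
    using le[OF that(1) x that(2) same_restr_refl max[OF that]] .
  moreover have "fle D y z \<or> fle D z y"
    if "y \<in> pmfs_on K" "z \<in> pmfs_on K" "same_restr D x y" "same_restr D x z" for y z
    using le[OF that] le[OF that(2,1,4,3)] linear by blast
  ultimately show ?thesis using x unfolding linear_points_def by simp
qed

text \<open>
  The restriction of \<open>x\<close> belongs to the fiber. If it had mass at the empty set, that mass could be
  put over either of two incompatible nodes, outside the window; if it had two one-element atoms,
  either of them could be completed outside the window. Both give incomparable members. If it had
  no one-element atom, the fiber would be a single point. So it has exactly one, and since \<open>x\<close> is
  on top of its fiber, \<open>x\<close> has the same atoms.
\<close>

lemma linear_pointD:
  assumes L: "x \<in> linear_points (pmf_space K) (same_restr D)"
  obtains q where "x \<in> pmfs_on K" "q \<in> D" "{q} \<in> set_pmf x"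
    "\<And>m. m \<in> set_pmf x \<Longrightarrow> m \<subseteq> D \<and> (m = {q} \<or> card m = 2)"
proof -
  have x: "x \<in> pmfs_on K"
    and total: "\<And>y z. y \<in> pmfs_on K \<Longrightarrow> z \<in> pmfs_on K \<Longrightarrow> same_restr D x y \<Longrightarrow> same_restr D x z \<Longrightarrow>
      fle D y z \<or> fle D z y"
    and top: "\<And>y. y \<in> pmfs_on K \<Longrightarrow> same_restr D x y \<Longrightarrow> fle D y x"
    using L unfolding linear_points_def by auto
  obtain y0 where y0: "y0 \<in> pmfs_on K" "same_restr D x y0" "\<not> fle D x y0"
    using L unfolding linear_points_def by auto
  obtain \<gamma> where \<gamma>: "\<gamma> \<in> \<Gamma>" "\<gamma> \<notin> \<Delta>" using outside by auto
  define \<rho> where "\<rho> = restr_pmf D x"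
  have \<rho>: "\<rho> \<in> pmfs_on K" "same_restr D x \<rho>"
    using x by (auto simp: \<rho>_def restr_in_pmfs same_restr_restr)
  have \<rho>D: "m \<in> set_pmf \<rho> \<Longrightarrow> m \<subseteq> D" for m by (auto simp: \<rho>_def set_restr_pmf)
  have \<rho>K: "m \<in> set_pmf \<rho> \<Longrightarrow> m \<in> K" for m using \<rho>(1) by (auto simp: pmfs_on_def)
  have empty: "{} \<notin> set_pmf \<rho>"
  proof
    assume e: "{} \<in> set_pmf \<rho>"
    define y where "y s = map_pmf (\<lambda>m. if m = {} then {(s, \<gamma>)} else m) \<rho>" for s
    have yK: "y s \<in> pmfs_on K" if "s \<in> S" for s
      using \<rho>(1) that S \<gamma> singleton_mem[of "(s, \<gamma>)"] by (auto simp: y_def pmfs_on_def)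
    have ysame: "same_restr D x (y s)" for s
      unfolding y_def by (rule same_restr_trans[OF \<rho>(2)], rule same_restr_map) (use \<gamma> in auto)
    \<comment> \<open>the mass at \<open>(s, \<gamma>)\<close> can still be completed over \<open>s\<close>, the mass at \<open>(s', \<gamma>)\<close> cannot\<close>
    have incomp: "\<not> fle D (y s) (y s')" if s: "s \<in> S" "s' \<in> S" "\<not> cmp s s'" for s s'
    proof
      assume "fle D (y s) (y s')"
      then have "pmf (y s) {(s, \<gamma>)} \<le>
          measure (y s') {l. l \<inter> D = {} \<and> card l \<le> 1 \<and> (\<forall>p\<in>l. cmp s (fst p))}"
        using s S \<gamma> cmp_refl by (intro free_bound yK) auto
      also have "\<dots> = 0"
        using s(3) \<rho>D by (auto simp: measure_pmf_zero_iff y_def split: if_splits)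
      finally have "(s, \<gamma>) \<notin> \<Union>{m. m = {(s, \<gamma>)} \<and> m \<in> set_pmf (y s)}"
        by (auto simp: set_pmf_iff)
      moreover have "{(s, \<gamma>)} \<in> set_pmf (y s)" using e by (force simp: y_def)
      ultimately show False by blast
    qed
    obtain s s' where s: "s \<in> S" "s' \<in> S" "\<not> cmp s s'" using split by blast
    moreover have "\<not> cmp s' s" using s cmp_sym by blast
    ultimately show False using incomp total yK ysame by metis
  qed
  have self: "z = \<rho>" if "z \<in> pmfs_on K" "same_restr D x z" "\<And>m. m \<in> set_pmf \<rho> \<Longrightarrow> card m = 2" for z
  proof -
    have "restr_pmf D z = \<rho>" using that(2) by (simp add: \<rho>_def same_restr_def)
    moreover have "restr_pmf D z = map_pmf id z"
      unfolding restr_pmf_def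
    proof (rule map_pmf_cong[OF refl])
      fix m assume m: "m \<in> set_pmf z"
      then have "m \<inter> D \<in> set_pmf \<rho>" using calculation by (auto simp: restr_pmf_def)
      then have "card (m \<inter> D) = 2" by (rule that(3))
      then have "m = m \<inter> D" using m that(1) by (intro doubleton_max) (auto simp: pmfs_on_def)
      then show "m \<inter> D = id m" by simp
    qed
    ultimately show ?thesis by simp
  qed
  have "\<exists>q. {q} \<in> set_pmf \<rho>"
  proof (rule ccontr)
    assume no: "\<nexists>q. {q} \<in> set_pmf \<rho>"
    have two: "card m = 2" if "m \<in> set_pmf \<rho>" for m
      using \<rho>K[OF that] by (cases rule: card_cases) (use that no empty in auto)
    have "x = y0" using self[OF x same_restr_refl two] self[OF y0(1,2) two] by simp
    then show False using y0(3) fiber_le_refl[of "same_restr D"] same_restr_refl by blast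
  qed
  then obtain q where q: "{q} \<in> set_pmf \<rho>" by blast
  have qD: "q \<in> D" using \<rho>D[OF q] by simp
  have unique: "q' = q" if q': "{q'} \<in> set_pmf \<rho>" for q'
  proof (rule ccontr)
    assume neq: "q' \<noteq> q"
    have q'D: "q' \<in> D" using \<rho>D[OF q'] by simp
    define z where "z p = map_pmf (\<lambda>m. if m = {p} then {p, (fst p, \<gamma>)} else m) \<rho>" for p
    have zK: "z p \<in> pmfs_on K" if "p \<in> D" for p
      using \<rho>(1) doubleton_mem[of p "(fst p, \<gamma>)"] that D_sub \<gamma> cmp_refl S
      by (auto simp: z_def pmfs_on_def)
    have zsame: "same_restr D x (z p)" if "p \<in> D" for p
      unfolding z_def by (rule same_restr_trans[OF \<rho>(2)], rule same_restr_map) (use \<gamma> that in auto)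
    have incomp: "\<not> fle D (z p) (z p')" if p: "p \<in> D" "p' \<in> D" "p \<noteq> p'" "{p'} \<in> set_pmf \<rho>" for p p'
    proof
      assume "fle D (z p) (z p')"
      then have "pmf (z p) {p'} \<le> pmf (z p') {p'}" using singleton_bound zK p by blast
      moreover have "{p'} \<notin> set_pmf (z p')" using p \<gamma> by (auto simp: z_def doubleton_eq_iff)
      moreover have "{p'} \<in> set_pmf (z p)" using p by (force simp: z_def)
      ultimately show False using pmf_positive[of "{p'}" "z p"] by (simp add: set_pmf_iff)
    qed
    show False
      using incomp[OF qD q'D _ q'] incomp[OF q'D qD _ q] neq
        total[OF zK[OF qD] zK[OF q'D] zsame[OF qD] zsame[OF q'D]] by auto
  qed
  have le: "pmf \<rho> {q} \<le> pmf x {q}"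
    by (rule singleton_bound[OF \<rho>(1) x top[OF \<rho>] qD])
  have pos: "pmf \<rho> {q} > 0" using q by (rule pmf_positive)
  have "{q} \<in> set_pmf x" using le pos by (simp add: set_pmf_iff)
  moreover have "m \<subseteq> D \<and> (m = {q} \<or> card m = 2)" if m: "m \<in> set_pmf x" for m
  proof -
    have mK: "m \<in> K" using m x by (auto simp: pmfs_on_def)
    have mD: "m \<inter> D \<in> set_pmf \<rho>" using m by (auto simp: \<rho>_def set_restr_pmf)
    from \<rho>K[OF mD] show ?thesis
    proof (cases rule: card_cases)
      case 1 then show ?thesis using mD empty by simp
    next
      case (2 p)
      then have p: "m \<inter> D = {q}" using mD unique by auto
      have "m = {q}"
      proof (rule ccontr)
        assume neq: "m \<noteq> {q}"
        have "pmf x m + pmf x {q} = measure x {m, {q}}"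
          using neq by (subst measure_measure_pmf_finite) auto
        also have "\<dots> \<le> measure x {m. m \<inter> D \<in> {{q}}}"
          by (rule measure_pmf.finite_measure_mono) (use p qD in auto)
        also have "\<dots> = measure \<rho> {m. m \<inter> D \<in> {{q}}}"
          using same_restrD[OF \<rho>(2)] by metis
        also have "\<dots> \<le> measure \<rho> {{q}}"
          by (rule measure_pmf_mono_on) (use \<rho>D in auto)
        finally show False
          using le pmf_positive[OF m] by (simp add: measure_pmf_single)
      qed
      then show ?thesis using qD by simp
    next
      case 3
      then have "m = m \<inter> D" using mK by (intro doubleton_max) auto
      then show ?thesis using 3 by auto
    qed
  qed
  ultimately show ?thesis using that[OF x qD] by blast
qed

end

section \<open>Points that represent nodes\<close>

text \<open>
  Three steps isolate the points that represent nodes. In the fiber of \<open>\<nu>\<close> over the window \<open>E\<close>, the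
  points that are linear for the larger window \<open>E'\<close> have one free point \<open>q\<close>, and are ordered by
  the mass at \<open>{q}\<close> together with the nodes compatible with \<open>q\<close>. If \<open>q\<close> is outside the window \<open>E\<close>
  and there is no infinite strict ascent, all the available mass is at \<open>{q}\<close>. If there are two
  incomparable points below, \<open>q\<close> is indeed outside \<open>E\<close>.
\<close>

definition ascent_free :: "'b set \<Rightarrow> ('b \<Rightarrow> 'b \<Rightarrow> bool) \<Rightarrow> 'b set" where
  "ascent_free P le = {x \<in> P. \<nexists>f :: nat \<Rightarrow> 'b. f 0 = x \<and>
     (\<forall>n. f n \<in> P \<and> le (f n) (f (Suc n)) \<and> \<not> le (f (Suc n)) (f n))}"

definition branching_points :: "'b set \<Rightarrow> ('b \<Rightarrow> 'b \<Rightarrow> bool) \<Rightarrow> 'b set" where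
  "branching_points P le = {x \<in> P. \<exists>y\<in>P. \<exists>z\<in>P. le y x \<and> le z x \<and> \<not> le y z \<and> \<not> le z y}"

definition linear_fiber :: "'b topology \<Rightarrow> ('b \<Rightarrow> 'b \<Rightarrow> bool) \<Rightarrow> ('b \<Rightarrow> 'b \<Rightarrow> bool) \<Rightarrow> 'b \<Rightarrow> 'b set" where
  "linear_fiber X E E' \<nu> = {x \<in> linear_points X E'. E \<nu> x}"

definition node_points :: "'b topology \<Rightarrow> ('b \<Rightarrow> 'b \<Rightarrow> bool) \<Rightarrow> ('b \<Rightarrow> 'b \<Rightarrow> bool) \<Rightarrow> 'b \<Rightarrow> 'b set" where
  "node_points X E E' \<nu> =
     branching_points (ascent_free (linear_fiber X E E' \<nu>) (fiber_le X E)) (fiber_le X E)"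

locale two_windows =
  inner: window N cmp \<Gamma> S \<Delta> r + outer: window N cmp \<Gamma> S' \<Delta>' r
  for N :: "'n set" and cmp :: "'n \<Rightarrow> 'n \<Rightarrow> bool" and \<Gamma> :: "'g set" and S \<Delta> r S' \<Delta>' +
  fixes \<gamma>0 :: 'g and \<nu> :: "('n \<times> 'g) set pmf"
  assumes sub: "S \<subseteq> S'" "\<Delta> \<subseteq> \<Delta>'"
    and \<gamma>0: "\<gamma>0 \<in> \<Delta>'" "\<gamma>0 \<notin> \<Delta>"
    and \<nu>: "\<nu> \<in> pmfs_on (compat_sets N cmp \<Gamma>)"
begin

abbreviation "K \<equiv> compat_sets N cmp \<Gamma>"
abbreviation "D \<equiv> S \<times> \<Delta>"
abbreviation "D' \<equiv> S' \<times> \<Delta>'"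
abbreviation "le \<equiv> fiber_le (pmf_space K) (same_restr D)"
abbreviation "L \<equiv> linear_points (pmf_space K) (same_restr D')"
abbreviation "P \<equiv> linear_fiber (pmf_space K) (same_restr D) (same_restr D') \<nu>"

text \<open>
  The point \<open>q\<close> of the only one-element atom \<open>{q}\<close> of a linear point.
\<close>

definition live :: "('n \<times> 'g) set pmf \<Rightarrow> 'n \<times> 'g" where
  "live x = (THE q. {q} \<in> set_pmf x)"

definition mass :: "('n \<times> 'g) set pmf \<Rightarrow> real" where
  "mass x = pmf x {live x}"

definition cone :: "'n \<Rightarrow> 'n set" where
  "cone t = {s \<in> S. cmp s t}"

text \<open>
  The mass that the smaller window sees at the empty set, which bounds the mass of any free point
  outside that window.
\<close>

definition \<epsilon> :: real where
  "\<epsilon> = pmf (restr_pmf D \<nu>) {}"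

lemma D'_sub: "D' \<subseteq> N \<times> \<Gamma>" by (rule outer.D_sub)

lemma linear_point_live:
  assumes "x \<in> L"
  shows "x \<in> pmfs_on K" "live x \<in> D'" "{live x} \<in> set_pmf x"
    "m \<in> set_pmf x \<Longrightarrow> m \<subseteq> D' \<and> (m = {live x} \<or> card m = 2)"
    "mass x > 0"
proof -
  obtain q where q: "x \<in> pmfs_on K" "q \<in> D'" "{q} \<in> set_pmf x"
    "\<And>m. m \<in> set_pmf x \<Longrightarrow> m \<subseteq> D' \<and> (m = {q} \<or> card m = 2)"
    using outer.linear_pointD[OF assms] by blast
  have "q' = q" if "{q'} \<in> set_pmf x" for q' using q(4)[OF that] by simp
  then have live: "live x = q" unfolding live_def using q(3) by (intro the_equality)
  show "x \<in> pmfs_on K" "live x \<in> D'" "{live x} \<in> set_pmf x"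
    unfolding live by (rule q)+
  show "mass x > 0" unfolding mass_def live by (rule pmf_positive[OF q(3)])
  show "m \<subseteq> D' \<and> (m = {live x} \<or> card m = 2)" if "m \<in> set_pmf x"
    unfolding live by (rule q(4)[OF that])
qed

lemma live_eq: "x \<in> L \<Longrightarrow> {q} \<in> set_pmf x \<Longrightarrow> live x = q"
  using linear_point_live(4)[of x "{q}"] by simp

lemma cone_nonempty: "t \<in> N \<Longrightarrow> r \<in> cone t"
  using inner.root by (auto simp: cone_def)

text \<open>
  If the free point \<open>q\<close> lies in \<open>D\<close>, its position is part of the common restriction. Otherwise its
  mass can be completed in \<open>D\<close> over every node of the cone of \<open>q\<close>, and over no other; so larger
  cones and larger masses are higher. The two directions are the bounds above and
  \<open>fiber_le_transport\<close>.
\<close>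

lemma le_iff:
  assumes x: "x \<in> L" and y: "y \<in> L" and same: "same_restr D x y"
  shows "le x y \<longleftrightarrow> mass x \<le> mass y \<and>
    (if live x \<in> D then live y = live x
     else live y \<notin> D \<and> cone (fst (live x)) \<subseteq> cone (fst (live y)))"
    (is "_ \<longleftrightarrow> ?rhs")
proof
  note X = linear_point_live[OF x] and Y = linear_point_live[OF y]
  assume le: "le x y"
  show ?rhs
  proof (cases "live x \<in> D")
    case True
    have b: "mass x \<le> pmf y {live x}"
      unfolding mass_def by (rule inner.singleton_bound[OF X(1) Y(1) le True])
    then have "{live x} \<in> set_pmf y" using X(5) by (simp add: set_pmf_iff)
    then have e: "live y = live x" by (rule live_eq[OF y])
    have "mass x \<le> mass y" using b unfolding mass_def e .
    then show ?thesis unfolding if_P[OF True] using e by blast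
  next
    case False
    have qN: "live x \<in> N \<times> \<Gamma>" by (rule subsetD[OF D'_sub X(2)])
    have *: "live y \<notin> D \<and> cmp s (fst (live y)) \<and> mass x \<le> mass y"
      if s: "s \<in> S" "cmp s (fst (live x))" for s
    proof -
      let ?B = "{l. l \<inter> D = {} \<and> card l \<le> 1 \<and> (\<forall>p\<in>l. cmp s (fst p))}"
      have b: "mass x \<le> measure y ?B"
        unfolding mass_def by (rule inner.free_bound[OF X(1) Y(1) le qN False s])
      then have "set_pmf y \<inter> ?B \<noteq> {}"
        using X(5) by (auto simp: measure_pmf_zero_iff[symmetric])
      then obtain l where l: "l \<in> set_pmf y" "l \<in> ?B" by blast
      then have "l = {live y}" using Y(4)[OF l(1)] by simp
      moreover have "measure y ?B \<le> measure y {{live y}}"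
      proof (rule measure_pmf_mono_on)
        fix m assume m: "m \<in> set_pmf y" "m \<in> ?B"
        then show "m \<in> {{live y}}" using Y(4)[OF m(1)] by simp
      qed
      ultimately show ?thesis using l b by (auto simp: mass_def measure_pmf_single)
    qed
    have "r \<in> S" "cmp r (fst (live x))"
      using inner.root(1) inner.root(2)[of "fst (live x)"] qN by (simp_all add: mem_Times_iff)
    note r = *[OF this]
    have "cone (fst (live x)) \<subseteq> cone (fst (live y))"
    proof
      fix s assume "s \<in> cone (fst (live x))"
      then have s: "s \<in> S" "cmp s (fst (live x))" by (simp_all add: cone_def)
      show "s \<in> cone (fst (live y))" using *[OF s] s(1) by (simp add: cone_def)
    qed
    then show ?thesis unfolding if_not_P[OF False] using r by (intro conjI) simp_all
  qed
next
  note X = linear_point_live[OF x] and Y = linear_point_live[OF y]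
  assume rhs: ?rhs
  have qN: "live x \<in> N \<times> \<Gamma>" "live y \<in> N \<times> \<Gamma>"
    using subsetD[OF D'_sub X(2)] subsetD[OF D'_sub Y(2)] by simp_all
  show "le x y"
  proof (rule inner.fiber_le_transport[where k = "{live x}" and l = "{live y}"])
    show "{live x} \<in> K" "{live y} \<in> K" by (rule inner.singleton_mem[OF qN(1)] inner.singleton_mem[OF qN(2)])+
    show "pmf x {live x} \<le> pmf y {live y}" using rhs by (simp add: mass_def)
    show "{live x} \<inter> D = {live y} \<inter> D" using rhs by (auto split: if_splits)
    show "card m = 2" if "m \<in> set_pmf x" "m \<noteq> {live x}" for m using X(4) that by blast
    fix e assume e: "e \<subseteq> D" "{live x} \<union> e \<in> K"
    show "{live y} \<union> e \<in> K"
    proof (cases "live x \<in> D")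
      case True then show ?thesis using rhs e by simp
    next
      case False
      have "live x \<notin> e" using False e(1) by auto
      then have c: "card e \<le> 1" "finite e" using inner.room_imp_card_le_1[of "live x" e] e(2) by auto
      show ?thesis
      proof (cases "e = {}")
        case True then show ?thesis using qN inner.singleton_mem by simp
      next
        case ne: False
        then obtain d where d: "e = {d}"
          using c by (metis One_nat_def card_1_singletonE card_gt_0_iff le_antisym less_eq_Suc_le)
        have "cmp (fst d) (fst (live x))" using inner.mem_compat[OF e(2), of d "live x"] d by auto
        then have "fst d \<in> cone (fst (live x))" using d e(1) by (auto simp: cone_def)
        then have "cmp (fst d) (fst (live y))" using rhs False by (auto simp: cone_def)
        then have "{d, live y} \<in> K"
          using d e(1) inner.D_sub qN by (intro inner.doubleton_mem) auto
        then show ?thesis using d by (simp add: insert_commute)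
      qed
    qed
  qed (use X Y same in auto)
qed

lemma le_iff':
  assumes "x \<in> P" "y \<in> P"
  shows "le x y \<longleftrightarrow> mass x \<le> mass y \<and>
    (if live x \<in> D then live y = live x
     else live y \<notin> D \<and> cone (fst (live x)) \<subseteq> cone (fst (live y)))"
proof -
  have "x \<in> L" "y \<in> L" "same_restr D x y"
    using assms by (auto simp: linear_fiber_def same_restr_def)
  then show ?thesis by (rule le_iff)
qed

lemma mass_le:
  assumes x: "x \<in> P" "live x \<notin> D"
  shows "mass x \<le> \<epsilon>"
proof -
  have s: "same_restr D \<nu> x" using x by (auto simp: linear_fiber_def)
  have "mass x \<le> measure x {m. m \<inter> D \<in> {{}}}"
    unfolding mass_def using x(2) by (intro pmf_le_measure) auto
  also have "\<dots> = measure (restr_pmf D x) {{}}" by (simp add: measure_restr_pmf)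
  also have "\<dots> = \<epsilon>" using s by (simp add: \<epsilon>_def same_restr_def measure_pmf_single)
  finally show ?thesis .
qed

text \<open>
  The point in the fiber of \<open>\<nu>\<close> that puts all the mass seen at the empty set on \<open>{q}\<close>. One-element
  atoms of the restriction are doubled over the same node, with the label \<open>\<gamma>0\<close> that only the larger
  window sees, so that \<open>{q}\<close> is the only one-element atom left.
\<close>

definition pt :: "'n \<times> 'g \<Rightarrow> ('n \<times> 'g) set pmf" where
  "pt q = map_pmf (\<lambda>m. if m = {} then {q} else if card m = 1 then m \<union> (\<lambda>p. (fst p, \<gamma>0)) ` m else m)
     (restr_pmf D \<nu>)"

lemma pt:
  assumes q: "q \<in> D'" "q \<notin> D" and pos: "\<epsilon> > 0"
  shows "pt q \<in> P" "live (pt q) = q" "mass (pt q) = \<epsilon>"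
proof -
  define g where "g m = (if m = {} then {q} else if card m = 1 then m \<union> (\<lambda>p. (fst p, \<gamma>0)) ` m else m)" for m
  define \<rho> where "\<rho> = restr_pmf D \<nu>"
  have ptg: "pt q = map_pmf g \<rho>" by (simp add: pt_def g_def[abs_def] \<rho>_def)
  have \<rho>: "m \<in> K" "m \<subseteq> D" if "m \<in> set_pmf \<rho>" for m
    using that inner.restr_in_pmfs[OF \<nu>] by (auto simp: \<rho>_def pmfs_on_def restr_pmf_def)
  have qN: "q \<in> N \<times> \<Gamma>" by (rule subsetD[OF D'_sub q(1)])
  have g: "g m \<in> K \<and> g m \<inter> D = m \<and> g m \<subseteq> D' \<and> (if m = {} then g m = {q} else card (g m) = 2)"
    if m: "m \<in> set_pmf \<rho>" for m
    using \<rho>(1)[OF m]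
  proof (cases rule: inner.card_cases)
    case 1
    then show ?thesis using q inner.singleton_mem[OF qN] by (auto simp: g_def)
  next
    case (2 p)
    obtain s \<gamma> where p: "p = (s, \<gamma>)" "s \<in> S" "\<gamma> \<in> \<Delta>" using \<rho>(2)[OF m] 2(1) by auto
    have gm: "g m = {(s, \<gamma>), (s, \<gamma>0)}" unfolding g_def 2(1) p(1) by auto
    have ne: "\<gamma> \<noteq> \<gamma>0" using p \<gamma>0 by auto
    have "{(s, \<gamma>), (s, \<gamma>0)} \<in> K"
      using p subsetD[OF inner.S p(2)] subsetD[OF inner.\<Delta>(1) p(3)] subsetD[OF outer.\<Delta>(1) \<gamma>0(1)]
      by (intro inner.doubleton_mem) (auto intro: inner.cmp_refl)
    moreover have "{(s, \<gamma>), (s, \<gamma>0)} \<inter> D = {p}" using p \<gamma>0 by auto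
    moreover have "{(s, \<gamma>), (s, \<gamma>0)} \<subseteq> D'" using p \<gamma>0 sub by auto
    moreover have "card {(s, \<gamma>), (s, \<gamma>0)} = 2" using ne by simp
    ultimately show ?thesis unfolding gm using 2(1) by simp
  next
    case 3
    then have "m \<noteq> {}" by auto
    then show ?thesis using 3 \<rho>[OF m] sub by (auto simp: g_def)
  qed
  have e: "{} \<in> set_pmf \<rho>" using pos by (simp add: \<epsilon>_def \<rho>_def set_pmf_iff)
  have same: "same_restr D \<nu> (pt q)"
  proof -
    have "restr_pmf D (map_pmf g \<rho>) = map_pmf id \<rho>"
      unfolding restr_pmf_def[of D "map_pmf g \<rho>"] map_pmf_comp
      by (intro map_pmf_cong) (use g in auto)
    then have "restr_pmf D (pt q) = map_pmf id \<rho>" unfolding ptg .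
    then show ?thesis by (simp add: same_restr_def \<rho>_def)
  qed
  have qin: "{q} \<in> set_pmf (pt q)" using e g[OF e] by (force simp: ptg)
  have L: "pt q \<in> L"
  proof (rule outer.linear_pointI[OF _ q(1) qin])
    show "pt q \<in> pmfs_on K" using g by (auto simp: ptg pmfs_on_def)
    fix m assume "m \<in> set_pmf (pt q)"
    then obtain m0 where "m0 \<in> set_pmf \<rho>" "m = g m0" by (auto simp: ptg)
    then show "m \<subseteq> D' \<and> (m = {q} \<or> card m = 2)" using g[of m0] by (auto split: if_splits)
  qed
  show "pt q \<in> P" using L same by (simp add: linear_fiber_def)
  show live: "live (pt q) = q" by (rule live_eq[OF L qin])
  have "measure (pt q) {{q}} = measure \<rho> {m. g m = {q}}" by (simp add: ptg vimage_def)
  also have "\<dots> = measure \<rho> {{}}"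
  proof -
    have "g m = {q} \<longleftrightarrow> m = {}" if "m \<in> set_pmf \<rho>" for m
      using g[OF that] by (cases "m = {}") auto
    then show ?thesis by (intro antisym measure_pmf_mono_on) auto
  qed
  finally show "mass (pt q) = \<epsilon>" by (simp add: mass_def live \<epsilon>_def \<rho>_def measure_pmf_single)
qed

text \<open>
  If the single point carries less than the mass available at the empty set, mixing with the
  extreme point \<open>pt\<close> gives a strictly ascending sequence.
\<close>

lemma ascent_free_mass:
  assumes x: "x \<in> ascent_free P le" "live x \<notin> D"
  shows "mass x = \<epsilon>"
proof (rule ccontr)
  assume neq: "mass x \<noteq> \<epsilon>"
  have xP: "x \<in> P" using x by (simp add: ascent_free_def)
  have xL: "x \<in> L" using xP by (simp add: linear_fiber_def)
  note X = linear_point_live[OF xL]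
  have lt: "mass x < \<epsilon>" using mass_le[OF xP x(2)] neq by simp
  then have pos: "\<epsilon> > 0" using X(5) by linarith
  let ?q = "live x"
  \<comment> \<open>the weight of the extreme point, increasing from \<open>0\<close>\<close>
  define w :: "nat \<Rightarrow> real" where "w n = n / (n + 1)" for n
  have w: "0 \<le> w n" "w n \<le> 1" "w n < w (Suc n)" "w 0 = 0" for n
    by (auto simp: w_def divide_simps) (simp add: algebra_simps)
  define f where "f n = bind_pmf (bernoulli_pmf (w n)) (\<lambda>b. if b then pt ?q else x)" for n
  note Q = pt[OF X(2) x(2) pos]
  have QL: "pt ?q \<in> L" using Q(1) by (simp add: linear_fiber_def)
  note Q' = linear_point_live[OF QL]
  have fL: "f n \<in> L" and qf: "{?q} \<in> set_pmf (f n)" for n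
  proof -
    show q: "{?q} \<in> set_pmf (f n)"
      using X(3) Q'(3) Q(2) set_pmf_not_empty[of "bernoulli_pmf (w n)"] unfolding f_def set_bind_pmf
      by auto
    show "f n \<in> L"
    proof (rule outer.linear_pointI[OF _ X(2) q])
      show "f n \<in> pmfs_on K" using X(1) Q'(1) by (auto simp: f_def pmfs_on_def split: if_splits)
      fix m assume "m \<in> set_pmf (f n)"
      then have "m \<in> set_pmf x \<or> m \<in> set_pmf (pt ?q)" by (auto simp: f_def split: if_splits)
      then show "m \<subseteq> D' \<and> (m = {?q} \<or> card m = 2)" using X(4)[of m] Q'(4)[of m] Q(2) by auto
    qed
  qed
  have "restr_pmf D (f n) = restr_pmf D \<nu>" for n
  proof -
    have "map_pmf (\<lambda>m. m \<inter> D) (if b then pt ?q else x) = restr_pmf D \<nu>" for b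
      using xP Q(1) by (auto simp: linear_fiber_def same_restr_def restr_pmf_def)
    then have "map_pmf (\<lambda>m. m \<inter> D) (f n) = restr_pmf D \<nu>" unfolding f_def map_bind_pmf by simp
    then show ?thesis unfolding restr_pmf_def[of D "f n"] .
  qed
  then have fP: "f n \<in> P" for n using fL by (simp add: linear_fiber_def same_restr_def)
  have live: "live (f n) = ?q" for n by (rule live_eq[OF fL qf])
  have "mass (f n) = w n * \<epsilon> + (1 - w n) * mass x" for n
  proof -
    have "pmf (f n) {?q} = w n * pmf (pt ?q) {?q} + (1 - w n) * pmf x {?q}"
      unfolding f_def pmf_bind using w by (subst integral_bernoulli_pmf) auto
    then have "mass (f n) = w n * pmf (pt ?q) {?q} + (1 - w n) * pmf x {?q}"
      by (simp only: mass_def live)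
    then show ?thesis using Q(2,3) by (simp add: mass_def)
  qed
  then have "mass (f n) = mass x + w n * (\<epsilon> - mass x)" for n by (simp add: algebra_simps)
  then have "mass (f n) < mass (f (Suc n))" for n using w(3)[of n] lt by simp
  then have "le (f n) (f (Suc n)) \<and> \<not> le (f (Suc n)) (f n)" for n
    unfolding le_iff'[OF fP fP] live using x(2) by (simp add: not_le less_imp_le)
  moreover have "f 0 = x"
  proof -
    have "b = False" if "b \<in> set_pmf (bernoulli_pmf 0)" for b
      using that by (cases b) (auto simp: set_pmf_iff)
    then have "bernoulli_pmf 0 = return_pmf False"
      unfolding set_pmf_subset_singleton[symmetric] by blast
    then show ?thesis by (simp add: f_def w bind_return_pmf)
  qed
  ultimately show False using x(1) fP by (auto simp: ascent_free_def)
qed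

abbreviation "NP \<equiv> node_points (pmf_space K) (same_restr D) (same_restr D') \<nu>"

definition node :: "('n \<times> 'g) set pmf \<Rightarrow> 'n" where
  "node x = fst (live x)"

text \<open>
  Below a point whose free point lies in \<open>D\<close>, the order is linear in the mass. Hence a branching
  point has its free point outside \<open>D\<close>, and then full mass; by \<open>le_iff\<close>, two incomparable points
  below it are incomparable because of their cones.
\<close>

lemma node_point:
  assumes "x \<in> NP"
  shows "x \<in> ascent_free P le" "x \<in> P" "live x \<notin> D" "mass x = \<epsilon>" "\<epsilon> > 0" "node x \<in> N"
    "\<exists>y z. y \<in> N \<and> z \<in> N \<and> cone y \<subseteq> cone (node x) \<and> cone z \<subseteq> cone (node x) \<and>
      \<not> cone y \<subseteq> cone z \<and> \<not> cone z \<subseteq> cone y"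
proof -
  obtain y z where yz: "y \<in> ascent_free P le" "z \<in> ascent_free P le" "le y x" "le z x"
    "\<not> le y z" "\<not> le z y" and x: "x \<in> ascent_free P le"
    using assms by (auto simp: node_points_def branching_points_def)
  have P: "x \<in> P" "y \<in> P" "z \<in> P" using x yz by (auto simp: ascent_free_def)
  show ndx: "live x \<notin> D"
  proof
    assume D: "live x \<in> D"
    then have l: "live y = live x" "live z = live x"
      using yz(3,4) unfolding le_iff'[OF P(2,1)] le_iff'[OF P(3,1)] by (auto split: if_splits)
    show False using yz(5,6) linear[of "mass y" "mass z"]
      unfolding le_iff'[OF P(2,3)] le_iff'[OF P(3,2)] l if_P[OF D] by blast
  qed
  then have nd: "live y \<notin> D" "live z \<notin> D"
    using yz(3,4) unfolding le_iff'[OF P(2,1)] le_iff'[OF P(3,1)] by (auto split: if_splits)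
  show "x \<in> ascent_free P le" "x \<in> P" using x P by auto
  show m: "mass x = \<epsilon>" by (rule ascent_free_mass[OF x ndx])
  have L: "x \<in> L" "y \<in> L" "z \<in> L" using P by (auto simp: linear_fiber_def)
  show "\<epsilon> > 0" using linear_point_live(5)[OF L(1)] m by simp
  have live_node: "node w \<in> N" if "w \<in> L" for w
    using subsetD[OF D'_sub linear_point_live(2)[OF that]] by (simp add: node_def mem_Times_iff)
  show "node x \<in> N" by (rule live_node[OF L(1)])
  have N: "node y \<in> N" "node z \<in> N" by (rule live_node[OF L(2)] live_node[OF L(3)])+
  have "mass y = \<epsilon>" "mass z = \<epsilon>" using ascent_free_mass yz(1,2) nd by auto
  then show "\<exists>y z. y \<in> N \<and> z \<in> N \<and> cone y \<subseteq> cone (node x) \<and> cone z \<subseteq> cone (node x) \<and>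
      \<not> cone y \<subseteq> cone z \<and> \<not> cone z \<subseteq> cone y"
    using yz(3-6) nd ndx N
    unfolding le_iff'[OF P(2,1)] le_iff'[OF P(3,1)] le_iff'[OF P(2,3)] le_iff'[OF P(3,2)]
    by (intro exI[of _ "node y"] exI[of _ "node z"]) (auto simp: node_def)
qed

lemma le_node_iff:
  assumes "x \<in> NP" "y \<in> NP"
  shows "le x y \<longleftrightarrow> cone (node x) \<subseteq> cone (node y)"
  using node_point[OF assms(1)] node_point[OF assms(2)]
  by (simp add: le_iff' node_def)

end

section \<open>Windows of a tree\<close>

definition tree_cmp :: "'n rel \<Rightarrow> 'n \<Rightarrow> 'n \<Rightarrow> bool" where
  "tree_cmp T s t \<longleftrightarrow> (s, t) \<in> T \<or> (t, s) \<in> T"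

text \<open>
  The relation is a preorder here, so tops and coatoms are meant up to equivalence.
\<close>

definition coatoms :: "'b set \<Rightarrow> ('b \<Rightarrow> 'b \<Rightarrow> bool) \<Rightarrow> 'b set" where
  "coatoms P le = {x \<in> P. (\<exists>z\<in>P. le x z \<and> \<not> le z x) \<and>
     (\<forall>z\<in>P. le x z \<and> \<not> le z x \<longrightarrow> (\<forall>w\<in>P. le w z))}"

locale order_tree =
  fixes T :: "'n rel"
  assumes tree: "is_tree T"
begin

lemma refl: "t \<in> Field T \<Longrightarrow> (t, t) \<in> T"
  and trans: "(s, t) \<in> T \<Longrightarrow> (t, u) \<in> T \<Longrightarrow> (s, u) \<in> T"
  and antisym: "(s, t) \<in> T \<Longrightarrow> (t, s) \<in> T \<Longrightarrow> s = t"
proof -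
  have "Refl T" "Relation.trans T" "Relation.antisym T"
    using tree by (auto simp: is_tree_def partial_order_on_def preorder_on_def)
  then show "t \<in> Field T \<Longrightarrow> (t, t) \<in> T"
    "(s, t) \<in> T \<Longrightarrow> (t, u) \<in> T \<Longrightarrow> (s, u) \<in> T" "(s, t) \<in> T \<Longrightarrow> (t, s) \<in> T \<Longrightarrow> s = t"
    by (auto simp: refl_on_def dest: transD antisymD)
qed

lemma in_Field: "(s, t) \<in> T \<Longrightarrow> s \<in> Field T \<and> t \<in> Field T"
  by (auto simp: Field_def)

lemma well_order_below: "t \<in> Field T \<Longrightarrow> Well_order (Restr T (underS T t))"
  using tree by (simp add: is_tree_def)

lemma Field_Restr_underS: "Field (Restr T (underS T t)) = underS T t"
proof -
  have "(s, s) \<in> Restr T (underS T t)" if "s \<in> underS T t" for s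
    using that refl by (auto simp: underS_def in_Field)
  then show ?thesis by (force simp: Field_def)
qed

lemma below_linear:
  assumes "(u, t) \<in> T" "(v, t) \<in> T"
  shows "tree_cmp T u v"
proof (cases "u = t \<or> v = t")
  case True then show ?thesis using assms by (auto simp: tree_cmp_def)
next
  case False
  have "Total (Restr T (underS T t))"
    using well_order_below[of t] assms(1) in_Field
    by (auto simp: well_order_on_def linear_order_on_def)
  moreover have uv: "u \<in> underS T t" "v \<in> underS T t" using False assms by (auto simp: underS_def)
  moreover have "tree_cmp T u u" using assms refl in_Field by (auto simp: tree_cmp_def)
  ultimately show ?thesis
    unfolding total_on_def Field_Restr_underS tree_cmp_def by (cases "u = v") auto
qed

lemma no_descent:
  assumes t: "t \<in> Field T" and f: "\<And>n :: nat. f n \<in> underS T t"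
    and desc: "\<And>n. (f (Suc n), f n) \<in> T \<and> f (Suc n) \<noteq> f n"
  shows False
proof -
  have "wf (Restr T (underS T t) - Id)"
    using well_order_below[OF t] by (simp add: well_order_on_def)
  moreover have "(f (Suc n), f n) \<in> Restr T (underS T t) - Id" for n
    using f desc by auto
  ultimately show False unfolding wf_iff_no_infinite_down_chain by blast
qed

lemma imm_succsD:
  "c \<in> imm_succs T t \<Longrightarrow> (t, c) \<in> T" "c \<in> imm_succs T t \<Longrightarrow> c \<noteq> t"
  "c \<in> imm_succs T t \<Longrightarrow> (t, u) \<in> T \<Longrightarrow> (u, c) \<in> T \<Longrightarrow> u = t \<or> u = c"
  by (auto simp: imm_succs_def aboveS_def underS_def)

lemma child_below:
  assumes c: "c \<in> imm_succs T t" and u: "(t, u) \<in> T" "u \<noteq> t" "tree_cmp T c u"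
  shows "(c, u) \<in> T"
  using u imm_succsD(3)[OF c u(1)] refl in_Field[OF imm_succsD(1)[OF c]]
  by (auto simp: tree_cmp_def)

lemma children_eq:
  assumes c: "c \<in> imm_succs T t" "c' \<in> imm_succs T t" and "tree_cmp T c c'"
  shows "c = c'"
  using assms(3) imm_succsD(3)[OF c(1) imm_succsD(1)[OF c(2)]] imm_succsD(2)[OF c(1)]
    imm_succsD(3)[OF c(2) imm_succsD(1)[OF c(1)]] imm_succsD(2)[OF c(2)]
  unfolding tree_cmp_def by blast

text \<open>
  The set below \<open>u\<close> is well-ordered; \<open>c\<close> is the least element above \<open>t\<close> in it, or \<open>u\<close> itself.
\<close>

lemma child_exists:
  assumes "(t, u) \<in> T" "u \<noteq> t"
  obtains c where "c \<in> imm_succs T t" "(c, u) \<in> T"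
proof -
  have uF: "u \<in> Field T" using in_Field assms by blast
  define Q where "Q = {s \<in> underS T u. (t, s) \<in> T \<and> s \<noteq> t}"
  show ?thesis
  proof (cases "Q = {}")
    case True
    then have "u \<in> imm_succs T t"
      using assms by (auto simp: imm_succs_def aboveS_def Q_def)
    then show ?thesis using that refl[OF uF] by blast
  next
    case False
    have "wf (Restr T (underS T u) - Id)"
      using well_order_below[OF uF] by (simp add: well_order_on_def)
    then obtain c where c: "c \<in> Q" "\<And>s. (s, c) \<in> Restr T (underS T u) - Id \<Longrightarrow> s \<notin> Q"
      using False by (meson wf_eq_minimal ex_in_conv)
    have cu: "(c, u) \<in> T" using c(1) by (auto simp: Q_def underS_def)
    have "\<not> (s \<in> aboveS T t \<and> s \<in> underS T c)" for s
    proof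
      assume s: "s \<in> aboveS T t \<and> s \<in> underS T c"
      then have "(s, c) \<in> T" "s \<noteq> c" "(t, s) \<in> T" "s \<noteq> t" by (auto simp: aboveS_def underS_def)
      moreover have "(s, u) \<in> T" using calculation(1) cu trans by blast
      moreover have "s \<noteq> u" using calculation cu antisym by blast
      ultimately show False using c by (auto simp: Q_def underS_def)
    qed
    then have "c \<in> imm_succs T t" using c(1) by (auto simp: imm_succs_def Q_def aboveS_def)
    then show ?thesis using that cu by blast
  qed
qed

end

text \<open>
  The smaller window contains two immediate successors of each of its nodes, so that cones inside
  the window determine the nodes of the window, and it contains the child of the root below each of
  its nodes.
\<close>

locale tree_windows = order_tree T +
  two_windows "Field T" "tree_cmp T" \<Gamma> S \<Delta> r S' \<Delta>' \<gamma>0 \<nu>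
  for T :: "'n rel" and \<Gamma> :: "'g set" and S \<Delta> r S' \<Delta>' \<gamma>0 \<nu> +
  assumes tree_root: "is_root T r"
    and branch: "\<And>t. t \<in> S \<Longrightarrow> \<exists>c\<in>S. \<exists>c'\<in>S. c \<noteq> c' \<and> c \<in> imm_succs T t \<and> c' \<in> imm_succs T t"
    and closed: "\<And>a s. a \<in> imm_succs T r \<Longrightarrow> s \<in> S \<Longrightarrow> (a, s) \<in> T \<Longrightarrow> a \<in> S"
begin

lemma root_le: "t \<in> Field T \<Longrightarrow> (r, t) \<in> T"
  using tree_root by (simp add: is_root_def)

lemma S_Field: "t \<in> S \<Longrightarrow> t \<in> Field T"
  using inner.S by blast

lemma cone_antimono:
  assumes "(u, t) \<in> T"
  shows "cone t \<subseteq> cone u"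
proof
  fix s assume s: "s \<in> cone t"
  then have "(s, t) \<in> T \<or> (t, s) \<in> T" by (simp add: cone_def tree_cmp_def)
  then have "tree_cmp T s u"
  proof
    assume "(s, t) \<in> T" then show ?thesis using below_linear assms by blast
  next
    assume "(t, s) \<in> T" then show ?thesis using trans[OF assms] by (simp add: tree_cmp_def)
  qed
  then show "s \<in> cone u" using s by (simp add: cone_def)
qed

text \<open>
  A node \<open>u\<close> strictly above \<open>s\<close> is compatible with at most one immediate successor of \<open>s\<close>, but the
  cone of \<open>s\<close> contains two of them.
\<close>

lemma cone_cancel:
  assumes s: "s \<in> S" and sub: "cone s \<subseteq> cone u"
  shows "(u, s) \<in> T"
proof (rule ccontr)
  assume nle: "(u, s) \<notin> T"
  have "s \<in> cone s" using s refl S_Field by (simp add: cone_def tree_cmp_def)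
  then have "tree_cmp T s u" using sub by (auto simp: cone_def)
  then have su: "(s, u) \<in> T" using nle by (simp add: tree_cmp_def)
  have us: "u \<noteq> s" using nle su by auto
  obtain c c' where c: "c \<in> S" "c' \<in> S" "c \<noteq> c'" "c \<in> imm_succs T s" "c' \<in> imm_succs T s"
    using branch[OF s] by blast
  have "(d, u) \<in> T" if d: "d \<in> S" "d \<in> imm_succs T s" for d
  proof -
    have "d \<in> cone s" using d imm_succsD(1) by (simp add: cone_def tree_cmp_def)
    then have "tree_cmp T d u" using sub by (auto simp: cone_def)
    then show ?thesis by (rule child_below[OF d(2) su us])
  qed
  then have "tree_cmp T c c'" using below_linear c by blast
  then show False using children_eq c by blast
qed

lemma cone_iff: "s \<in> S \<Longrightarrow> cone s \<subseteq> cone u \<longleftrightarrow> (u, s) \<in> T"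
  using cone_cancel cone_antimono by blast

text \<open>
  The representative of a node of the smaller window.
\<close>

abbreviation real :: "'n \<Rightarrow> ('n \<times> 'g) set pmf" where
  "real t \<equiv> pt (t, \<gamma>0)"

lemma real:
  assumes t: "t \<in> S" and pos: "\<epsilon> > 0"
  shows "real t \<in> P" "live (real t) = (t, \<gamma>0)" "mass (real t) = \<epsilon>" "live (real t) \<notin> D"
proof -
  have "(t, \<gamma>0) \<in> D'" "(t, \<gamma>0) \<notin> D" using t sub \<gamma>0 by auto
  note p = pt[OF this pos]
  show "real t \<in> P" "live (real t) = (t, \<gamma>0)" "mass (real t) = \<epsilon>" by (rule p)+
  show "live (real t) \<notin> D" unfolding p(2) using \<gamma>0 by simp
qed

text \<open>
  In an ascent the mass stays full, so the cones increase strictly. They contain the cone of \<open>t\<close>,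
  so by \<open>cone_cancel\<close> their nodes form a strictly descending sequence below \<open>t\<close> in the tree.
\<close>

lemma real_ascent_free:
  assumes t: "t \<in> S" and pos: "\<epsilon> > 0"
  shows "real t \<in> ascent_free P le"
proof (rule ccontr)
  assume "\<not> ?thesis"
  then obtain f :: "nat \<Rightarrow> _" where f0: "f 0 = real t"
    and fP: "\<And>n. f n \<in> P" and up: "\<And>n. le (f n) (f (Suc n))" "\<And>n. \<not> le (f (Suc n)) (f n)"
    using real(1)[OF t pos] unfolding ascent_free_def by auto
  define l where "l n = fst (live (f n))" for n
  have step: "live (f n) \<notin> D \<Longrightarrow> mass (f n) \<le> mass (f (Suc n)) \<and> live (f (Suc n)) \<notin> D \<and> cone (l n) \<subseteq> cone (l (Suc n))" for n
    using up(1)[of n] unfolding le_iff'[OF fP fP] l_def by (simp split: if_splits)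
  have nd: "live (f n) \<notin> D" for n
  proof (induction n)
    case 0 show ?case unfolding f0 by (rule real(4)[OF t pos])
  next
    case (Suc n)
    show ?case by (rule step[OF Suc, THEN conjunct2, THEN conjunct1])
  qed
  have m: "mass (f n) = \<epsilon>" for n
  proof (induction n)
    case 0 show ?case unfolding f0 by (rule real(3)[OF t pos])
  next
    case (Suc n)
    then show ?case
      using step[OF nd[of n], THEN conjunct1] mass_le[OF fP nd, of "Suc n"] by linarith
  qed
  have strict: "\<not> cone (l (Suc n)) \<subseteq> cone (l n)" for n
    using up(2)[of n] nd m unfolding le_iff'[OF fP fP] l_def by simp
  have up_cone: "cone (l n) \<subseteq> cone (l (Suc n))" for n
    by (rule step[OF nd, THEN conjunct2, THEN conjunct2])
  have "cone (l 0) \<subseteq> cone (l n)" for n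
    by (induction n) (simp, erule order_trans[OF _ up_cone])
  then have "cone t \<subseteq> cone (l n)" for n
    using real(2)[OF t pos] by (simp add: l_def f0)
  then have lt: "(l n, t) \<in> T" for n using cone_cancel[OF t] by blast
  have desc: "(l (Suc n), l n) \<in> T \<and> l (Suc n) \<noteq> l n" for n
    using below_linear[OF lt lt, of n "Suc n"] strict[of n] cone_antimono[of "l n" "l (Suc n)"]
    by (auto simp: tree_cmp_def)
  have "l (Suc n) \<in> underS T t" for n
    using lt[of "Suc n"] lt[of n] desc[of n] antisym by (auto simp: underS_def)
  then show False using no_descent[of t "\<lambda>n. l (Suc n)"] desc S_Field[OF t] by blast
qed

text \<open>
  The representatives of two immediate successors are incomparable points below that of \<open>t\<close>.
\<close>

lemma real_node:
  assumes t: "t \<in> S" and pos: "\<epsilon> > 0"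
  shows "real t \<in> NP" "node (real t) = t"
proof -
  show "node (real t) = t" using real(2)[OF assms] by (simp add: node_def)
  obtain c c' where c: "c \<in> S" "c' \<in> S" "c \<noteq> c'" "c \<in> imm_succs T t" "c' \<in> imm_succs T t"
    using branch[OF t] by blast
  have le: "le (real s) (real u) \<longleftrightarrow> (u, s) \<in> T" if "s \<in> S" "u \<in> S" for s u
    unfolding le_iff'[OF real(1)[OF that(1) pos] real(1)[OF that(2) pos]]
    using real[OF that(1) pos] real[OF that(2) pos] cone_iff[OF that(1)] \<gamma>0(2) by simp
  have "(c, c') \<notin> T" "(c', c) \<notin> T" using children_eq c by (auto simp: tree_cmp_def)
  then show "real t \<in> NP"
    unfolding node_points_def branching_points_def
    using c real_ascent_free[OF _ pos] t le imm_succsD(1) by blast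
qed

lemma le_real_iff:
  assumes "s \<in> S" "u \<in> S" "\<epsilon> > 0"
  shows "le (real s) (real u) \<longleftrightarrow> (u, s) \<in> T"
  using le_node_iff[OF real_node(1) real_node(1)] real_node(2) assms cone_iff by simp

text \<open>
  All cones contain the root, and two of those below the given one are incomparable.
\<close>

lemma node_cone_nontrivial:
  assumes "x \<in> NP"
  obtains s where "s \<in> cone (node x)" "s \<noteq> r"
proof -
  obtain y z where yz: "y \<in> Field T" "z \<in> Field T" "cone y \<subseteq> cone (node x)" "\<not> cone y \<subseteq> cone z"
    using node_point(7)[OF assms] by blast
  have "r \<in> cone z" using cone_nonempty[OF yz(2)] .
  then show ?thesis using yz that by blast
qed

lemma above_child:
  assumes a: "a \<in> imm_succs T r" and s: "s \<in> Field T" "s \<noteq> r" and "tree_cmp T s a"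
  shows "(a, s) \<in> T"
  using child_below[OF a root_le[OF s(1)] s(2)] assms(4) by (auto simp: tree_cmp_def)

text \<open>
  Only the root lies strictly below a child of the root, and its cone is the largest one.
\<close>

lemma coatom_real:
  assumes a: "a \<in> imm_succs T r" "a \<in> S" and pos: "\<epsilon> > 0"
  shows "real a \<in> coatoms NP le"
  unfolding coatoms_def
proof (intro CollectI conjI ballI impI)
  have rS: "r \<in> S" using inner.root by blast
  show "real a \<in> NP" using real_node a pos by blast
  have "(a, r) \<notin> T" using imm_succsD(1,2)[OF a(1)] antisym by blast
  then show "\<exists>z\<in>NP. le (real a) z \<and> \<not> le z (real a)"
    using le_real_iff[OF a(2) rS pos] le_real_iff[OF rS a(2) pos] imm_succsD(1)[OF a(1)]
      real_node[OF rS pos] by blast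
  fix z w assume z: "z \<in> NP" "le (real a) z \<and> \<not> le z (real a)" and w: "w \<in> NP"
  have "cone a \<subseteq> cone (node z)" and ne: "node z \<noteq> a"
    using z le_node_iff[OF real_node(1)[OF a(2) pos] z(1)] le_node_iff[OF z(1) real_node(1)[OF a(2) pos]]
      real_node(2)[OF a(2) pos] by auto
  then have "(node z, a) \<in> T" using cone_cancel a(2) by blast
  then have "node z = r" using imm_succsD(3)[OF a(1) root_le] node_point(6)[OF z(1)] ne by blast
  then show "le w z"
    unfolding le_node_iff[OF w z(1)] using cone_antimono[OF root_le] node_point(6)[OF w] by simp
qed

text \<open>
  A coatom \<open>x\<close> is the point of a node other than the root, hence of a node above some child \<open>a\<close> of
  the root. The cone of \<open>x\<close> contains a node of the window other than the root, which is above \<open>a\<close>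
  too, so \<open>a\<close> is in the window. The representative of \<open>a\<close> is above \<open>x\<close> and not on top, so it is
  equivalent to \<open>x\<close>.
\<close>

lemma coatomD:
  assumes x: "x \<in> coatoms NP le"
  obtains a where "a \<in> imm_succs T r" "a \<in> S" "le x (real a)" "le (real a) x" "\<epsilon> > 0"
proof -
  have rS: "r \<in> S" using inner.root by blast
  note x' = x[unfolded coatoms_def mem_Collect_eq]
  have xNP: "x \<in> NP" by (rule conjunct1[OF x'])
  have max: "le w z" if "z \<in> NP" "le x z" "\<not> le z x" "w \<in> NP" for z w
    using x'[THEN conjunct2, THEN conjunct2, rule_format, OF that(1) conjI[OF that(2,3)] that(4)] .
  obtain z where z: "z \<in> NP" "le x z" "\<not> le z x"
    using x'[THEN conjunct2, THEN conjunct1] by blast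
  have pos: "\<epsilon> > 0" by (rule node_point(5)[OF xNP])
  let ?t = "node x"
  have tF: "?t \<in> Field T" by (rule node_point(6)[OF xNP])
  have "?t \<noteq> r"
  proof
    assume "?t = r"
    then have "cone (node z) \<subseteq> cone ?t"
      using cone_antimono[OF root_le[OF node_point(6)[OF z(1)]]] by simp
    then show False using z(3) le_node_iff[OF z(1) xNP] by simp
  qed
  then obtain a where a: "a \<in> imm_succs T r" "(a, ?t) \<in> T"
    using child_exists[OF root_le[OF tF]] by blast
  obtain s where s: "s \<in> cone ?t" "s \<noteq> r" using node_cone_nontrivial[OF xNP] .
  have "s \<in> cone a" using s(1) cone_antimono[OF a(2)] by blast
  then have sS: "s \<in> S" "tree_cmp T s a" by (auto simp: cone_def)
  have "(a, s) \<in> T" by (rule above_child[OF a(1) S_Field[OF sS(1)] s(2) sS(2)])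
  then have aS: "a \<in> S" using closed a(1) sS(1) by blast
  note ra = real_node[OF aS pos]
  have le: "le x (real a)" unfolding le_node_iff[OF xNP ra(1)] ra(2) by (rule cone_antimono[OF a(2)])
  have "le (real a) x"
  proof (rule ccontr)
    assume "\<not> ?thesis"
    then have "le (real r) (real a)" using max[OF ra(1) le] real_node(1)[OF rS pos] by blast
    then have "(a, r) \<in> T" using le_real_iff[OF rS aS pos] by simp
    then show False using imm_succsD(1,2)[OF a(1)] antisym by blast
  qed
  then show ?thesis using that a(1) aS le pos by blast
qed

text \<open>
  The cone of \<open>w\<close> contains a node of the window other than the root. That node lies above the child
  of the root below the node of \<open>w\<close>, and above \<open>a\<close>; so the two children agree.
\<close>

lemma below_real_child:
  assumes a: "a \<in> imm_succs T r" "a \<in> S" and w: "w \<in> NP" "le w (real a)"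
  shows "(a, node w) \<in> T"
proof -
  have pos: "\<epsilon> > 0" by (rule node_point(5)[OF w(1)])
  have tF: "node w \<in> Field T" by (rule node_point(6)[OF w(1)])
  have sub: "cone (node w) \<subseteq> cone a"
    using w(2) le_node_iff[OF w(1) real_node(1)[OF a(2) pos]] real_node(2)[OF a(2) pos] by simp
  have "node w \<noteq> r"
  proof
    assume "node w = r"
    then have "(a, r) \<in> T" using cone_cancel[of r a] sub inner.root(1) by simp
    then show False using imm_succsD(1,2)[OF a(1)] antisym by blast
  qed
  then obtain a' where a': "a' \<in> imm_succs T r" "(a', node w) \<in> T"
    using child_exists[OF root_le[OF tF]] by blast
  obtain s where s: "s \<in> cone (node w)" "s \<noteq> r" using node_cone_nontrivial[OF w(1)] .
  have sS: "s \<in> S" "tree_cmp T s a" "tree_cmp T s a'"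
    using s(1) sub cone_antimono[OF a'(2)] by (auto simp: cone_def)
  have "(a, s) \<in> T" "(a', s) \<in> T"
    using above_child[OF a(1) S_Field[OF sS(1)] s(2) sS(2)]
      above_child[OF a'(1) S_Field[OF sS(1)] s(2) sS(3)] by auto
  then have "a = a'" using children_eq[OF a(1) a'(1)] below_linear by blast
  then show ?thesis using a'(2) by simp
qed

end

section \<open>Transport along homeomorphisms\<close>

lemma fiber_le_homeomorphic:
  assumes h: "homeomorphic_maps X Y h g"
    and E: "\<And>x y. x \<in> topspace X \<Longrightarrow> y \<in> topspace X \<Longrightarrow> E x y \<Longrightarrow> E2 (h x) (h y)"
    and xy: "x \<in> topspace X" "y \<in> topspace X" "fiber_le X E x y"
  shows "fiber_le Y E2 (h x) (h y)"
  unfolding fiber_le_def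
proof (intro allI impI)
  fix U assume U: "openin Y U \<and> h y \<in> U"
  have ch: "continuous_map X Y h" and cg: "continuous_map Y X g"
    and gh: "\<And>x. x \<in> topspace X \<Longrightarrow> g (h x) = x" and hg: "\<And>y. y \<in> topspace Y \<Longrightarrow> h (g y) = y"
    using h by (auto simp: homeomorphic_maps_def)
  have "openin X {x \<in> topspace X. h x \<in> U}"
    using U openin_continuous_map_preimage[OF ch] by blast
  moreover have "y \<in> {x \<in> topspace X. h x \<in> U}" using U xy by simp
  ultimately have "\<exists>V. openin X V \<and> x \<in> V \<and> (\<forall>v\<in>V. \<exists>u\<in>{x \<in> topspace X. h x \<in> U}. E v u)"
    by (intro xy(3)[unfolded fiber_le_def, rule_format] conjI)
  then obtain V where V: "openin X V" "x \<in> V"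
    "\<And>v. v \<in> V \<Longrightarrow> \<exists>u\<in>{x \<in> topspace X. h x \<in> U}. E v u" by blast
  have "openin Y {z \<in> topspace Y. g z \<in> V}"
    using openin_continuous_map_preimage[OF cg V(1)] .
  moreover have "h x \<in> {z \<in> topspace Y. g z \<in> V}"
    using xy(1) V(2) gh continuous_map_funspace[OF ch] by auto
  moreover have "\<exists>u\<in>U. E2 z u" if z: "z \<in> {z \<in> topspace Y. g z \<in> V}" for z
  proof -
    obtain u where u: "u \<in> topspace X" "h u \<in> U" "E (g z) u" using V(3) z by blast
    moreover have "g z \<in> topspace X" using z V(1) openin_subset by blast
    ultimately have "E2 (h (g z)) (h u)" by (intro E)
    then show ?thesis using u hg z by auto
  qed
  ultimately show "\<exists>V. openin Y V \<and> h x \<in> V \<and> (\<forall>v\<in>V. \<exists>u\<in>U. E2 v u)" by blast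
qed

lemma image_of_subset:
  assumes "A' \<subseteq> h ` P" "A \<subseteq> P" "\<And>x. x \<in> P \<Longrightarrow> h x \<in> A' \<longleftrightarrow> x \<in> A"
  shows "A' = h ` A"
  using assms by blast

text \<open>
  A homeomorphism that respects two relations, for a smaller and a larger window.
\<close>

locale fiber_homeo =
  fixes X :: "'b topology" and Y :: "'c topology" and h g and E E' E2 E2'
  assumes h: "homeomorphic_maps X Y h g"
    and E: "\<And>x y. x \<in> topspace X \<Longrightarrow> y \<in> topspace X \<Longrightarrow> E x y \<longleftrightarrow> E2 (h x) (h y)"
    and E': "\<And>x y. x \<in> topspace X \<Longrightarrow> y \<in> topspace X \<Longrightarrow> E' x y \<longleftrightarrow> E2' (h x) (h y)"
begin

lemma maps: "x \<in> topspace X \<Longrightarrow> h x \<in> topspace Y" "y \<in> topspace Y \<Longrightarrow> g y \<in> topspace X"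
  "x \<in> topspace X \<Longrightarrow> g (h x) = x" "y \<in> topspace Y \<Longrightarrow> h (g y) = y"
  using h by (auto simp: homeomorphic_maps_def continuous_map_def)

lemma fiber_le_iff:
  assumes xy: "x \<in> topspace X" "y \<in> topspace X"
  shows "fiber_le X E x y \<longleftrightarrow> fiber_le Y E2 (h x) (h y)"
proof
  show "fiber_le Y E2 (h x) (h y)" if "fiber_le X E x y"
    by (rule fiber_le_homeomorphic[OF h _ xy that]) (rule E[THEN iffD1])
  have h': "homeomorphic_maps Y X g h" by (rule homeomorphic_maps_sym[THEN iffD1, OF h])
  have "fiber_le X E (g (h x)) (g (h y))" if "fiber_le Y E2 (h x) (h y)"
    by (rule fiber_le_homeomorphic[OF h' _ _ _ that], rule E[THEN iffD2])
      (simp_all add: xy maps)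
  then show "fiber_le X E x y" if "fiber_le Y E2 (h x) (h y)" using that xy maps by simp
qed

lemma fiber_le_iff':
  assumes xy: "x \<in> topspace X" "y \<in> topspace X"
  shows "fiber_le X E' x y \<longleftrightarrow> fiber_le Y E2' (h x) (h y)"
proof -
  interpret s: fiber_homeo X Y h g E' E E2' E2 by standard (use h E E' in auto)
  show ?thesis by (rule s.fiber_le_iff[OF xy])
qed

lemma all_topspace: "(\<forall>y\<in>topspace Y. Q y) \<longleftrightarrow> (\<forall>x\<in>topspace X. Q (h x))"
  and ex_topspace: "(\<exists>y\<in>topspace Y. Q y) \<longleftrightarrow> (\<exists>x\<in>topspace X. Q (h x))"
  using maps by metis+

lemma linear_points_iff:
  assumes "x \<in> topspace X"
  shows "x \<in> linear_points X E' \<longleftrightarrow> h x \<in> linear_points Y E2'"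
  unfolding linear_points_def mem_Collect_eq all_topspace ex_topspace
  using assms maps(1)[OF assms] E' fiber_le_iff' by simp

lemma linear_fiber_image:
  assumes \<nu>: "\<nu> \<in> topspace X"
  shows "linear_fiber Y E2 E2' (h \<nu>) = h ` linear_fiber X E E' \<nu>"
proof (intro equalityI subsetI)
  fix y assume y: "y \<in> linear_fiber Y E2 E2' (h \<nu>)"
  then have yT: "y \<in> topspace Y" by (auto simp: linear_fiber_def linear_points_def)
  then have "g y \<in> linear_fiber X E E' \<nu>"
    using y maps(2,4)[OF yT] linear_points_iff[of "g y"] E[OF \<nu>, of "g y"]
    by (auto simp: linear_fiber_def)
  then show "y \<in> h ` linear_fiber X E E' \<nu>" using maps(4)[OF yT] by force
next
  fix y assume "y \<in> h ` linear_fiber X E E' \<nu>"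
  then obtain x where x: "x \<in> linear_fiber X E E' \<nu>" "y = h x" by blast
  then have "x \<in> topspace X" by (auto simp: linear_fiber_def linear_points_def)
  then show "y \<in> linear_fiber Y E2 E2' (h \<nu>)"
    using x linear_points_iff E[OF \<nu>] by (auto simp: linear_fiber_def)
qed

lemma ascent_free_image:
  assumes P: "P \<subseteq> topspace X"
  shows "ascent_free (h ` P) (fiber_le Y E2) = h ` ascent_free P (fiber_le X E)"
proof -
  have le: "fiber_le X E x y \<longleftrightarrow> fiber_le Y E2 (h x) (h y)" if "x \<in> P" "y \<in> P" for x y
    using fiber_le_iff that P by blast
  have gh: "g (h x) = x" if "x \<in> P" for x using that P maps by blast
  have "h x \<in> ascent_free (h ` P) (fiber_le Y E2) \<longleftrightarrow> x \<in> ascent_free P (fiber_le X E)"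
    if x: "x \<in> P" for x
  proof -
    have "(\<exists>f. f 0 = h x \<and> (\<forall>n::nat. f n \<in> h ` P \<and> fiber_le Y E2 (f n) (f (Suc n)) \<and>
        \<not> fiber_le Y E2 (f (Suc n)) (f n))) \<longleftrightarrow>
      (\<exists>f. f 0 = x \<and> (\<forall>n::nat. f n \<in> P \<and> fiber_le X E (f n) (f (Suc n)) \<and>
        \<not> fiber_le X E (f (Suc n)) (f n)))" (is "?l \<longleftrightarrow> ?r")
    proof
      assume ?l
      then obtain f where f: "f 0 = h x" "\<And>n::nat. f n \<in> h ` P"
        "\<And>n. fiber_le Y E2 (f n) (f (Suc n))" "\<And>n. \<not> fiber_le Y E2 (f (Suc n)) (f n)" by blast
      have gP: "g (f n) \<in> P \<and> h (g (f n)) = f n" for n using f(2)[of n] gh by auto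
      show ?r
        by (rule exI[of _ "\<lambda>n. g (f n)"]) (use f gP le gh[OF x] in auto)
    next
      assume ?r
      then obtain f where f: "f 0 = x" "\<And>n::nat. f n \<in> P"
        "\<And>n. fiber_le X E (f n) (f (Suc n))" "\<And>n. \<not> fiber_le X E (f (Suc n)) (f n)" by blast
      show ?l
        by (rule exI[of _ "\<lambda>n. h (f n)"]) (use f le in auto)
    qed
    then show ?thesis unfolding ascent_free_def mem_Collect_eq using x by simp
  qed
  then show ?thesis
    by (intro image_of_subset[where P = P]) (simp_all add: ascent_free_def Collect_restrict)
qed

lemma node_points_image:
  assumes \<nu>: "\<nu> \<in> topspace X"
  shows "node_points Y E2 E2' (h \<nu>) = h ` node_points X E E' \<nu>"
proof -
  let ?Q = "ascent_free (linear_fiber X E E' \<nu>) (fiber_le X E)"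
  have P: "linear_fiber X E E' \<nu> \<subseteq> topspace X"
    by (auto simp: linear_fiber_def linear_points_def)
  then have Q: "?Q \<subseteq> topspace X" by (auto simp: ascent_free_def)
  have le: "fiber_le X E x y \<longleftrightarrow> fiber_le Y E2 (h x) (h y)" if "x \<in> ?Q" "y \<in> ?Q" for x y
    using fiber_le_iff that Q by blast
  have "branching_points (h ` ?Q) (fiber_le Y E2) = h ` branching_points ?Q (fiber_le X E)"
  proof (rule image_of_subset[where P = ?Q])
    fix x assume x: "x \<in> ?Q"
    have "(\<exists>y\<in>h ` ?Q. \<exists>z\<in>h ` ?Q. fiber_le Y E2 y (h x) \<and> fiber_le Y E2 z (h x) \<and>
        \<not> fiber_le Y E2 y z \<and> \<not> fiber_le Y E2 z y) \<longleftrightarrow>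
      (\<exists>y\<in>?Q. \<exists>z\<in>?Q. fiber_le Y E2 (h y) (h x) \<and> fiber_le Y E2 (h z) (h x) \<and>
        \<not> fiber_le Y E2 (h y) (h z) \<and> \<not> fiber_le Y E2 (h z) (h y))"
      by simp
    also have "\<dots> \<longleftrightarrow> (\<exists>y\<in>?Q. \<exists>z\<in>?Q. fiber_le X E y x \<and> fiber_le X E z x \<and>
        \<not> fiber_le X E y z \<and> \<not> fiber_le X E z y)"
      using x by (intro bex_cong refl) (simp add: le)
    finally show "h x \<in> branching_points (h ` ?Q) (fiber_le Y E2) \<longleftrightarrow>
        x \<in> branching_points ?Q (fiber_le X E)"
      unfolding branching_points_def mem_Collect_eq using x by simp
  qed (simp_all add: branching_points_def Collect_restrict)
  then show ?thesis
    unfolding node_points_def linear_fiber_image[OF \<nu>] ascent_free_image[OF P] .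
qed

lemma coatoms_image:
  assumes P: "P \<subseteq> topspace X" and x: "x \<in> coatoms P (fiber_le X E)"
  shows "h x \<in> coatoms (h ` P) (fiber_le Y E2)"
proof -
  have le: "fiber_le X E x y \<longleftrightarrow> fiber_le Y E2 (h x) (h y)" if "x \<in> P" "y \<in> P" for x y
    using fiber_le_iff that P by blast
  note x' = x[unfolded coatoms_def mem_Collect_eq]
  have xP: "x \<in> P" by (rule conjunct1[OF x'])
  obtain z0 where z0: "z0 \<in> P" "fiber_le X E x z0" "\<not> fiber_le X E z0 x"
    using x'[THEN conjunct2, THEN conjunct1] by blast
  show ?thesis
    unfolding coatoms_def mem_Collect_eq
  proof (intro conjI ballI impI)
    show "h x \<in> h ` P" using xP by simp
    show "\<exists>z\<in>h ` P. fiber_le Y E2 (h x) z \<and> \<not> fiber_le Y E2 z (h x)"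
      using z0 le[OF xP z0(1)] le[OF z0(1) xP] by (intro bexI[of _ "h z0"]) simp_all
    fix z w assume "z \<in> h ` P" "w \<in> h ` P"
    then obtain z' w' where z: "z = h z'" "z' \<in> P" and w: "w = h w'" "w' \<in> P" by blast
    assume "fiber_le Y E2 (h x) z \<and> \<not> fiber_le Y E2 z (h x)"
    then have "fiber_le X E x z' \<and> \<not> fiber_le X E z' x"
      unfolding z(1) le[OF xP z(2)] le[OF z(2) xP] .
    then have "fiber_le X E w' z'"
      using x'[THEN conjunct2, THEN conjunct2, rule_format, OF z(2) _ w(2)] by blast
    then show "fiber_le Y E2 w z" unfolding z(1) w(1) le[OF w(2) z(2)] .
  qed
qed

end

text \<open>
  Node points map to node points, and \<open>f\<close> reads off their nodes. Points below the representative of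
  \<open>a1\<close> go to points below that of \<open>a2\<close>, whose nodes are above \<open>a2\<close> by \<open>below_real_child\<close>. These
  nodes lie in the window because the window contains all of the cone above \<open>a2\<close>, so there cones
  determine nodes and strict inequalities are preserved.
\<close>

lemma chain_transfer:
  assumes A: "tree_windows T1 \<Gamma> S1 \<Delta> r1 S1' \<Delta>' \<gamma>0 \<nu>1"
    and B: "tree_windows T2 \<Gamma> S2 \<Delta> r2 S2' \<Delta>' \<gamma>0 \<nu>2"
    and H: "fiber_homeo (pmf_space (compat_sets (Field T1) (tree_cmp T1) \<Gamma>))
        (pmf_space (compat_sets (Field T2) (tree_cmp T2) \<Gamma>)) h g
        (same_restr (S1 \<times> \<Delta>)) (same_restr (S1' \<times> \<Delta>'))
        (same_restr (S2 \<times> \<Delta>)) (same_restr (S2' \<times> \<Delta>'))"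
    and \<nu>: "\<nu>2 = h \<nu>1"
    and a1: "a1 \<in> imm_succs T1 r1" "a1 \<in> S1" and a2: "a2 \<in> imm_succs T2 r2" "a2 \<in> S2"
    and eq: "fiber_le (pmf_space (compat_sets (Field T2) (tree_cmp T2) \<Gamma>)) (same_restr (S2 \<times> \<Delta>))
        (h (two_windows.pt S1 \<Delta> \<gamma>0 \<nu>1 (a1, \<gamma>0))) (two_windows.pt S2 \<Delta> \<gamma>0 \<nu>2 (a2, \<gamma>0))"
    and pos: "two_windows.\<epsilon> S1 \<Delta> \<nu>1 > 0"
    and full: "above T2 a2 \<subseteq> S2"
  shows "\<exists>f. (\<forall>t\<in>S1. (a1, t) \<in> T1 \<longrightarrow> (a2, f t) \<in> T2) \<and>
    (\<forall>t\<in>S1. \<forall>t'\<in>S1. (a1, t) \<in> T1 \<longrightarrow> (t, t') \<in> T1 \<longrightarrow> t \<noteq> t' \<longrightarrow>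
      (f t, f t') \<in> T2 \<and> f t \<noteq> f t')"
proof -
  interpret A: tree_windows T1 \<Gamma> S1 \<Delta> r1 S1' \<Delta>' \<gamma>0 \<nu>1 by (rule A)
  interpret B: tree_windows T2 \<Gamma> S2 \<Delta> r2 S2' \<Delta>' \<gamma>0 \<nu>2 by (rule B)
  interpret H: fiber_homeo "pmf_space A.K" "pmf_space B.K" h g
    "same_restr (S1 \<times> \<Delta>)" "same_restr (S1' \<times> \<Delta>')" "same_restr (S2 \<times> \<Delta>)" "same_restr (S2' \<times> \<Delta>')"
    by (rule H)
  have \<nu>1: "\<nu>1 \<in> topspace (pmf_space A.K)" using A.\<nu> by simp
  have NP: "B.NP = h ` A.NP" unfolding \<nu> by (rule H.node_points_image[OF \<nu>1])
  have top: "x \<in> topspace (pmf_space A.K)" if "x \<in> A.NP" for x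
    using A.node_point(2)[OF that] by (auto simp: linear_fiber_def linear_points_def)
  have le: "A.le x y \<longleftrightarrow> B.le (h x) (h y)" if "x \<in> A.NP" "y \<in> A.NP" for x y
    by (rule H.fiber_le_iff[OF top[OF that(1)] top[OF that(2)]])
  have hr: "h (A.real t) \<in> B.NP" if "t \<in> S1" for t using A.real_node(1)[OF that pos] NP by blast
  define f where "f t = B.node (h (A.real t))" for t
  have le_trans: "B.le x z" if "x \<in> B.NP" "y \<in> B.NP" "z \<in> B.NP" "B.le x y" "B.le y z" for x y z
    using that(4,5) unfolding B.le_node_iff[OF that(1,2)] B.le_node_iff[OF that(2,3)] B.le_node_iff[OF that(1,3)]
    by blast
  have pos2: "B.\<epsilon> > 0" using B.node_point(5)[OF hr[OF a1(2)]] .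
  have up: "(a2, f t) \<in> T2" if t: "t \<in> S1" "(a1, t) \<in> T1" for t
  proof -
    have "A.le (A.real t) (A.real a1)" using A.le_real_iff[OF t(1) a1(2) pos] t(2) by simp
    then have "B.le (h (A.real t)) (h (A.real a1))"
      using le A.real_node(1)[OF t(1) pos] A.real_node(1)[OF a1(2) pos] by blast
    then have "B.le (h (A.real t)) (B.real a2)"
      using le_trans[OF hr[OF t(1)] hr[OF a1(2)] B.real_node(1)[OF a2(2) pos2]] eq by blast
    then show ?thesis unfolding f_def by (rule B.below_real_child[OF a2 hr[OF t(1)]])
  qed
  have strict: "(f t, f t') \<in> T2 \<and> f t \<noteq> f t'"
    if t: "t \<in> S1" "t' \<in> S1" "(a1, t) \<in> T1" "(t, t') \<in> T1" "t \<noteq> t'" for t t'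
  proof -
    have "A.le (A.real t') (A.real t)" "\<not> A.le (A.real t) (A.real t')"
      using A.le_real_iff[OF t(2,1) pos] A.le_real_iff[OF t(1,2) pos] t A.antisym by auto
    then have c: "B.le (h (A.real t')) (h (A.real t))" "\<not> B.le (h (A.real t)) (h (A.real t'))"
      using le A.real_node(1)[OF _ pos] t by blast+
    have "(a2, f t') \<in> T2" using up[OF t(2)] t A.trans by blast
    then have S2: "f t' \<in> S2" using full by (auto simp: above_def)
    have cones: "B.cone (f t') \<subseteq> B.cone (f t)" "\<not> B.cone (f t) \<subseteq> B.cone (f t')"
      using c unfolding B.le_node_iff[OF hr[OF t(2)] hr[OF t(1)]] B.le_node_iff[OF hr[OF t(1)] hr[OF t(2)]]
      by (simp_all add: f_def)
    have "f t \<noteq> f t'" using cones by metis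
    then show ?thesis using B.cone_cancel[OF S2 cones(1)] by simp
  qed
  show ?thesis
    by (rule exI[of _ f], rule conjI) (intro ballI impI up strict; assumption)+
qed

section \<open>Continuous functions depend on countably many coordinates\<close>

locale compact_pair_family = pair_family K for K :: "'i set set" +
  fixes X :: "'i set topology"
  assumes openin_X: "openin X U \<longleftrightarrow>
      U \<subseteq> K \<and> (\<forall>x\<in>U. \<exists>G. finite G \<and> {y \<in> K. y \<inter> G = x \<inter> G} \<subseteq> U)"
    and compact_X: "compact_space X"
begin

lemma openin_agree: "finite G \<Longrightarrow> openin X {y \<in> K. y \<inter> G \<in> A}"
  unfolding openin_X by auto

lemma topspace_X: "topspace X = K"
proof
  show "topspace X \<subseteq> K" using openin_X[of "topspace X"] by simp
  have "openin X {y \<in> K. y \<inter> {} \<in> UNIV}" by (rule openin_agree) simp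
  then show "K \<subseteq> topspace X" using openin_subset by fastforce
qed

text \<open>
  With fixed finitely supported weights, the sequences of points that serve as atoms form a compact
  product, and \<open>g\<close> is continuous in the sequence. Finitely many basic neighborhoods cover the
  product, and together they look at finitely many coordinates.
\<close>

lemma finite_dependence:
  assumes g: "continuous_map (pmf_space K) euclideanreal g" and e: "e > 0"
    and w: "finite (set_pmf (w :: nat pmf))"
  obtains G where "finite G"
    "\<And>f f'. (\<And>i. f i \<in> K \<and> f' i \<in> K \<and> f i \<inter> G = f' i \<inter> G) \<Longrightarrow>
      \<bar>g (map_pmf f w) - g (map_pmf f' w)\<bar> < e"
proof -
  define P where "P = product_topology (\<lambda>_ :: nat. X) UNIV"
  have P_compact: "compact_space P"
    unfolding P_def compact_space_product_topology using compact_X by simp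
  have P_top: "topspace P = {f. \<forall>i. f i \<in> K}"
    by (auto simp: P_def topspace_X)
  have mapK: "map_pmf f w \<in> pmfs_on K" if "f \<in> topspace P" for f
    using that by (auto simp: P_top pmfs_on_def)
  have "\<exists>G. finite G \<and> (\<forall>f'\<in>topspace P. (\<forall>i\<in>set_pmf w. f' i \<inter> G = f i \<inter> G) \<longrightarrow>
      \<bar>g (map_pmf f' w) - g (map_pmf f w)\<bar> < e / 2)" if f: "f \<in> topspace P" for f
  proof -
    let ?U = "{x \<in> topspace (pmf_space K). g x \<in> ball (g (map_pmf f w)) (e / 2)}"
    have "openin (pmf_space K) ?U"
      by (rule openin_continuous_map_preimage[OF g]) simp
    moreover have "map_pmf f w \<in> ?U" using mapK[OF f] e by simp
    ultimately obtain G \<eta> where G: "finite G" "\<eta> > 0" "pmf_nhd K G \<eta> (map_pmf f w) \<subseteq> ?U"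
      unfolding openin_pmf_space by blast
    have "\<bar>g (map_pmf f' w) - g (map_pmf f w)\<bar> < e / 2"
      if f': "f' \<in> topspace P" "\<forall>i\<in>set_pmf w. f' i \<inter> G = f i \<inter> G" for f'
    proof -
      have "restr_pmf G (map_pmf f' w) = restr_pmf G (map_pmf f w)"
        unfolding restr_pmf_def map_pmf_comp using f'(2) by (intro map_pmf_cong) auto
      then have "map_pmf f' w \<in> pmf_nhd K G \<eta> (map_pmf f w)"
        using mapK[OF f'(1)] G(2) by (simp add: pmf_nhd_def close_pmf_def)
      then show ?thesis using G(3) by (auto simp: dist_real_def abs_minus_commute)
    qed
    then show ?thesis using G(1) by blast
  qed
  then obtain \<G> where \<G>: "\<And>f. f \<in> topspace P \<Longrightarrow> finite (\<G> f)"
    "\<And>f f'. f \<in> topspace P \<Longrightarrow> f' \<in> topspace P \<Longrightarrow> (\<forall>i\<in>set_pmf w. f' i \<inter> \<G> f = f i \<inter> \<G> f) \<Longrightarrow>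
      \<bar>g (map_pmf f' w) - g (map_pmf f w)\<bar> < e / 2" by metis
  define O' where "O' f = (\<Pi>\<^sub>E i\<in>UNIV. if i \<in> set_pmf w then {y \<in> K. y \<inter> \<G> f \<in> {f i \<inter> \<G> f}} else K)" for f
  have "openin P (O' f)" if f: "f \<in> topspace P" for f
    unfolding O'_def P_def
  proof (rule product_topology_basis)
    fix i
    have "openin X {y \<in> K. y \<inter> \<G> f \<in> {f i \<inter> \<G> f}}" by (rule openin_agree[OF \<G>(1)[OF f]])
    moreover have "openin X K" using openin_topspace[of X] by (simp add: topspace_X)
    ultimately show "openin X (if i \<in> set_pmf w then {y \<in> K. y \<inter> \<G> f \<in> {f i \<inter> \<G> f}} else K)"
      by simp
  next
    show "finite {i. (if i \<in> set_pmf w then {y \<in> K. y \<inter> \<G> f \<in> {f i \<inter> \<G> f}} else K) \<noteq> topspace X}"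
      by (rule finite_subset[OF _ w]) (auto simp: topspace_X)
  qed
  moreover have mem: "f' \<in> O' f \<longleftrightarrow> f' \<in> topspace P \<and> (\<forall>i\<in>set_pmf w. f' i \<inter> \<G> f = f i \<inter> \<G> f)" for f f'
    unfolding O'_def P_top PiE_UNIV_domain Pi_iff by (auto split: if_splits)
  moreover have "topspace P \<subseteq> \<Union>(O' ` topspace P)" using mem by blast
  ultimately obtain \<F> where \<F>: "finite \<F>" "\<F> \<subseteq> O' ` topspace P" "topspace P \<subseteq> \<Union>\<F>"
    using compactinD[of P "topspace P" "O' ` topspace P"] P_compact
    by (auto simp: compact_space_def)
  then obtain F where F: "finite F" "F \<subseteq> topspace P" "\<F> = O' ` F"
    using finite_subset_image by metis
  define G where "G = \<Union>(\<G> ` F)"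
  have key: "\<bar>g (map_pmf f w) - g (map_pmf f' w)\<bar> < e"
    if ff': "\<And>i. f i \<in> K \<and> f' i \<in> K \<and> f i \<inter> G = f' i \<inter> G" for f f'
  proof -
    have fP: "f \<in> topspace P" "f' \<in> topspace P" using ff' by (auto simp: P_top)
    then obtain k where k: "k \<in> F" "f \<in> O' k" using \<F>(3) F(3) by blast
    have kP: "k \<in> topspace P" using k F by blast
    have 1: "\<forall>i\<in>set_pmf w. f i \<inter> \<G> k = k i \<inter> \<G> k"
      by (rule mem[THEN iffD1, OF k(2), THEN conjunct2])
    have "f i \<inter> \<G> k = f' i \<inter> \<G> k" for i
    proof -
      have "\<G> k \<subseteq> G" using k(1) by (auto simp: G_def)
      then show ?thesis using ff'[of i] by blast
    qed
    then have 2: "\<forall>i\<in>set_pmf w. f' i \<inter> \<G> k = k i \<inter> \<G> k" using 1 by simp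
    show ?thesis using \<G>(2)[OF kP fP(1) 1] \<G>(2)[OF kP fP(2) 2] by linarith
  qed
  have "finite G" using F \<G>(1) by (auto simp: G_def)
  then show ?thesis
  proof (rule that)
    fix f f' :: "nat \<Rightarrow> 'i set"
    assume "\<And>i. f i \<in> K \<and> f' i \<in> K \<and> f i \<inter> G = f' i \<inter> G"
    then show "\<bar>g (map_pmf f w) - g (map_pmf f' w)\<bar> < e" by (rule key)
  qed
qed

end

text \<open>
  Round the masses down to multiples of \<open>1 / n\<close> on a finite set that carries almost everything. The
  mass that is left over is put at \<open>0\<close>, which does no harm, since only a lower bound is needed.
  The point is that there are only countably many finite multisets.
\<close>

lemma multiset_pmf_dense:
  fixes w :: "nat pmf"
  assumes e: "e > 0"
  obtains M where "M \<noteq> {#}" "\<And>A. measure (pmf_of_multiset M) A > measure w A - e"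
proof -
  have "e / 2 > 0" using e by simp
  then obtain F where F: "finite F" "F \<subseteq> set_pmf w" "measure w F > 1 - e / 2"
    by (rule pmf_finite_approx)
  obtain N where N: "F \<subseteq> {..<N}" using F(1) unfolding finite_nat_iff_bounded by blast
  define n where "n = Suc (nat \<lceil>2 * N / e\<rceil>)"
  have n: "n > 0" by (simp add: n_def)
  have "2 * N / e \<le> n" unfolding n_def by linarith
  then have "2 * N \<le> n * e" using e by (simp add: pos_divide_le_eq)
  then have Nn: "real N / n \<le> e / 2" using n by (simp add: pos_divide_le_eq mult.commute)
  define c where "c i = nat \<lfloor>n * pmf w i\<rfloor>" for i
  have c: "real (c i) \<le> n * pmf w i" "n * pmf w i - 1 \<le> real (c i)" for i
    by (auto simp: c_def)
  have "real (\<Sum>i<N. c i) \<le> n * (\<Sum>i<N. pmf w i)"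
    unfolding sum_distrib_left of_nat_sum by (intro sum_mono c)
  also have "(\<Sum>i<N. pmf w i) = measure w {..<N}" by (simp add: measure_measure_pmf_finite)
  also have "real n * measure w {..<N} \<le> real n" by (simp add: mult_left_le)
  finally have cn: "(\<Sum>i<N. c i) \<le> n" by (simp only: of_nat_le_iff)
  define M where "M = (\<Sum>i<N. replicate_mset (c i) i) + replicate_mset (n - (\<Sum>i<N. c i)) 0"
  have size: "size M = n" using cn by (simp add: M_def size_multiset_sum)
  then have ne: "M \<noteq> {#}" using n by auto
  have count: "c i \<le> count M i" if "i < N" for i
  proof -
    have "c i = (\<Sum>j<N. if j = i then c i else 0)" using that by simp
    also have "\<dots> \<le> (\<Sum>j<N. count (replicate_mset (c j) j) i)" by (intro sum_mono) auto
    finally show ?thesis by (simp add: M_def count_sum)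
  qed
  have key: "measure (pmf_of_multiset M) A > measure w A - e" for A
  proof -
    have "measure w A \<le> measure w ((A \<inter> {..<N}) \<union> - F)"
      by (rule measure_pmf.finite_measure_mono) (use N in auto)
    also have "\<dots> \<le> measure w (A \<inter> {..<N}) + measure w (- F)"
      by (rule measure_subadditive) auto
    also have "measure w (- F) = 1 - measure w F"
      using measure_pmf.prob_compl[of F w] by (simp add: Compl_eq_Diff_UNIV)
    also have "measure w (A \<inter> {..<N}) = (\<Sum>i\<in>A \<inter> {..<N}. pmf w i)"
      by (simp add: measure_measure_pmf_finite)
    also have "\<dots> \<le> (\<Sum>i\<in>A \<inter> {..<N}. pmf (pmf_of_multiset M) i + 1 / real n)"
    proof (rule sum_mono)
      fix i assume i: "i \<in> A \<inter> {..<N}"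
      have "real n * pmf w i \<le> real (count M i) + 1" using c(2)[of i] count[of i] i by simp
      then have "pmf w i \<le> (real (count M i) + 1) / real n"
        using n by (simp add: pos_le_divide_eq mult.commute)
      then show "pmf w i \<le> pmf (pmf_of_multiset M) i + 1 / real n"
        by (simp add: pmf_of_multiset[OF ne] size add_divide_distrib)
    qed
    also have "\<dots> = measure (pmf_of_multiset M) (A \<inter> {..<N}) + real (card (A \<inter> {..<N})) / real n"
      by (simp add: sum.distrib measure_measure_pmf_finite)
    also have "measure (pmf_of_multiset M) (A \<inter> {..<N}) \<le> measure (pmf_of_multiset M) A"
      by (rule measure_pmf.finite_measure_mono) auto
    also have "real (card (A \<inter> {..<N})) / n \<le> real N / n"
      using card_mono[of "{..<N}" "A \<inter> {..<N}"] by (intro divide_right_mono) auto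
    finally show ?thesis using F(3) Nn by linarith
  qed
  show ?thesis by (rule that[OF ne key])
qed

text \<open>
  The kernel of \<open>fiber_transport_kernel\<close> is a coupling. That lemma asks one atom of \<open>x\<close> to be at most
  as large as one of \<open>y\<close>; this is arranged for the empty set by exchanging \<open>x\<close> and \<open>y\<close> if needed.
\<close>

lemma same_restr_coupling:
  fixes x y :: "'i set pmf"
  assumes same: "same_restr D x y"
  obtains \<pi> where "map_pmf fst \<pi> = x" "map_pmf snd \<pi> = y"
    "\<And>p. p \<in> set_pmf \<pi> \<Longrightarrow> fst p \<inter> D = snd p \<inter> D"
proof -
  have *: "\<exists>\<pi>. map_pmf fst \<pi> = x \<and> map_pmf snd \<pi> = y \<and> (\<forall>p\<in>set_pmf \<pi>. fst p \<inter> D = snd p \<inter> D)"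
    if h: "same_restr D x y" "pmf x {} \<le> pmf y {}" for x y :: "'i set pmf"
  proof -
    obtain \<kappa> where \<kappa>: "bind_pmf x \<kappa> = y"
      "\<And>m m'. m \<in> set_pmf x \<Longrightarrow> m' \<in> set_pmf (\<kappa> m) \<Longrightarrow> m' \<inter> D = m \<inter> D"
      using fiber_transport_kernel[OF h(1) refl h(2)] by blast
    define \<pi> where "\<pi> = bind_pmf x (\<lambda>m. map_pmf (Pair m) (\<kappa> m))"
    have "map_pmf fst \<pi> = x" by (simp add: \<pi>_def map_bind_pmf map_pmf_comp bind_return_pmf')
    moreover have "map_pmf snd \<pi> = y" by (simp add: \<pi>_def map_bind_pmf map_pmf_comp \<kappa>(1))
    moreover have "\<forall>p\<in>set_pmf \<pi>. fst p \<inter> D = snd p \<inter> D" using \<kappa>(2) by (auto simp: \<pi>_def)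
    ultimately show ?thesis by blast
  qed
  show ?thesis
  proof (cases "pmf x {} \<le> pmf y {}")
    case True
    then show ?thesis using *[OF same] that by metis
  next
    case False
    then have "same_restr D y x" "pmf y {} \<le> pmf x {}" using same by (auto simp: same_restr_def)
    then obtain \<pi> where \<pi>: "map_pmf fst \<pi> = y" "map_pmf snd \<pi> = x"
      "\<forall>p\<in>set_pmf \<pi>. fst p \<inter> D = snd p \<inter> D" using * by blast
    have sw: "map_pmf fst (map_pmf prod.swap \<pi>) = x" "map_pmf snd (map_pmf prod.swap \<pi>) = y"
      using \<pi>(1,2) by (simp_all add: map_pmf_comp)
    have sD: "fst p \<inter> D = snd p \<inter> D" if "p \<in> set_pmf (map_pmf prod.swap \<pi>)" for p
    proof -
      have "p \<in> prod.swap ` set_pmf \<pi>" using that by simp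
      then obtain p' where "p = prod.swap p'" "p' \<in> set_pmf \<pi>" by (rule imageE)
      then show ?thesis using \<pi>(3) by simp
    qed
    from sw show ?thesis by (rule that) (rule sD)
  qed
qed

lemma pmf_nat_representation:
  fixes \<pi> :: "'b pmf"
  obtains w :: "nat pmf" and f where "map_pmf f w = \<pi>" "\<And>i. f i \<in> set_pmf \<pi>"
proof -
  let ?S = "set_pmf \<pi>"
  have "map_pmf (from_nat_into ?S) (map_pmf (to_nat_on ?S) \<pi>) = map_pmf id \<pi>"
    unfolding map_pmf_comp by (intro map_pmf_cong) auto
  then have "map_pmf (from_nat_into ?S) (map_pmf (to_nat_on ?S) \<pi>) = \<pi>" by simp
  then show ?thesis by (rule that) (rule from_nat_into[OF set_pmf_not_empty])
qed

context compact_pair_family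
begin

text \<open>
  Collect the finite windows given by \<open>finite_dependence\<close> for all empirical weights and all
  precisions \<open>1 / Suc n\<close>. If \<open>x\<close> and \<open>y\<close> agree on this countable window, then a coupling represents
  them as images of one distribution \<open>w\<close> on the natural numbers under two sequences that agree on
  the window. For empirical weights instead of \<open>w\<close> the two values of \<open>g\<close> coincide, and they tend to
  \<open>g x\<close> and \<open>g y\<close> as the weights tend to \<open>w\<close>.
\<close>

lemma countable_dependence:
  assumes g: "continuous_map (pmf_space K) euclideanreal g"
  obtains D where "countable D"
    "\<And>x y. x \<in> pmfs_on K \<Longrightarrow> y \<in> pmfs_on K \<Longrightarrow> same_restr D x y \<Longrightarrow> g x = g y"
proof -
  define W where "W xs = pmf_of_multiset (mset (xs :: nat list))" for xs
  have finW: "finite (set_pmf (W xs))" if "xs \<noteq> []" for xs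
    using that by (simp add: W_def set_pmf_of_multiset)
  define Q where "Q xs n G \<longleftrightarrow> finite G \<and> (\<forall>f f'. (\<forall>i. f i \<in> K \<and> f' i \<in> K \<and> f i \<inter> G = f' i \<inter> G) \<longrightarrow>
      \<bar>g (map_pmf f (W xs)) - g (map_pmf f' (W xs))\<bar> < 1 / Suc n)" for xs n G
  define \<G> where "\<G> xs n = (SOME G. Q xs n G)" for xs n
  have Q: "Q xs n (\<G> xs n)" if ne: "xs \<noteq> []" for xs n
    unfolding \<G>_def
  proof (rule someI_ex)
    obtain G where "finite G" "\<And>f f'. (\<And>i. f i \<in> K \<and> f' i \<in> K \<and> f i \<inter> G = f' i \<inter> G) \<Longrightarrow>
      \<bar>g (map_pmf f (W xs)) - g (map_pmf f' (W xs))\<bar> < 1 / Suc n"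
      using finite_dependence[OF g _ finW[OF ne], of "1 / Suc n"] by auto
    then have "Q xs n G" unfolding Q_def by blast
    then show "\<exists>G. Q xs n G" ..
  qed
  have \<G>: "finite (\<G> xs n)"
    "(\<forall>i. f i \<in> K \<and> f' i \<in> K \<and> f i \<inter> \<G> xs n = f' i \<inter> \<G> xs n) \<Longrightarrow>
      \<bar>g (map_pmf f (W xs)) - g (map_pmf f' (W xs))\<bar> < 1 / Suc n"
    if "xs \<noteq> []" for xs n f f'
    using Q[OF that, of n] unfolding Q_def by simp_all
  define D where "D = (\<Union>xs\<in>{xs. xs \<noteq> []}. \<Union>n. \<G> xs n)"
  have cD: "countable D" unfolding D_def using \<G>(1)
    by (intro countable_UN) (auto intro: countable_finite)
  have gD: "g x = g y" if x: "x \<in> pmfs_on K" and y: "y \<in> pmfs_on K" and same: "same_restr D x y" for x y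
  proof -
    obtain \<pi> where \<pi>: "map_pmf fst \<pi> = x" "map_pmf snd \<pi> = y"
      "\<And>p. p \<in> set_pmf \<pi> \<Longrightarrow> fst p \<inter> D = snd p \<inter> D" using same_restr_coupling[OF same] by blast
    obtain w :: "nat pmf" and f where f: "map_pmf f w = \<pi>" "\<And>i. f i \<in> set_pmf \<pi>"
      using pmf_nat_representation[of \<pi>] by blast
    have fst_map: "map_pmf (\<lambda>i. fst (f i)) w = x" and snd_map: "map_pmf (\<lambda>i. snd (f i)) w = y"
      using \<pi>(1,2) f(1) by (auto simp: map_pmf_comp)
    have fK: "fst (f i) \<in> K" "snd (f i) \<in> K" for i
    proof -
      have "fst (f i) \<in> set_pmf x" "snd (f i) \<in> set_pmf y"
        using f(2)[of i] unfolding \<pi>(1,2)[symmetric] by simp_all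
      then show "fst (f i) \<in> K" "snd (f i) \<in> K" using x y by (auto simp: pmfs_on_def)
    qed
    have eq: "g (map_pmf (\<lambda>i. fst (f i)) (W xs)) = g (map_pmf (\<lambda>i. snd (f i)) (W xs))" if ne: "xs \<noteq> []" for xs
    proof (rule ccontr)
      assume "\<not> ?thesis"
      then have "\<bar>g (map_pmf (\<lambda>i. fst (f i)) (W xs)) - g (map_pmf (\<lambda>i. snd (f i)) (W xs))\<bar> > 0" by simp
      then obtain n where n: "1 / Suc n < \<bar>g (map_pmf (\<lambda>i. fst (f i)) (W xs)) - g (map_pmf (\<lambda>i. snd (f i)) (W xs))\<bar>"
        using nat_approx_posE by blast
      have "fst (f i) \<inter> \<G> xs n = snd (f i) \<inter> \<G> xs n" for i
      proof -
        have "\<G> xs n \<subseteq> D" using ne by (auto simp: D_def)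
        then show ?thesis using \<pi>(3)[OF f(2)[of i]] by blast
      qed
      then show False using \<G>(2)[OF ne, of "\<lambda>i. fst (f i)" "\<lambda>i. snd (f i)" n] fK n by simp
    qed
    \<comment> \<open>continuity in the weights, uniformly over all weights that are close to \<open>w\<close>\<close>
    have approx: "\<exists>\<eta>>0. \<forall>xs. xs \<noteq> [] \<longrightarrow> (\<forall>A. measure (W xs) A > measure w A - \<eta>) \<longrightarrow>
        \<bar>g (map_pmf h (W xs)) - g (map_pmf h w)\<bar> < e"
      if e: "e > 0" and h: "\<And>i. h i \<in> K" for h :: "nat \<Rightarrow> 'i set" and e :: real
    proof -
      let ?U = "{z \<in> topspace (pmf_space K). g z \<in> ball (g (map_pmf h w)) e}"
      have hK: "map_pmf h v \<in> pmfs_on K" for v using h by (auto simp: pmfs_on_def)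
      have "openin (pmf_space K) ?U" by (rule openin_continuous_map_preimage[OF g]) simp
      moreover have "map_pmf h w \<in> ?U" using hK e by simp
      ultimately obtain G \<eta> where G: "finite G" "\<eta> > 0" "pmf_nhd K G \<eta> (map_pmf h w) \<subseteq> ?U"
        unfolding openin_pmf_space by blast
      have "\<bar>g (map_pmf h (W xs)) - g (map_pmf h w)\<bar> < e"
        if cl: "\<forall>A. measure (W xs) A > measure w A - \<eta>" for xs
      proof -
        have "close_pmf G \<eta> (map_pmf h w) (map_pmf h (W xs))"
          by (rule close_pmfI) (use cl in \<open>simp add: vimage_def\<close>)
        then have "map_pmf h (W xs) \<in> ?U" using hK G(3) by (auto simp: pmf_nhd_def)
        then show ?thesis by (auto simp: dist_real_def abs_minus_commute)
      qed
      then show ?thesis using G(2) by blast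
    qed
    have close: "\<bar>g x - g y\<bar> \<le> 2 * e" if e: "e > 0" for e
    proof -
      have "\<exists>\<eta>>0. \<forall>xs. xs \<noteq> [] \<longrightarrow> (\<forall>A. measure (W xs) A > measure w A - \<eta>) \<longrightarrow>
          \<bar>g (map_pmf (\<lambda>i. fst (f i)) (W xs)) - g x\<bar> < e"
        using approx[OF e, of "\<lambda>i. fst (f i)"] unfolding fst_map using fK(1) .
      then obtain \<eta>1 where \<eta>1: "\<eta>1 > 0"
        and near1: "\<forall>xs. xs \<noteq> [] \<longrightarrow> (\<forall>A. measure (W xs) A > measure w A - \<eta>1) \<longrightarrow>
          \<bar>g (map_pmf (\<lambda>i. fst (f i)) (W xs)) - g x\<bar> < e" by (elim exE conjE)
      have "\<exists>\<eta>>0. \<forall>xs. xs \<noteq> [] \<longrightarrow> (\<forall>A. measure (W xs) A > measure w A - \<eta>) \<longrightarrow>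
          \<bar>g (map_pmf (\<lambda>i. snd (f i)) (W xs)) - g y\<bar> < e"
        using approx[OF e, of "\<lambda>i. snd (f i)"] unfolding snd_map using fK(2) .
      then obtain \<eta>2 where \<eta>2: "\<eta>2 > 0"
        and near2: "\<forall>xs. xs \<noteq> [] \<longrightarrow> (\<forall>A. measure (W xs) A > measure w A - \<eta>2) \<longrightarrow>
          \<bar>g (map_pmf (\<lambda>i. snd (f i)) (W xs)) - g y\<bar> < e" by (elim exE conjE)
      have "min \<eta>1 \<eta>2 > 0" using \<eta>1 \<eta>2 by simp
      then obtain M where M: "M \<noteq> {#}" "\<And>A. measure (pmf_of_multiset M) A > measure w A - min \<eta>1 \<eta>2"
        using multiset_pmf_dense[of "min \<eta>1 \<eta>2" w] by blast
      obtain xs where xs: "mset xs = M" using ex_mset by blast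
      have ne: "xs \<noteq> []" using xs M(1) by auto
      have m: "measure (W xs) A > measure w A - min \<eta>1 \<eta>2" for A using M(2) by (simp add: W_def xs)
      have m1: "\<forall>A. measure (W xs) A > measure w A - \<eta>1"
      proof
        fix A show "measure (W xs) A > measure w A - \<eta>1" using m[of A] by linarith
      qed
      have m2: "\<forall>A. measure (W xs) A > measure w A - \<eta>2"
      proof
        fix A show "measure (W xs) A > measure w A - \<eta>2" using m[of A] by linarith
      qed
      show ?thesis
        using near1[THEN spec, THEN mp, OF ne, THEN mp, OF m1]
          near2[THEN spec, THEN mp, OF ne, THEN mp, OF m2] eq[OF ne] by linarith
    qed
    show ?thesis
    proof (rule ccontr)
      assume "g x \<noteq> g y"
      then show False using close[of "\<bar>g x - g y\<bar> / 4"] by simp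
    qed
  qed
  from cD show ?thesis by (rule that) (rule gD)
qed

end

section \<open>Regular measures on the space of pairs are discrete\<close>

context compact_pair_family
begin

lemma space_borel: "space (borel_sigma X) = K"
  and sets_borel: "sets (borel_sigma X) = sigma_sets K {U. openin X U}"
proof -
  have "{U. openin X U} \<subseteq> Pow (topspace X)" using openin_subset by blast
  then show "space (borel_sigma X) = K" "sets (borel_sigma X) = sigma_sets K {U. openin X U}"
    by (simp_all add: borel_sigma_def topspace_X)
qed

lemma open_borel: "openin X U \<Longrightarrow> U \<in> sets (borel_sigma X)"
  unfolding sets_borel by (rule sigma_sets.Basic) simp

lemma compl_borel: "E \<in> sets (borel_sigma X) \<Longrightarrow> K - E \<in> sets (borel_sigma X)"
  using sets.compl_sets[of E "borel_sigma X"] by (simp add: space_borel)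

lemma openin_compl_finite:
  assumes F: "finite F"
  shows "openin X (K - F)"
  unfolding openin_X
proof (intro conjI ballI)
  fix x assume x: "x \<in> K - F"
  define G where "G = x \<union> \<Union>(F \<inter> K)"
  have "finite G" using F finite_mem x by (auto simp: G_def)
  moreover have "y \<notin> F" if "y \<in> K" "y \<inter> G = x \<inter> G" for y
  proof
    assume y: "y \<in> F"
    have "y \<subseteq> G" using y that(1) by (auto simp: G_def)
    moreover have "x \<subseteq> G" by (simp add: G_def)
    ultimately have "y = x" using that(2) by auto
    then show False using x y by simp
  qed
  ultimately show "\<exists>G. finite G \<and> {y \<in> K. y \<inter> G = x \<inter> G} \<subseteq> K - F" by blast
qed simp

lemma singleton_borel: "x \<in> K \<Longrightarrow> {x} \<in> sets (borel_sigma X)"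
proof -
  assume x: "x \<in> K"
  have "K - (K - {x}) \<in> sets (borel_sigma X)"
    by (rule compl_borel[OF open_borel[OF openin_compl_finite]]) simp
  then show ?thesis using x by (simp add: double_diff)
qed

lemma countable_borel: "C \<subseteq> K \<Longrightarrow> countable C \<Longrightarrow> C \<in> sets (borel_sigma X)"
  by (rule sets.countable, rule singleton_borel, erule subsetD)

lemma openin_contains: "openin X {y \<in> K. p \<in> y}"
proof -
  have eq: "{y \<in> K. p \<in> y} = {y \<in> K. y \<inter> {p} \<in> {{p}}}" by auto
  show ?thesis unfolding eq by (rule openin_agree) simp
qed

lemma openin_doubletons:
  assumes W: "W \<subseteq> {x \<in> K. card x = 2}"
  shows "openin X W"
  unfolding openin_X
proof (intro conjI ballI)
  show "W \<subseteq> K" using W by blast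
  fix x assume x: "x \<in> W"
  then have xK: "x \<in> K" "card x = 2" using W by auto
  have "y \<in> W" if "y \<in> K" "y \<inter> x = x \<inter> x" for y
  proof -
    have "x \<subseteq> y" using that(2) by auto
    moreover have "card y \<le> card x" using card_mem[OF that(1)] xK by simp
    ultimately have "x = y" using card_seteq[OF finite_mem[OF that(1)]] by blast
    then show ?thesis using x by simp
  qed
  then show "\<exists>G. finite G \<and> {y \<in> K. y \<inter> G = x \<inter> G} \<subseteq> W"
    using finite_mem[OF xK(1)] by blast
qed

text \<open>
  Within the doubletons every point is isolated, and within the singletons every point is
  relatively isolated. Hence compact subsets of either layer are finite.
\<close>

lemma compact_doubletons_finite:
  assumes C: "C \<subseteq> {x \<in> K. card x = 2}" "compactin X C"
  shows "finite C"
proof -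
  have "\<exists>\<F>. finite \<F> \<and> \<F> \<subseteq> (\<lambda>x. {x}) ` C \<and> C \<subseteq> \<Union>\<F>"
    by (rule compactinD[OF C(2)]) (use C(1) openin_doubletons in auto)
  then obtain \<F> where \<F>: "finite \<F>" "\<F> \<subseteq> (\<lambda>x. {x}) ` C" "C \<subseteq> \<Union>\<F>" by blast
  have "finite (\<Union>\<F>)" using \<F>(1,2) by (intro finite_Union) auto
  then show ?thesis using \<F>(3) finite_subset by blast
qed

lemma compact_singletons_finite:
  assumes C: "C \<subseteq> {x \<in> K. card x = 1}" "compactin X C"
  shows "finite C"
proof -
  define U where "U p = {y \<in> K. p \<in> y}" for p
  have "\<exists>\<F>. finite \<F> \<and> \<F> \<subseteq> range U \<and> C \<subseteq> \<Union>\<F>"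
  proof (rule compactinD[OF C(2)])
    show "openin X V" if "V \<in> range U" for V using that openin_contains by (auto simp: U_def)
    show "C \<subseteq> \<Union>(range U)" using C(1) by (force simp: U_def card_1_singleton_iff)
  qed
  then obtain \<F> where \<F>: "finite \<F>" "\<F> \<subseteq> range U" "C \<subseteq> \<Union>\<F>" by blast
  obtain F where F: "finite F" "\<F> = U ` F" using finite_subset_image[OF \<F>(1,2)] by blast
  have "C \<subseteq> (\<lambda>p. {p}) ` F"
  proof
    fix x assume x: "x \<in> C"
    then obtain q where q: "x = {q}" using C(1) by (auto simp: card_1_singleton_iff)
    obtain p where "p \<in> F" "x \<in> U p" using \<F>(3) F(2) x by blast
    then show "x \<in> (\<lambda>p. {p}) ` F" using q by (auto simp: U_def)
  qed
  then show ?thesis using F(1) finite_subset by blast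
qed

definition atoms :: "'i set measure \<Rightarrow> 'i set set" where
  "atoms M = {x \<in> K. measure M {x} \<noteq> 0}"

lemma prob_measuresD:
  assumes "M \<in> prob_measures X"
  shows "space M = K" "sets M = sets (borel_sigma X)" "prob_space M"
    "E \<in> sets M \<Longrightarrow> emeasure M E = (SUP C\<in>{C. C \<subseteq> E \<and> compactin X C}. emeasure M C)"
  using assms by (simp_all add: prob_measures_def topspace_X regular_measure_def)

text \<open>
  By inner regularity the measure of \<open>E\<close> is approximated by that of finite sets without atoms.
\<close>

lemma null_of_finite_compacts:
  assumes M: "M \<in> prob_measures X" and E: "E \<in> sets M" "E \<inter> atoms M = {}" "E \<subseteq> K"
    and fin: "\<And>C. C \<subseteq> E \<Longrightarrow> compactin X C \<Longrightarrow> finite C"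
  shows "emeasure M E = 0"
proof -
  interpret prob_space M by (rule prob_measuresD(3)[OF M])
  have "emeasure M C = 0" if C: "C \<subseteq> E" "compactin X C" for C
  proof -
    have "finite C" by (rule fin[OF C])
    moreover have "{x} \<in> sets M" if "x \<in> C" for x
      using singleton_borel[of x] that C(1) E(3) prob_measuresD(2)[OF M] by blast
    moreover have "emeasure M {x} = 0" if "x \<in> C" for x
      using that C(1) E(2,3) by (auto simp: atoms_def emeasure_eq_measure)
    ultimately show ?thesis by (simp add: emeasure_eq_sum_singleton)
  qed
  then have "emeasure M E \<le> 0"
    unfolding prob_measuresD(4)[OF M E(1)] by (intro SUP_least) simp
  then show ?thesis by simp
qed

text \<open>
  Split the complement of the atoms by cardinality into three layers. In each of them compact sets
  are finite, so each is a null set.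
\<close>

lemma prob_measure_atomic:
  assumes M: "M \<in> prob_measures X"
  shows "countable (atoms M)" "emeasure M (atoms M) = 1" "atoms M \<in> sets M"
proof -
  interpret prob_space M by (rule prob_measuresD(3)[OF M])
  have "atoms M \<subseteq> {x. measure M {x} \<noteq> 0}" by (auto simp: atoms_def)
  then show c: "countable (atoms M)" using countable_support countable_subset by blast
  have sets: "sets M = sets (borel_sigma X)" by (rule prob_measuresD(2)[OF M])
  show aM: "atoms M \<in> sets M"
    unfolding sets by (rule countable_borel[OF _ c]) (auto simp: atoms_def)
  define E2 where "E2 = {x \<in> K. card x = 2} - atoms M"
  define E1 where "E1 = {x \<in> K. card x = 1} - atoms M"
  define E0 where "E0 = {{}} - atoms M"
  have S2: "{x \<in> K. card x = 2} \<in> sets M" unfolding sets by (rule open_borel[OF openin_doubletons]) simp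
  have S0: "{{}} \<in> sets M" unfolding sets by (rule singleton_borel[OF empty_mem])
  have K: "K \<in> sets M" using sets.top[of M] prob_measuresD(1)[OF M] by simp
  have split: "{x \<in> K. card x = 1} = K - {x \<in> K. card x = 2} - {{}}"
  proof -
    have "card x = 1 \<longleftrightarrow> card x \<noteq> 2 \<and> x \<noteq> {}" if "x \<in> K" for x
    proof -
      have "card x = 0 \<longleftrightarrow> x = {}" using finite_mem[OF that] by simp
      then show ?thesis using card_mem[OF that] by auto
    qed
    then show ?thesis by auto
  qed
  have S1: "{x \<in> K. card x = 1} \<in> sets M" unfolding split using K S2 S0 by (intro sets.Diff)
  have E: "E2 \<in> sets M" "E1 \<in> sets M" "E0 \<in> sets M"
    unfolding E2_def E1_def E0_def
    by (rule sets.Diff[OF S2 aM] sets.Diff[OF S1 aM] sets.Diff[OF S0 aM])+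
  have "emeasure M E2 = 0"
    by (rule null_of_finite_compacts[OF M E(1)])
      (auto simp: E2_def intro!: compact_doubletons_finite)
  moreover have "emeasure M E1 = 0"
    by (rule null_of_finite_compacts[OF M E(2)])
      (auto simp: E1_def intro!: compact_singletons_finite)
  moreover have "emeasure M E0 = 0"
    by (rule null_of_finite_compacts[OF M E(3)])
      (auto simp: E0_def empty_mem intro: finite_subset[of _ "{{}}"])
  moreover have "K - atoms M = E2 \<union> E1 \<union> E0"
    using split empty_mem by (auto simp: E2_def E1_def E0_def)
  ultimately have "emeasure M (K - atoms M) = 0"
    using E by (simp add: emeasure_Un_null_set null_sets_def emeasure_Un)
  moreover have "emeasure M (K - atoms M) + emeasure M (atoms M) = emeasure M K"
    using aM K by (subst plus_emeasure) (auto simp: atoms_def intro!: arg_cong[where f = "emeasure M"])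
  ultimately show "emeasure M (atoms M) = 1"
    using emeasure_space_1 prob_measuresD(1)[OF M] by simp
qed

text \<open>
  Sets outside \<open>K\<close> are sent to the empty set to obtain a map into the space. They carry no mass for
  the distributions in question.
\<close>

definition to_measure :: "'i set pmf \<Rightarrow> 'i set measure" where
  "to_measure m = distr (measure_pmf m) (borel_sigma X) (\<lambda>x. if x \<in> K then x else {})"

lemma to_measure_measurable:
  "(\<lambda>x. if x \<in> K then x else {}) \<in> measurable (measure_pmf m) (borel_sigma X)"
  by (simp add: measurable_def space_borel empty_mem)

lemma space_to_measure: "space (to_measure m) = K"
  and sets_to_measure: "sets (to_measure m) = sets (borel_sigma X)"
  by (simp_all add: to_measure_def space_borel)

lemma emeasure_to_measure:
  assumes "m \<in> pmfs_on K" "E \<in> sets (borel_sigma X)"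
  shows "emeasure (to_measure m) E = emeasure (measure_pmf m) E"
proof -
  have "emeasure (to_measure m) E =
      emeasure (measure_pmf m) ((\<lambda>x. if x \<in> K then x else {}) -` E)"
    using assms(2) to_measure_measurable by (simp add: to_measure_def emeasure_distr)
  also have "\<dots> = emeasure (measure_pmf m) E"
    by (rule emeasure_eq_AE) (use assms(1) in \<open>auto simp: AE_measure_pmf_iff pmfs_on_def\<close>)
  finally show ?thesis .
qed

lemma measure_to_measure:
  "m \<in> pmfs_on K \<Longrightarrow> E \<in> sets (borel_sigma X) \<Longrightarrow> measure (to_measure m) E = measure (measure_pmf m) E"
  by (simp add: measure_def emeasure_to_measure)

lemma prob_space_to_measure: "prob_space (to_measure m)"
  unfolding to_measure_def by (rule measure_pmf.prob_space_distr[OF to_measure_measurable])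

lemma continuous_borel_measurable:
  assumes "continuous_map X euclideanreal f"
  shows "f \<in> borel_measurable (borel_sigma X)"
proof (rule borel_measurableI)
  fix S :: "real set" assume "open S"
  then have "openin X {x \<in> topspace X. f x \<in> S}"
    using openin_continuous_map_preimage[OF assms] by simp
  moreover have "f -` S \<inter> space (borel_sigma X) = {x \<in> topspace X. f x \<in> S}"
    by (auto simp: space_borel topspace_X)
  ultimately show "f -` S \<inter> space (borel_sigma X) \<in> sets (borel_sigma X)"
    using open_borel by simp
qed

lemma integral_to_measure:
  assumes m: "m \<in> pmfs_on K" and f: "continuous_map X euclideanreal f"
  shows "(LINT x|to_measure m. f x) = (LINT x|measure_pmf m. f x)"
proof -
  have "(LINT x|to_measure m. f x) = (LINT x|measure_pmf m. f (if x \<in> K then x else {}))"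
    unfolding to_measure_def
    by (rule integral_distr[OF to_measure_measurable continuous_borel_measurable[OF f]])
  also have "\<dots> = (LINT x|measure_pmf m. f x)"
    by (rule integral_cong_AE) (use m in \<open>auto simp: AE_measure_pmf_iff pmfs_on_def\<close>)
  finally show ?thesis .
qed

text \<open>
  Almost all mass inside a set \<open>E\<close>, and almost all mass outside it, is carried by finite sets, which
  are compact and closed.
\<close>

lemma to_measure_regular:
  assumes m: "m \<in> pmfs_on K"
  shows "regular_measure X (to_measure m)"
proof -
  let ?M = "to_measure m"
  interpret M: prob_space ?M by (rule prob_space_to_measure)
  have fin_sets: "F \<in> sets (borel_sigma X)" if "finite F" "F \<subseteq> K" for F
    by (rule countable_borel[OF that(2) countable_finite[OF that(1)]])
  have approx: "\<exists>F. finite F \<and> F \<subseteq> E \<and> measure ?M E < measure ?M F + e"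
    if E: "E \<in> sets (borel_sigma X)" and e: "e > 0" for E e
  proof -
    obtain F where F: "finite F" "F \<subseteq> set_pmf m" "measure m F > 1 - e"
      using e by (rule pmf_finite_approx)
    have EK: "E \<subseteq> K" using sets.sets_into_space[OF E] by (simp add: space_borel)
    have "measure m E \<le> measure m ((F \<inter> E) \<union> - F)"
      by (rule measure_pmf.finite_measure_mono) auto
    also have "\<dots> \<le> measure m (F \<inter> E) + measure m (- F)" by (rule measure_subadditive) auto
    also have "measure m (- F) = 1 - measure m F"
      using measure_pmf.prob_compl[of F m] by (simp add: Compl_eq_Diff_UNIV)
    finally have "measure m E < measure m (F \<inter> E) + e" using F(3) by linarith
    moreover have FE: "F \<inter> E \<in> sets (borel_sigma X)"
      by (rule fin_sets[OF finite_Int[OF disjI1[OF F(1)]]]) (use EK in blast)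
    ultimately have "measure ?M E < measure ?M (F \<inter> E) + e"
      unfolding measure_to_measure[OF m E] measure_to_measure[OF m FE] by simp
    then show ?thesis using F(1) by (intro exI[of _ "F \<inter> E"] conjI) simp_all
  qed
  show ?thesis
    unfolding regular_measure_def sets_to_measure
  proof (intro ballI conjI)
    fix E assume E: "E \<in> sets (borel_sigma X)"
    have EK: "E \<subseteq> K" using sets.sets_into_space[OF E] by (simp add: space_borel)
    have EM: "E \<in> sets ?M" using E by (simp add: sets_to_measure)
    show "emeasure ?M E = (SUP C\<in>{C. C \<subseteq> E \<and> compactin X C}. emeasure ?M C)"
    proof (rule antisym)
      show "(SUP C\<in>{C. C \<subseteq> E \<and> compactin X C}. emeasure ?M C) \<le> emeasure ?M E"
        using EM by (intro SUP_least emeasure_mono) auto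
      show "emeasure ?M E \<le> (SUP C\<in>{C. C \<subseteq> E \<and> compactin X C}. emeasure ?M C)"
      proof (rule ennreal_le_epsilon)
        fix e :: real assume e: "0 < e"
        obtain F where F: "finite F" "F \<subseteq> E" "measure ?M E < measure ?M F + e"
          using approx[OF E e] by blast
        have "emeasure ?M E \<le> emeasure ?M F + ennreal e"
          using F(3) e by (simp add: M.emeasure_eq_measure flip: ennreal_plus)
        also have "emeasure ?M F \<le> (SUP C\<in>{C. C \<subseteq> E \<and> compactin X C}. emeasure ?M C)"
          using F(1,2) EK by (intro SUP_upper) (auto intro!: finite_imp_compactin simp: topspace_X)
        finally show "emeasure ?M E \<le> (SUP C\<in>{C. C \<subseteq> E \<and> compactin X C}. emeasure ?M C) + ennreal e"
          by (simp add: add_right_mono)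
      qed
    qed
    show "emeasure ?M E = (INF U\<in>{U. E \<subseteq> U \<and> openin X U}. emeasure ?M U)"
    proof (rule antisym)
      show "emeasure ?M E \<le> (INF U\<in>{U. E \<subseteq> U \<and> openin X U}. emeasure ?M U)"
        by (intro INF_greatest emeasure_mono) (auto simp: sets_to_measure open_borel)
      show "(INF U\<in>{U. E \<subseteq> U \<and> openin X U}. emeasure ?M U) \<le> emeasure ?M E"
      proof (rule ennreal_le_epsilon)
        fix e :: real assume e: "0 < e"
        obtain F where F: "finite F" "F \<subseteq> K - E" "measure ?M (K - E) < measure ?M F + e"
          using approx[OF compl_borel[OF E] e] by blast
        have FM: "F \<in> sets ?M" unfolding sets_to_measure using F(1,2) by (intro fin_sets) auto
        have "measure ?M (K - F) = 1 - measure ?M F"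
          using M.prob_compl[OF FM] by (simp add: space_to_measure)
        moreover have "measure ?M (K - E) = 1 - measure ?M E"
          using M.prob_compl[OF EM] by (simp add: space_to_measure)
        ultimately have "measure ?M (K - F) \<le> measure ?M E + e" using F(3) by linarith
        then have "emeasure ?M (K - F) \<le> emeasure ?M E + ennreal e"
          using e by (simp add: M.emeasure_eq_measure flip: ennreal_plus)
        moreover have "(INF U\<in>{U. E \<subseteq> U \<and> openin X U}. emeasure ?M U) \<le> emeasure ?M (K - F)"
          by (rule INF_lower) (use F(2) EK openin_compl_finite[OF F(1)] in auto)
        ultimately show "(INF U\<in>{U. E \<subseteq> U \<and> openin X U}. emeasure ?M U) \<le> emeasure ?M E + ennreal e"
          by (rule order_trans[rotated])
      qed
    qed
  qed
qed

lemma to_measure_in: "m \<in> pmfs_on K \<Longrightarrow> to_measure m \<in> prob_measures X"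
  by (simp add: prob_measures_def space_to_measure topspace_X sets_to_measure
      prob_space_to_measure to_measure_regular)

text \<open>
  By \<open>prob_measure_atomic\<close>, the masses of the atoms are those of a discrete distribution.
\<close>

lemma to_measure_surj:
  assumes M: "M \<in> prob_measures X"
  obtains m where "m \<in> pmfs_on K" "to_measure m = M"
proof -
  interpret prob_space M by (rule prob_measuresD(3)[OF M])
  have sets: "sets M = sets (borel_sigma X)" by (rule prob_measuresD(2)[OF M])
  let ?C = "atoms M"
  note C = prob_measure_atomic[OF M]
  have CK: "?C \<subseteq> K" by (auto simp: atoms_def)
  have single: "{x} \<in> sets M" if "x \<in> K" for x unfolding sets by (rule singleton_borel[OF that])
  define f where "f x = (if x \<in> ?C then measure M {x} else 0)" for x
  have "(\<integral>\<^sup>+ x. ennreal (f x) \<partial>count_space UNIV) = (\<integral>\<^sup>+ x. emeasure M {x} \<partial>count_space ?C)"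
    by (subst nn_integral_count_space_indicator)
      (auto intro!: nn_integral_cong simp: f_def emeasure_eq_measure indicator_def)
  also have "\<dots> = emeasure M ?C"
    by (rule emeasure_countable_singleton[symmetric]) (use C(1) CK single in auto)
  finally have f1: "(\<integral>\<^sup>+ x. ennreal (f x) \<partial>count_space UNIV) = 1" using C(2) by simp
  define m where "m = embed_pmf f"
  have pmf_m: "pmf m x = f x" for x
    unfolding m_def by (rule pmf_embed_pmf[OF _ f1]) (simp add: f_def)
  have set_m: "set_pmf m = ?C" by (auto simp: set_pmf_iff pmf_m f_def atoms_def split: if_splits)
  have mK: "m \<in> pmfs_on K" using set_m CK by (simp add: pmfs_on_def)
  have "to_measure m = M"
  proof (rule measure_eqI)
    show "sets (to_measure m) = sets M" by (simp add: sets_to_measure sets)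
    fix E assume "E \<in> sets (to_measure m)"
    then have E: "E \<in> sets (borel_sigma X)" "E \<in> sets M" by (simp_all add: sets_to_measure sets)
    have "emeasure (to_measure m) E = emeasure m E" by (rule emeasure_to_measure[OF mK E(1)])
    also have "\<dots> = emeasure m (E \<inter> ?C)"
      by (rule emeasure_eq_AE) (auto simp: AE_measure_pmf_iff set_m)
    also have "\<dots> = (\<integral>\<^sup>+ x. emeasure m {x} \<partial>count_space (E \<inter> ?C))"
      by (rule emeasure_countable_singleton) (use C(1) in auto)
    also have "\<dots> = (\<integral>\<^sup>+ x. emeasure M {x} \<partial>count_space (E \<inter> ?C))"
      by (intro nn_integral_cong) (simp add: emeasure_pmf_single pmf_m f_def emeasure_eq_measure)
    also have "\<dots> = emeasure M (E \<inter> ?C)"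
      by (rule emeasure_countable_singleton[symmetric]) (use C(1) CK single in auto)
    also have "\<dots> = emeasure M E"
    proof (rule emeasure_eq_AE)
      have "AE x in M. x \<in> ?C" using C(2) prob_eq_1[OF C(3)] by (simp add: emeasure_eq_measure)
      then show "AE x in M. x \<in> E \<inter> ?C \<longleftrightarrow> x \<in> E" by eventually_elim auto
    qed (use E C(3) in auto)
    finally show "emeasure (to_measure m) E = emeasure M E" .
  qed
  then show ?thesis using that mK by blast
qed

lemma to_measure_inj: "inj_on to_measure (pmfs_on K)"
proof (rule inj_onI)
  fix m m' assume m: "m \<in> pmfs_on K" "m' \<in> pmfs_on K" "to_measure m = to_measure m'"
  show "m = m'"
  proof (rule pmf_eqI)
    fix x
    show "pmf m x = pmf m' x"
    proof (cases "x \<in> K")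
      case True
      then have "measure m {x} = measure m' {x}"
        using measure_to_measure[OF m(1) singleton_borel] measure_to_measure[OF m(2) singleton_borel] m(3)
        by simp
      then show ?thesis by (simp add: measure_pmf_single)
    next
      case False
      then have "x \<notin> set_pmf m" "x \<notin> set_pmf m'" using m by (auto simp: pmfs_on_def)
      then show ?thesis by (simp add: set_pmf_iff)
    qed
  qed
qed

text \<open>
  Finitely many basic neighborhoods on which \<open>f\<close> varies by less than \<open>e\<close> cover the compact space; as
  \<open>x \<inter> G\<close> is itself a point of the space, it lies in the same one as \<open>x\<close>.
\<close>

lemma finite_window:
  assumes f: "continuous_map X euclideanreal f" and e: "e > 0"
  obtains G where "finite G" "\<And>x. x \<in> K \<Longrightarrow> \<bar>f x - f (x \<inter> G)\<bar> < e"
proof -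
  have "\<exists>G. finite G \<and> (\<forall>y\<in>K. y \<inter> G = x \<inter> G \<longrightarrow> \<bar>f y - f x\<bar> < e / 2)" if x: "x \<in> K" for x
  proof -
    let ?U = "{y \<in> topspace X. f y \<in> ball (f x) (e / 2)}"
    have "openin X ?U" by (rule openin_continuous_map_preimage[OF f]) simp
    moreover have "x \<in> ?U" using x e by (simp add: topspace_X)
    ultimately obtain G where G: "finite G" "{y \<in> K. y \<inter> G = x \<inter> G} \<subseteq> ?U"
      unfolding openin_X by blast
    have "\<bar>f y - f x\<bar> < e / 2" if "y \<in> K" "y \<inter> G = x \<inter> G" for y
      using G(2) that by (auto simp: dist_real_def abs_minus_commute)
    then show ?thesis using G(1) by blast
  qed
  then obtain \<G> where \<G>: "\<And>x. x \<in> K \<Longrightarrow> finite (\<G> x)"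
    "\<And>x y. x \<in> K \<Longrightarrow> y \<in> K \<Longrightarrow> y \<inter> \<G> x = x \<inter> \<G> x \<Longrightarrow> \<bar>f y - f x\<bar> < e / 2"
    by metis
  define U where "U x = {y \<in> K. y \<inter> \<G> x \<in> {x \<inter> \<G> x}}" for x
  have "\<exists>\<F>. finite \<F> \<and> \<F> \<subseteq> U ` K \<and> topspace X \<subseteq> \<Union>\<F>"
  proof (rule compactinD)
    show "compactin X (topspace X)" using compact_X by (simp add: compact_space_def)
    show "openin X V" if V: "V \<in> U ` K" for V
    proof -
      obtain x where x: "x \<in> K" "V = U x" using V by blast
      show ?thesis unfolding x(2) U_def by (rule openin_agree[OF \<G>(1)[OF x(1)]])
    qed
    show "topspace X \<subseteq> \<Union>(U ` K)" by (auto simp: topspace_X U_def)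
  qed
  then obtain \<F> where \<F>: "finite \<F>" "\<F> \<subseteq> U ` K" "topspace X \<subseteq> \<Union>\<F>" by blast
  obtain F where F: "F \<subseteq> K" "finite F" "\<F> = U ` F" using finite_subset_image[OF \<F>(1,2)] by blast
  define G where "G = \<Union>(\<G> ` F)"
  have fin: "finite G" using F \<G>(1) by (auto simp: G_def)
  have key: "\<bar>f x - f (x \<inter> G)\<bar> < e" if x: "x \<in> K" for x
  proof -
    obtain z where z: "z \<in> F" "x \<in> U z" using \<F>(3) F(3) x by (auto simp: topspace_X)
    have zK: "z \<in> K" using z F by blast
    have xz: "x \<inter> \<G> z = z \<inter> \<G> z" using z(2) by (simp add: U_def)
    have xG: "x \<inter> G \<in> K" by (rule down[OF x]) auto
    have "x \<inter> G \<inter> \<G> z = z \<inter> \<G> z" using xz z(1) by (auto simp: G_def)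
    then show ?thesis using \<G>(2)[OF zK x xz] \<G>(2)[OF zK xG] by linarith
  qed
  from fin show ?thesis by (rule that) (rule key)
qed

text \<open>
  By \<open>finite_window\<close> the integral of a continuous function is, up to a small error, a finite
  combination of probabilities of events in one finite window.
\<close>

lemma to_measure_continuous: "continuous_map (pmf_space K) (P_space X) to_measure"
  unfolding P_space_def
proof (rule continuous_on_generated_topo)
  let ?S = "{{M \<in> prob_measures X. (LINT x|M. f x) \<in> U} | f U. continuous_map X euclideanreal f \<and> open U}"
  have "\<Union>?S = prob_measures X"
    using topspace_P_space[of X] unfolding P_space_def topology_generated_by_topspace .
  then show "to_measure ` topspace (pmf_space K) \<subseteq> \<Union>?S" using to_measure_in by auto
  fix W assume "W \<in> ?S"
  then obtain f U where W: "W = {M \<in> prob_measures X. (LINT x|M. f x) \<in> U}"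
    and f: "continuous_map X euclideanreal f" and U: "open U" by blast
  have pre: "to_measure -` W \<inter> topspace (pmf_space K) = {m \<in> pmfs_on K. (LINT x|measure_pmf m. f x) \<in> U}"
    using to_measure_in integral_to_measure[OF _ f] by (auto simp: W)
  show "openin (pmf_space K) (to_measure -` W \<inter> topspace (pmf_space K))"
    unfolding pre openin_pmf_space
  proof (intro conjI ballI)
    fix m assume "m \<in> {m \<in> pmfs_on K. (LINT x|measure_pmf m. f x) \<in> U}"
    then have m: "m \<in> pmfs_on K" "(LINT x|measure_pmf m. f x) \<in> U" by auto
    obtain e where e: "e > 0" "ball (LINT x|measure_pmf m. f x) e \<subseteq> U"
      using U m(2) openE by blast
    have "e / 4 > 0" using e by simp
    then obtain G where G: "finite G" "\<And>x. x \<in> K \<Longrightarrow> \<bar>f x - f (x \<inter> G)\<bar> < e / 4"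
      using finite_window[OF f] by blast
    define B where "B = (\<Sum>j\<in>Pow G. \<bar>f j\<bar>)"
    have B: "B \<ge> 0" by (simp add: B_def sum_nonneg)
    define \<eta> where "\<eta> = e / (4 * (B + 1))"
    have \<eta>: "\<eta> > 0" "B * \<eta> \<le> e / 4" using e(1) B by (auto simp: \<eta>_def field_simps)
    define s where "s y = (\<Sum>j\<in>Pow G. f j * measure y {x. x \<inter> G \<in> {j}})" for y :: "'i set pmf"
    have near: "\<bar>(LINT x|measure_pmf y. f x) - s y\<bar> \<le> e / 4" if y: "y \<in> pmfs_on K" for y
    proof -
      define h where "h x = (\<Sum>j\<in>Pow G. f j * indicator {x. x \<inter> G \<in> {j}} x)" for x
      have hx: "h x = f (x \<inter> G)" for x
      proof -
        have "h x = (\<Sum>j\<in>Pow G. if j = x \<inter> G then f j else 0)"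
          unfolding h_def by (intro sum.cong) (auto simp: indicator_def)
        then show ?thesis using G(1) by simp
      qed
      have sy: "s y = (LINT x|measure_pmf y. h x)"
        unfolding s_def h_def by (rule integral_weighted_indicators[symmetric])
      have hint: "integrable (measure_pmf y) h"
        unfolding h_def by (rule integrable_weighted_indicators)
      have close: "AE x in measure_pmf y. \<bar>f x - h x\<bar> \<le> e / 4"
        using y G(2) by (auto simp: AE_measure_pmf_iff pmfs_on_def hx less_imp_le)
      have dint: "integrable (measure_pmf y) (\<lambda>x. f x - h x)"
        by (rule measure_pmf.integrable_const_bound[where B = "e / 4"]) (use close in auto)
      then have fint: "integrable (measure_pmf y) f"
        using Bochner_Integration.integrable_add[OF dint hint] by simp
      have "(LINT x|measure_pmf y. f x) - s y = (LINT x|measure_pmf y. f x - h x)"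
        unfolding sy by (rule Bochner_Integration.integral_diff[OF fint hint, symmetric])
      also have "\<bar>\<dots>\<bar> \<le> (LINT x|measure_pmf y. e / 4)"
        by (rule order_trans[OF integral_abs_bound], rule integral_mono_AE) (use dint close in auto)
      finally show ?thesis by simp
    qed
    have "y \<in> {m \<in> pmfs_on K. (LINT x|measure_pmf m. f x) \<in> U}" if y: "y \<in> pmf_nhd K G \<eta> m" for y
    proof -
      have yK: "y \<in> pmfs_on K" and cl: "close_pmf G \<eta> m y" using y by (auto simp: pmf_nhd_def)
      have "\<bar>s m - s y\<bar> \<le> (\<Sum>j\<in>Pow G. \<bar>f j\<bar> * \<bar>measure m {x. x \<inter> G \<in> {j}} - measure y {x. x \<inter> G \<in> {j}}\<bar>)"
        unfolding s_def sum_subtractf[symmetric] right_diff_distrib[symmetric]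
        by (rule order_trans[OF sum_abs]) (simp add: abs_mult)
      also have "\<dots> \<le> (\<Sum>j\<in>Pow G. \<bar>f j\<bar> * \<eta>)"
        by (intro sum_mono mult_left_mono less_imp_le[OF close_pmfD[OF cl]]) simp
      also have "\<dots> = B * \<eta>" by (simp add: B_def sum_distrib_right)
      also have "\<dots> \<le> e / 4" by (rule \<eta>(2))
      finally have sm: "\<bar>s m - s y\<bar> \<le> e / 4" .
      have "\<bar>(LINT x|measure_pmf m. f x) - (LINT x|measure_pmf y. f x)\<bar> < e"
        using near[OF m(1)] near[OF yK] sm e(1) by linarith
      then show ?thesis using e(2) yK by (auto simp: dist_real_def)
    qed
    then show "\<exists>G \<eta>. finite G \<and> 0 < \<eta> \<and> pmf_nhd K G \<eta> m \<subseteq> {m \<in> pmfs_on K. (LINT x|measure_pmf m. f x) \<in> U}"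
      using G(1) \<eta>(1) by blast
  qed blast
qed

text \<open>
  The events of a finite window are clopen, so their indicators are among the functions whose
  integrals define the weak* topology.
\<close>

lemma to_measure_open: "open_map (pmf_space K) (P_space X) to_measure"
  unfolding open_map_def
proof (intro allI impI)
  fix V assume V: "openin (pmf_space K) V"
  show "openin (P_space X) (to_measure ` V)"
  proof (subst openin_subopen, rule ballI)
    fix M assume "M \<in> to_measure ` V"
    then obtain x where x: "x \<in> V" "M = to_measure x" by blast
    obtain G \<eta> where G: "finite G" "\<eta> > 0" "pmf_nhd K G \<eta> x \<subseteq> V"
      using V x(1) unfolding openin_pmf_space by blast
    have xK: "x \<in> pmfs_on K" using V x(1) unfolding openin_pmf_space by blast
    define E where "E A = {m \<in> K. m \<inter> G \<in> A}" for A
    have Eopen: "openin X (E A)" for A unfolding E_def by (rule openin_agree[OF G(1)])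
    define f where "f A = (\<lambda>m. if m \<in> E A then 1 else 0 :: real)" for A
    have fcont: "continuous_map X euclideanreal (f A)" for A
    proof (rule continuous_map_openin_preimage_eq[THEN iffD2], intro conjI allI impI)
      show "f A \<in> topspace X \<rightarrow> topspace euclideanreal" by simp
      fix U :: "real set"
      have c: "K - E A = E (- A)" by (auto simp: E_def)
      have "topspace X \<inter> f A -` U = (if 1 \<in> U then E A else {}) \<union> (if 0 \<in> U then E (- A) else {})"
        unfolding topspace_X c[symmetric] by (auto simp: f_def E_def split: if_splits)
      also have "openin X \<dots>" using Eopen by (intro openin_Un) auto
      finally show "openin X (topspace X \<inter> f A -` U)" .
    qed
    have fint: "(LINT m|to_measure y. f A m) = measure y {m. m \<inter> G \<in> A}" if y: "y \<in> pmfs_on K" for y A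
    proof -
      have "(LINT m|to_measure y. f A m) = (LINT m|measure_pmf y. f A m)"
        by (rule integral_to_measure[OF y fcont])
      also have "\<dots> = (LINT m|measure_pmf y. indicator {m. m \<inter> G \<in> A} m)"
        by (rule integral_cong_AE)
          (use y in \<open>auto simp: AE_measure_pmf_iff pmfs_on_def f_def E_def indicator_def\<close>)
      finally show ?thesis by simp
    qed
    define W where "W A = {M \<in> prob_measures X. (LINT m|M. f A m) \<in> ball (measure x {m. m \<inter> G \<in> A}) \<eta>}" for A
    have Wopen: "openin (P_space X) (W A)" for A
      unfolding P_space_def W_def by (rule topology_generated_by_Basis) (use fcont[of A] in blast)
    define T where "T = \<Inter>(W ` Pow (Pow G))"
    have "openin (P_space X) T"
      unfolding T_def by (rule openin_Inter) (use G(1) Wopen in auto)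
    moreover have "M \<in> T"
      using x(2) xK to_measure_in[OF xK] fint[OF xK] G(2) by (auto simp: T_def W_def)
    moreover have "T \<subseteq> to_measure ` V"
    proof
      fix M' assume M': "M' \<in> T"
      then have "M' \<in> W {}" by (auto simp: T_def)
      then have "M' \<in> prob_measures X" by (simp add: W_def)
      then obtain y where y: "y \<in> pmfs_on K" "to_measure y = M'" using to_measure_surj by blast
      have cl: "\<bar>measure x {m. m \<inter> G \<in> A} - measure y {m. m \<inter> G \<in> A}\<bar> < \<eta>" for A
      proof -
        have red: "{m. m \<inter> G \<in> A} = {m. m \<inter> G \<in> A \<inter> Pow G}" by auto
        have "M' \<in> W (A \<inter> Pow G)" using M' by (auto simp: T_def)
        then have "(LINT m|M'. f (A \<inter> Pow G) m) \<in> ball (measure x {m. m \<inter> G \<in> A \<inter> Pow G}) \<eta>"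
          by (simp add: W_def)
        then show ?thesis
          unfolding red y(2)[symmetric] fint[OF y(1)] by (simp add: dist_real_def)
      qed
      then have "y \<in> pmf_nhd K G \<eta> x" using y(1) by (simp add: pmf_nhd_def close_pmf_def measure_restr_pmf)
      then show "M' \<in> to_measure ` V" using G(3) y(2) by blast
    qed
    ultimately show "\<exists>T. openin (P_space X) T \<and> M \<in> T \<and> T \<subseteq> to_measure ` V" by blast
  qed
qed

theorem pmf_space_homeomorphic: "pmf_space K homeomorphic_space P_space X"
proof -
  have "to_measure ` topspace (pmf_space K) = topspace (P_space X)"
    unfolding topspace_P_space using to_measure_in to_measure_surj by (auto simp: image_iff) metis
  then have "homeomorphic_map (pmf_space K) (P_space X) to_measure"
    using to_measure_continuous to_measure_open to_measure_inj
    by (intro bijective_open_imp_homeomorphic_map) simp_all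
  then show ?thesis by (rule homeomorphic_map_imp_homeomorphic_space)
qed

end

section \<open>The compact space of a tree\<close>

lemma openin_cantor_cube:
  "openin (cantor_cube I) U \<longleftrightarrow>
     U \<subseteq> Pow I \<and> (\<forall>x\<in>U. \<exists>G. finite G \<and> {y \<in> Pow I. y \<inter> G = x \<inter> G} \<subseteq> U)"
proof
  let ?P = "product_topology (\<lambda>_. discrete_topology (UNIV :: bool set)) I"
  let ?c = "\<lambda>x. restrict (\<lambda>i. i \<in> x) I"
  assume "openin (cantor_cube I) U"
  then obtain V where V: "openin ?P V" "U = ?c -` V \<inter> Pow I"
    unfolding cantor_cube_def openin_pullback_topology by blast
  show "U \<subseteq> Pow I \<and> (\<forall>x\<in>U. \<exists>G. finite G \<and> {y \<in> Pow I. y \<inter> G = x \<inter> G} \<subseteq> U)"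
  proof (intro conjI ballI)
    show "U \<subseteq> Pow I" using V(2) by blast
    fix x assume x: "x \<in> U"
    then have "?c x \<in> V" using V(2) by blast
    then have "\<exists>W. finite {i \<in> I. W i \<noteq> topspace (discrete_topology (UNIV :: bool set))} \<and>
        (\<forall>i\<in>I. openin (discrete_topology UNIV) (W i)) \<and> ?c x \<in> Pi\<^sub>E I W \<and> Pi\<^sub>E I W \<subseteq> V"
      using V(1)[unfolded openin_product_topology_alt] by blast
    then obtain W where W: "finite {i \<in> I. W i \<noteq> (UNIV :: bool set)}" "?c x \<in> Pi\<^sub>E I W" "Pi\<^sub>E I W \<subseteq> V"
      by auto
    have "y \<in> U" if y: "y \<in> Pow I" "y \<inter> {i \<in> I. W i \<noteq> UNIV} = x \<inter> {i \<in> I. W i \<noteq> UNIV}" for y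
    proof -
      have "?c y \<in> Pi\<^sub>E I W"
      proof (rule PiE_I)
        fix i assume i: "i \<in> I"
        have ci: "(i \<in> x) \<in> W i" using PiE_mem[OF W(2) i] i by simp
        show "?c y i \<in> W i"
        proof (cases "W i = UNIV")
          case False
          then have "i \<in> y \<longleftrightarrow> i \<in> x" using y(2) i by blast
          then show ?thesis using ci i by simp
        qed simp
      qed simp
      then show ?thesis using W(3) V(2) y(1) by blast
    qed
    then show "\<exists>G. finite G \<and> {y \<in> Pow I. y \<inter> G = x \<inter> G} \<subseteq> U"
      using W(1) by (intro exI[of _ "{i \<in> I. W i \<noteq> UNIV}"]) blast
  qed
next
  let ?P = "product_topology (\<lambda>_. discrete_topology (UNIV :: bool set)) I"
  let ?c = "\<lambda>x. restrict (\<lambda>i. i \<in> x) I"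
  assume U: "U \<subseteq> Pow I \<and> (\<forall>x\<in>U. \<exists>G. finite G \<and> {y \<in> Pow I. y \<inter> G = x \<inter> G} \<subseteq> U)"
  define V where "V = {b \<in> Pi\<^sub>E I (\<lambda>_. UNIV). {i \<in> I. b i} \<in> U}"
  have "openin ?P V"
    unfolding openin_product_topology_alt
  proof
    fix b assume b: "b \<in> V"
    let ?x = "{i \<in> I. b i}"
    have "?x \<in> U" using b by (simp add: V_def)
    then obtain G where G: "finite G" "{y \<in> Pow I. y \<inter> G = ?x \<inter> G} \<subseteq> U" using U by blast
    define W where "W i = (if i \<in> G then {b i} else (UNIV :: bool set))" for i
    have "{i \<in> I. W i \<noteq> UNIV} \<subseteq> G" by (auto simp: W_def)
    then have W1: "finite {i \<in> I. W i \<noteq> UNIV}" using G(1) finite_subset by blast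
    have W2: "b \<in> Pi\<^sub>E I W"
    proof (rule PiE_I)
      fix i show "b i \<in> W i" by (simp add: W_def)
    next
      fix i assume "i \<notin> I"
      moreover have "b \<in> Pi\<^sub>E I (\<lambda>_. UNIV)" using b by (simp add: V_def)
      ultimately show "b i = undefined" by (rule PiE_arb[rotated])
    qed
    have W3: "Pi\<^sub>E I W \<subseteq> V"
    proof
      fix d assume d: "d \<in> Pi\<^sub>E I W"
      have "d i = b i" if "i \<in> I" "i \<in> G" for i
        using PiE_mem[OF d that(1)] that(2) by (simp add: W_def)
      then have e: "{i \<in> I. d i} \<inter> G = ?x \<inter> G" by auto
      have "{i \<in> I. d i} \<in> {y \<in> Pow I. y \<inter> G = ?x \<inter> G}"
        by (intro CollectI conjI PowI e Collect_restrict)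
      then have "{i \<in> I. d i} \<in> U" by (rule subsetD[OF G(2)])
      moreover have "d \<in> Pi\<^sub>E I (\<lambda>_. UNIV)" using d by (simp add: PiE_iff)
      ultimately show "d \<in> V" by (simp add: V_def)
    qed
    show "\<exists>W. finite {i \<in> I. W i \<noteq> topspace (discrete_topology (UNIV :: bool set))} \<and>
        (\<forall>i\<in>I. openin (discrete_topology UNIV) (W i)) \<and> b \<in> Pi\<^sub>E I W \<and> Pi\<^sub>E I W \<subseteq> V"
    proof (intro exI[of _ W] conjI ballI)
      show "finite {i \<in> I. W i \<noteq> topspace (discrete_topology (UNIV :: bool set))}"
        using W1 unfolding topspace_discrete_topology .
    qed (rule W2 W3 | simp)+
  qed
  moreover have "U = ?c -` V \<inter> Pow I"
  proof -
    have key: "?c x \<in> V \<longleftrightarrow> x \<in> U" if "x \<in> Pow I" for x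
    proof -
      have "{i \<in> I. ?c x i} = x" using that by auto
      then show ?thesis by (simp add: V_def)
    qed
    show ?thesis
    proof (intro equalityI subsetI)
      fix x assume x: "x \<in> U"
      have "x \<in> Pow I" by (rule subsetD[OF conjunct1[OF U] x])
      then show "x \<in> ?c -` V \<inter> Pow I"
        using key[THEN iffD2, OF _ x] by (intro IntI vimageI2)
    next
      fix x assume x: "x \<in> ?c -` V \<inter> Pow I"
      show "x \<in> U" by (rule key[THEN iffD1, OF IntD2[OF x] vimageD[OF IntD1[OF x]]])
    qed
  qed
  ultimately have "\<exists>V. openin ?P V \<and> U = ?c -` V \<inter> Pow I"
    by (intro exI[of _ V] conjI)
  then show "openin (cantor_cube I) U"
    unfolding cantor_cube_def openin_pullback_topology .
qed

lemma compact_cantor_cube: "compactin (cantor_cube I) (Pow I)"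
proof -
  let ?P = "product_topology (\<lambda>_. discrete_topology (UNIV :: bool set)) I"
  let ?c = "\<lambda>x. restrict (\<lambda>i. i \<in> x) I"
  let ?g = "\<lambda>b. {i \<in> I. b i}"
  have "compact_space ?P"
    unfolding compact_space_product_topology by (simp add: compact_space_discrete_topology)
  then have P: "compactin ?P (topspace ?P)" by (simp add: compact_space_def)
  have "continuous_map ?P (cantor_cube I) ?g"
    unfolding cantor_cube_def
  proof (rule continuous_map_pullback')
    have "continuous_map ?P ?P id" by simp
    then show "continuous_map ?P ?P (?c \<circ> ?g)"
      by (rule continuous_map_eq) (auto simp: PiE_iff extensional_def restrict_def fun_eq_iff)
    show "topspace ?P \<subseteq> ?g -` Pow I" by auto
  qed
  from image_compactin[OF P this] have "compactin (cantor_cube I) (?g ` topspace ?P)" .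
  moreover have "?g ` topspace ?P = Pow I"
  proof
    show "?g ` topspace ?P \<subseteq> Pow I" by (rule image_subsetI) (simp add: Collect_restrict)
    show "Pow I \<subseteq> ?g ` topspace ?P"
    proof
      fix x assume x: "x \<in> Pow I"
      show "x \<in> ?g ` topspace ?P"
      proof (rule image_eqI)
        show "x = ?g (?c x)" using x by auto
        show "?c x \<in> topspace ?P" by simp
      qed
    qed
  qed
  ultimately show ?thesis by simp
qed

context order_tree
begin

lemma Chains_cmp: "C \<in> Chains T \<longleftrightarrow> (\<forall>s\<in>C. \<forall>t\<in>C. tree_cmp T s t)"
  by (simp add: Chains_def tree_cmp_def)

lemma chain_in_branch:
  assumes C: "C \<in> Chains T"
  obtains B where "B \<in> branches T" "C \<subseteq> B"
proof -
  let ?A = "{D \<in> Chains T. C \<subseteq> D}"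
  have "\<exists>M\<in>?A. \<forall>D\<in>?A. M \<subseteq> D \<longrightarrow> D = M"
  proof (rule subset_Zorn_nonempty)
    show "?A \<noteq> {}" using C by blast
    fix \<C> assume \<C>: "\<C> \<noteq> {}" "subset.chain ?A \<C>"
    have chain: "tree_cmp T s t" if st: "s \<in> \<Union>\<C>" "t \<in> \<Union>\<C>" for s t
    proof -
      obtain D E where DE: "D \<in> \<C>" "s \<in> D" "E \<in> \<C>" "t \<in> E" using st by blast
      then have "D \<subseteq> E \<or> E \<subseteq> D" using \<C>(2) by (auto simp: subset_chain_def)
      then obtain F where "F \<in> \<C>" "s \<in> F" "t \<in> F" using DE by blast
      moreover have "F \<in> Chains T" using \<C>(2) calculation(1) by (auto simp: subset_chain_def)
      ultimately show ?thesis by (simp add: Chains_cmp)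
    qed
    have "C \<subseteq> \<Union>\<C>"
    proof -
      obtain D where D: "D \<in> \<C>" using \<C>(1) by blast
      then have "C \<subseteq> D" using \<C>(2) by (auto simp: subset_chain_def)
      then show ?thesis using D by blast
    qed
    moreover have "\<Union>\<C> \<in> Chains T" unfolding Chains_cmp by (intro ballI chain)
    ultimately show "\<Union>\<C> \<in> ?A" by (intro CollectI conjI)
  qed
  then obtain M where M: "M \<in> ?A" and max: "\<forall>D\<in>?A. M \<subseteq> D \<longrightarrow> D = M" by (rule bexE)
  have "M \<in> branches T"
    unfolding branches_def
  proof (intro CollectI conjI ballI impI)
    show "M \<in> Chains T" using M by simp
    fix D assume D: "D \<in> Chains T" "M \<subseteq> D"
    then have "D \<in> ?A" using M by auto
    then show "D = M" using max D(2) by simp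
  qed
  moreover have "C \<subseteq> M" using M by simp
  ultimately show ?thesis by (rule that)
qed

abbreviation KT :: "'g set \<Rightarrow> ('n \<times> 'g) set set" where
  "KT \<Gamma> \<equiv> compat_sets (Field T) (tree_cmp T) \<Gamma>"

lemma K_space_carrier:
  fixes \<Gamma> :: "'g set"
  shows "{x. x \<subseteq> Field T \<times> \<Gamma> \<and> finite x \<and> card x \<le> 2 \<and> (\<exists>C\<in>branches T. fst ` x \<subseteq> C)} = KT \<Gamma>"
proof -
  have "(\<exists>C\<in>branches T. fst ` x \<subseteq> C) \<longleftrightarrow> (\<forall>p\<in>x. \<forall>q\<in>x. tree_cmp T (fst p) (fst q))" for x :: "('n \<times> 'g) set"
  proof
    assume "\<exists>C\<in>branches T. fst ` x \<subseteq> C"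
    then obtain C where "C \<in> Chains T" "fst ` x \<subseteq> C" by (auto simp: branches_def)
    then show "\<forall>p\<in>x. \<forall>q\<in>x. tree_cmp T (fst p) (fst q)" unfolding Chains_cmp by blast
  next
    assume "\<forall>p\<in>x. \<forall>q\<in>x. tree_cmp T (fst p) (fst q)"
    then have "fst ` x \<in> Chains T" unfolding Chains_cmp by blast
    then obtain B where "B \<in> branches T" "fst ` x \<subseteq> B" by (rule chain_in_branch)
    then show "\<exists>C\<in>branches T. fst ` x \<subseteq> C" by blast
  qed
  then show ?thesis by (simp add: compat_sets_def)
qed

lemma K_space_alt: "K_space T \<Gamma> = subtopology (cantor_cube (Field T \<times> \<Gamma>)) (KT \<Gamma>)"
  unfolding K_space_def K_space_carrier ..

lemma KT_sub: "KT \<Gamma> \<subseteq> Pow (Field T \<times> \<Gamma>)"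
  by (auto simp: compat_sets_def)

lemma openin_K_space:
  "openin (K_space T \<Gamma>) U \<longleftrightarrow>
     U \<subseteq> KT \<Gamma> \<and> (\<forall>x\<in>U. \<exists>G. finite G \<and> {y \<in> KT \<Gamma>. y \<inter> G = x \<inter> G} \<subseteq> U)"
proof
  assume "openin (K_space T \<Gamma>) U"
  then obtain V where V: "openin (cantor_cube (Field T \<times> \<Gamma>)) V" "U = V \<inter> KT \<Gamma>"
    unfolding K_space_alt openin_subtopology by blast
  show "U \<subseteq> KT \<Gamma> \<and> (\<forall>x\<in>U. \<exists>G. finite G \<and> {y \<in> KT \<Gamma>. y \<inter> G = x \<inter> G} \<subseteq> U)"
  proof (intro conjI ballI)
    show "U \<subseteq> KT \<Gamma>" using V(2) by blast
    fix x assume "x \<in> U"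
    then have "x \<in> V" using V(2) by blast
    then obtain G where G: "finite G" "{y \<in> Pow (Field T \<times> \<Gamma>). y \<inter> G = x \<inter> G} \<subseteq> V"
      using V(1) unfolding openin_cantor_cube by blast
    have "{y \<in> KT \<Gamma>. y \<inter> G = x \<inter> G} \<subseteq> U"
    proof
      fix y assume y: "y \<in> {y \<in> KT \<Gamma>. y \<inter> G = x \<inter> G}"
      then have "y \<in> Pow (Field T \<times> \<Gamma>)" using subsetD[OF KT_sub] by blast
      then show "y \<in> U" using y G(2) V(2) by blast
    qed
    then show "\<exists>G. finite G \<and> {y \<in> KT \<Gamma>. y \<inter> G = x \<inter> G} \<subseteq> U" using G(1) by blast
  qed
next
  assume U: "U \<subseteq> KT \<Gamma> \<and> (\<forall>x\<in>U. \<exists>G. finite G \<and> {y \<in> KT \<Gamma>. y \<inter> G = x \<inter> G} \<subseteq> U)"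
  define V where "V = {z \<in> Pow (Field T \<times> \<Gamma>). \<exists>x\<in>U. \<exists>G. finite G \<and>
    {y \<in> KT \<Gamma>. y \<inter> G = x \<inter> G} \<subseteq> U \<and> z \<inter> G = x \<inter> G}"
  have "openin (cantor_cube (Field T \<times> \<Gamma>)) V"
    unfolding openin_cantor_cube
  proof (intro conjI ballI)
    show "V \<subseteq> Pow (Field T \<times> \<Gamma>)" unfolding V_def by (rule Collect_restrict)
    fix z assume "z \<in> V"
    then obtain x G where xG: "x \<in> U" "finite G" "{y \<in> KT \<Gamma>. y \<inter> G = x \<inter> G} \<subseteq> U" "z \<inter> G = x \<inter> G"
      unfolding V_def by blast
    have "{y \<in> Pow (Field T \<times> \<Gamma>). y \<inter> G = z \<inter> G} \<subseteq> V"
    proof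
      fix y assume "y \<in> {y \<in> Pow (Field T \<times> \<Gamma>). y \<inter> G = z \<inter> G}"
      then have y: "y \<in> Pow (Field T \<times> \<Gamma>)" "y \<inter> G = x \<inter> G" using xG(4) by simp_all
      show "y \<in> V"
        unfolding V_def by (intro CollectI conjI bexI[OF _ xG(1)] exI[of _ G] y xG(2,3))
    qed
    then show "\<exists>G. finite G \<and> {y \<in> Pow (Field T \<times> \<Gamma>). y \<inter> G = z \<inter> G} \<subseteq> V" using xG(2) by blast
  qed
  moreover have "U = V \<inter> KT \<Gamma>"
  proof (intro equalityI subsetI)
    fix x assume x: "x \<in> U"
    then have xK: "x \<in> KT \<Gamma>" using U by blast
    obtain G where G: "finite G" "{y \<in> KT \<Gamma>. y \<inter> G = x \<inter> G} \<subseteq> U" using U x by blast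
    have "x \<in> V"
      unfolding V_def
      by (intro CollectI conjI bexI[OF _ x] exI[of _ G] subsetD[OF KT_sub xK] G HOL.refl)
    then show "x \<in> V \<inter> KT \<Gamma>" using xK by blast
  next
    fix x assume x: "x \<in> V \<inter> KT \<Gamma>"
    then obtain x' G where "{y \<in> KT \<Gamma>. y \<inter> G = x' \<inter> G} \<subseteq> U" "x \<inter> G = x' \<inter> G"
      unfolding V_def by blast
    then show "x \<in> U" using x by blast
  qed
  ultimately show "openin (K_space T \<Gamma>) U"
    unfolding K_space_alt openin_subtopology by (intro exI[of _ V] conjI)
qed

text \<open>
  Not being in the family is witnessed by finitely many points: two incomparable ones or three
  distinct ones. So the family is closed in the Cantor cube.
\<close>

lemma compact_K_space: "compact_space (K_space T \<Gamma>)"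
proof -
  let ?I = "Field T \<times> \<Gamma>"
  have "openin (cantor_cube ?I) (Pow ?I - KT \<Gamma>)"
    unfolding openin_cantor_cube
  proof (intro conjI ballI)
    fix x assume x: "x \<in> Pow ?I - KT \<Gamma>"
    have "\<exists>G. finite G \<and> G \<subseteq> x \<and> (\<forall>y. G \<subseteq> y \<longrightarrow> y \<notin> KT \<Gamma>)"
    proof (cases "finite x \<and> card x \<le> 2")
      case True
      then obtain p q where pq: "p \<in> x" "q \<in> x" "\<not> tree_cmp T (fst p) (fst q)"
        using x by (auto simp: compat_sets_def)
      have "y \<notin> KT \<Gamma>" if "{p, q} \<subseteq> y" for y using that pq(3) by (auto simp: compat_sets_def)
      then show ?thesis using pq by (intro exI[of _ "{p, q}"]) blast
    next
      case False
      have "\<exists>G\<subseteq>x. finite G \<and> card G = 3"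
      proof (cases "finite x")
        case True
        then have "3 \<le> card x" using False by simp
        then show ?thesis using True by (metis obtain_subset_with_card_n)
      next
        case False
        then show ?thesis by (metis infinite_arbitrarily_large)
      qed
      then obtain G where G: "G \<subseteq> x" "finite G" "card G = 3" by blast
      have "y \<notin> KT \<Gamma>" if "G \<subseteq> y" for y
        using card_mono[OF _ that] G(3) by (auto simp: compat_sets_def)
      then show ?thesis using G by blast
    qed
    then obtain G where G: "finite G" "G \<subseteq> x" "\<And>y. G \<subseteq> y \<Longrightarrow> y \<notin> KT \<Gamma>" by blast
    have "{y \<in> Pow ?I. y \<inter> G = x \<inter> G} \<subseteq> Pow ?I - KT \<Gamma>"
    proof
      fix y assume y: "y \<in> {y \<in> Pow ?I. y \<inter> G = x \<inter> G}"
      then have "G \<subseteq> y" using G(2) by blast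
      then show "y \<in> Pow ?I - KT \<Gamma>" using G(3) y by blast
    qed
    then show "\<exists>G. finite G \<and> {y \<in> Pow ?I. y \<inter> G = x \<inter> G} \<subseteq> Pow ?I - KT \<Gamma>" using G(1) by blast
  qed blast
  then have "closedin (cantor_cube ?I) (KT \<Gamma>)"
    unfolding closedin_def topspace_cantor_cube using KT_sub by simp
  moreover have "compact_space (cantor_cube ?I)"
    using compact_cantor_cube by (simp add: compact_space_def topspace_cantor_cube)
  ultimately have "compactin (cantor_cube ?I) (KT \<Gamma>)" by (rule closedin_compact_space[rotated])
  then show ?thesis unfolding K_space_alt by (rule compact_space_subtopology)
qed

lemma compact_pair_family_K_space: "compact_pair_family (KT \<Gamma>) (K_space T \<Gamma>)"
proof -
  interpret compat_nodes "Field T" "tree_cmp T" \<Gamma>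
    by standard (auto simp: tree_cmp_def refl)
  show ?thesis
    by standard (rule openin_K_space, rule compact_K_space)
qed

end

section \<open>Windows invariant under a homeomorphism\<close>

lemma eq_of_abs_le:
  fixes a b :: real
  assumes "\<And>e. e > 0 \<Longrightarrow> \<bar>a - b\<bar> \<le> e"
  shows "a = b"
proof (rule ccontr)
  assume neq: "a \<noteq> b"
  define t where "t = \<bar>a - b\<bar>"
  have t: "t > 0" using neq by (simp add: t_def)
  have "t \<le> t / 2" unfolding t_def by (rule assms) (use t in \<open>simp add: t_def\<close>)
  then show False using t by simp
qed

text \<open>
  Sets in the family have at most two points, so the hypothesis gives the probability of
  containing any finite subset of \<open>D\<close>. Inclusion and exclusion then gives the distribution of the
  trace on every finite subset of \<open>D\<close>, and the mass of a trace on \<open>D\<close> is a limit of these.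
\<close>

lemma (in pair_family) same_restr_pairs:
  assumes x: "x \<in> pmfs_on K" and y: "y \<in> pmfs_on K"
    and pairs: "\<And>p q. p \<in> D \<Longrightarrow> q \<in> D \<Longrightarrow> measure x {m. p \<in> m \<and> q \<in> m} = measure y {m. p \<in> m \<and> q \<in> m}"
  shows "same_restr D x y"
proof -
  have sup: "measure x {m. A \<subseteq> m} = measure y {m. A \<subseteq> m}" if A: "finite A" "A \<subseteq> D" for A
  proof -
    consider "A = {}" | p where "A = {p}" | p q where "A = {p, q}" | "card A \<ge> 3"
    proof -
      have "card A = 0 \<or> card A = 1 \<or> card A = 2 \<or> card A \<ge> 3" by linarith
      then show ?thesis using that A(1) by (auto simp: card_1_singleton_iff card_2_iff)
    qed
    then show ?thesis
    proof cases
      case 1 then show ?thesis by simp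
    next
      case (2 p) then show ?thesis using pairs[of p p] A(2) by simp
    next
      case (3 p q) then show ?thesis using pairs[of p q] A(2) by simp
    next
      case 4
      have "measure z {m. A \<subseteq> m} = 0" if z: "z \<in> pmfs_on K" for z
      proof -
        have "\<not> A \<subseteq> m" if "m \<in> set_pmf z" for m
        proof
          assume "A \<subseteq> m"
          have "m \<in> K" using that z by (auto simp: pmfs_on_def)
          then show False using card_mono[OF finite_mem \<open>A \<subseteq> m\<close>] card_mem[of m] 4 by force
        qed
        then show ?thesis by (auto simp: measure_pmf_zero_iff)
      qed
      then show ?thesis using x y by simp
    qed
  qed
  have cyl: "measure x {m. A \<subseteq> m \<and> m \<inter> B = {}} = measure y {m. A \<subseteq> m \<and> m \<inter> B = {}}"
    if B: "finite B" "B \<subseteq> D" and A: "finite A" "A \<subseteq> D" for A B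
    using B A
  proof (induction B arbitrary: A rule: finite_induct)
    case empty then show ?case using sup by simp
  next
    case (insert b B)
    have step: "measure z {m. A \<subseteq> m \<and> m \<inter> insert b B = {}} =
        measure z {m. A \<subseteq> m \<and> m \<inter> B = {}} - measure z {m. insert b A \<subseteq> m \<and> m \<inter> B = {}}"
      for z :: "'i set pmf"
    proof -
      have "{m. A \<subseteq> m \<and> m \<inter> insert b B = {}} =
          {m. A \<subseteq> m \<and> m \<inter> B = {}} - {m. insert b A \<subseteq> m \<and> m \<inter> B = {}}" by auto
      then show ?thesis by (simp only:) (rule measure_pmf.finite_measure_Diff; auto)
    qed
    show ?case unfolding step using insert.IH[of A] insert.IH[of "insert b A"] insert.prems by simp
  qed
  have fin: "measure x {m. m \<inter> G = k} = measure y {m. m \<inter> G = k}" if "finite G" "G \<subseteq> D" "k \<subseteq> G" for G k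
  proof -
    have eq: "{m. m \<inter> G = k} = {m. k \<subseteq> m \<and> m \<inter> (G - k) = {}}" using that(3) by auto
    show ?thesis unfolding eq using that by (intro cyl) (auto intro: finite_subset)
  qed
  show ?thesis
    unfolding same_restr_def
  proof (rule pmf_eqI)
    fix k
    have pm: "pmf (restr_pmf D z) k = measure z {m. m \<inter> D = k}" for z
      unfolding pmf_eq_measure_singleton measure_restr_pmf by simp
    show "pmf (restr_pmf D x) k = pmf (restr_pmf D y) k"
    proof (cases "finite k \<and> k \<subseteq> D")
      case False
      have "measure z {m. m \<inter> D = k} = 0" if z: "z \<in> pmfs_on K" for z
      proof -
        have "m \<inter> D \<noteq> k" if "m \<in> set_pmf z" for m
          using that z False finite_mem by (auto simp: pmfs_on_def)
        then show ?thesis by (auto simp: measure_pmf_zero_iff)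
      qed
      then show ?thesis using x y by (simp add: pm)
    next
      case True
      have "\<bar>measure x {m. m \<inter> D = k} - measure y {m. m \<inter> D = k}\<bar> \<le> e" if e: "e > 0" for e
      proof -
        obtain F where F: "finite F" "F \<subseteq> set_pmf x" "measure x F > 1 - e" "finite (\<Union>F)"
          using finite_approx_support[OF x e] by blast
        obtain F' where F': "finite F'" "F' \<subseteq> set_pmf y" "measure y F' > 1 - e" "finite (\<Union>F')"
          using finite_approx_support[OF y e] by blast
        define G where "G = (\<Union>F \<union> \<Union>F' \<union> k) \<inter> D"
        have G: "finite G" "G \<subseteq> D" "k \<subseteq> G" using F(4) F'(4) True by (auto simp: G_def)
        have near: "measure z {m. m \<inter> D = k} \<le> measure z {m. m \<inter> G = k} \<and>
            measure z {m. m \<inter> G = k} \<le> measure z {m. m \<inter> D = k} + e"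
          if H: "measure z H > 1 - e" "\<Union>H \<subseteq> \<Union>F \<union> \<Union>F'" for z :: "'i set pmf" and H
        proof
          show "measure z {m. m \<inter> D = k} \<le> measure z {m. m \<inter> G = k}"
            by (rule measure_pmf.finite_measure_mono) (use G in auto)
          have "m \<inter> D = m \<inter> G" if "m \<in> H" for m using H(2) that by (auto simp: G_def)
          then have "measure z {m. m \<inter> G = k} \<le> measure z ({m. m \<inter> D = k} \<union> - H)"
            by (intro measure_pmf.finite_measure_mono) auto
          also have "\<dots> \<le> measure z {m. m \<inter> D = k} + measure z (- H)"
            by (rule measure_subadditive) auto
          also have "measure z (- H) = 1 - measure z H"
            using measure_pmf.prob_compl[of H z] by (simp add: Compl_eq_Diff_UNIV)
          finally show "measure z {m. m \<inter> G = k} \<le> measure z {m. m \<inter> D = k} + e" using H(1) by linarith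
        qed
        note nx = near[OF F(3) Un_upper1] and ny = near[OF F'(3) Un_upper2]
        show ?thesis
          unfolding abs_le_iff
          using nx[THEN conjunct1] nx[THEN conjunct2] ny[THEN conjunct1] ny[THEN conjunct2] fin[OF G]
          by linarith
      qed
      then show ?thesis unfolding pm by (rule eq_of_abs_le)
    qed
  qed
qed

lemma continuous_prob:
  assumes G: "finite G"
  shows "continuous_map (pmf_space K) euclideanreal (\<lambda>x. measure (measure_pmf x) {m. m \<inter> G \<in> A})"
proof (rule continuous_map_openin_preimage_eq[THEN iffD2], intro conjI allI impI)
  let ?f = "\<lambda>x. measure (measure_pmf x) {m. m \<inter> G \<in> A}"
  show "?f \<in> topspace (pmf_space K) \<rightarrow> topspace euclideanreal" by simp
  fix U :: "real set" assume "openin euclideanreal U"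
  then have U: "open U" by simp
  have pre: "topspace (pmf_space K) \<inter> ?f -` U = {x \<in> pmfs_on K. ?f x \<in> U}" by auto
  show "openin (pmf_space K) (topspace (pmf_space K) \<inter> ?f -` U)"
    unfolding pre openin_pmf_space
  proof (intro conjI ballI)
    fix x assume x: "x \<in> {x \<in> pmfs_on K. measure (measure_pmf x) {m. m \<inter> G \<in> A} \<in> U}"
    then obtain e where e: "e > 0" "ball (measure (measure_pmf x) {m. m \<inter> G \<in> A}) e \<subseteq> U"
      using U openE by blast
    have "measure (measure_pmf y) {m. m \<inter> G \<in> A} \<in> U" if "y \<in> pmf_nhd K G e x" for y
    proof -
      have "close_pmf G e x y" using that by (simp add: pmf_nhd_def)
      from close_pmfD[OF this, of A] show ?thesis using e(2) by (auto simp: dist_real_def)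
    qed
    then have "pmf_nhd K G e x \<subseteq> {x \<in> pmfs_on K. measure (measure_pmf x) {m. m \<inter> G \<in> A} \<in> U}"
      by (auto simp: pmf_nhd_def)
    then show "\<exists>G' \<eta>. finite G' \<and> 0 < \<eta> \<and>
        pmf_nhd K G' \<eta> x \<subseteq> {x \<in> pmfs_on K. measure (measure_pmf x) {m. m \<inter> G \<in> A} \<in> U}"
      using G e(1) by blast
  qed blast
qed

text \<open>
  For each pair \<open>p\<close>, \<open>q\<close>, the probability that \<open>h x\<close> assigns to containing both depends on countably
  many coordinates \<open>N p q\<close> of \<open>x\<close>. If a window of the source contains all of these coordinates for
  the points of a window of the target, then \<open>h\<close> maps equal restrictions to equal restrictions, by
  \<open>same_restr_pairs\<close>.
\<close>

lemma dependence_transfer: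
  fixes K1 :: "'i set set" and K2 :: "'j set set"
  assumes K1: "compact_pair_family K1 X1" and K2: "pair_family K2"
    and h: "continuous_map (pmf_space K1) (pmf_space K2) h"
  shows "\<exists>N :: 'j \<Rightarrow> 'j \<Rightarrow> 'i set. (\<forall>p q. countable (N p q)) \<and>
    (\<forall>D1 D2 x y. (\<forall>p\<in>D2. \<forall>q\<in>D2. N p q \<inter> \<Union>K1 \<subseteq> D1) \<longrightarrow>
      x \<in> pmfs_on K1 \<longrightarrow> y \<in> pmfs_on K1 \<longrightarrow> same_restr D1 x y \<longrightarrow> same_restr D2 (h x) (h y))"
proof -
  interpret K1: compact_pair_family K1 X1 by (rule K1)
  interpret K2: pair_family K2 by (rule K2)
  define \<phi> where "\<phi> p q x = measure (measure_pmf (h x)) {m. p \<in> m \<and> q \<in> m}" for p q x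
  define Q where "Q p q D \<longleftrightarrow> countable D \<and>
    (\<forall>x\<in>pmfs_on K1. \<forall>y\<in>pmfs_on K1. same_restr D x y \<longrightarrow> \<phi> p q x = \<phi> p q y)" for p q D
  define N where "N p q = (SOME D. Q p q D)" for p q
  have Q: "Q p q (N p q)" for p q
    unfolding N_def
  proof (rule someI_ex)
    have eq: "{m. p \<in> m \<and> q \<in> m} = {m. m \<inter> {p, q} \<in> {{p, q}}}" by auto
    have "continuous_map (pmf_space K1) euclideanreal
        ((\<lambda>x. measure (measure_pmf x) {m. m \<inter> {p, q} \<in> {{p, q}}}) \<circ> h)"
      by (rule continuous_map_compose[OF h continuous_prob]) simp
    then have "continuous_map (pmf_space K1) euclideanreal (\<phi> p q)"
      unfolding \<phi>_def[abs_def] eq by (simp add: comp_def)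
    then obtain D where "countable D"
      "\<And>x y. x \<in> pmfs_on K1 \<Longrightarrow> y \<in> pmfs_on K1 \<Longrightarrow> same_restr D x y \<Longrightarrow> \<phi> p q x = \<phi> p q y"
      using K1.countable_dependence by blast
    then have "Q p q D" by (simp add: Q_def)
    then show "\<exists>D. Q p q D" ..
  qed
  have cN: "countable (N p q)" for p q using Q[of p q] by (simp add: Q_def)
  show ?thesis
  proof (intro exI[of _ N] conjI allI impI cN)
    fix D1 :: "'i set" and D2 :: "'j set" and x y :: "'i set pmf"
    assume sub: "\<forall>p\<in>D2. \<forall>q\<in>D2. N p q \<inter> \<Union>K1 \<subseteq> D1"
      and x: "x \<in> pmfs_on K1" and y: "y \<in> pmfs_on K1" and same: "same_restr D1 x y"
    have hxy: "h x \<in> pmfs_on K2" "h y \<in> pmfs_on K2"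
      using x y continuous_map_funspace[OF h] by auto
    show "same_restr D2 (h x) (h y)"
    proof (rule K2.same_restr_pairs[OF hxy])
      fix p q assume pq: "p \<in> D2" "q \<in> D2"
      have red: "restr_pmf (N p q) z = map_pmf (\<lambda>m. m \<inter> N p q) (restr_pmf D1 z)" if z: "z \<in> pmfs_on K1" for z
        unfolding restr_pmf_def map_pmf_comp
      proof (rule map_pmf_cong[OF refl])
        fix m assume "m \<in> set_pmf z"
        then have "m \<in> K1" using z by (auto simp: pmfs_on_def)
        then have "m \<inter> N p q \<subseteq> D1" using sub[rule_format, OF pq] by blast
        then show "m \<inter> N p q = m \<inter> D1 \<inter> N p q" by blast
      qed
      have "same_restr (N p q) x y" using same unfolding same_restr_def red[OF x] red[OF y] by simp
      then have "\<phi> p q x = \<phi> p q y" using Q[of p q] x y by (simp add: Q_def)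
      then show "measure (h x) {m. p \<in> m \<and> q \<in> m} = measure (h y) {m. p \<in> m \<and> q \<in> m}"
        by (simp add: \<phi>_def)
    qed
  qed
qed

text \<open>
  Countably many rounds of adding all \<open>F p q\<close> suffice, as four points lie in a common round.
\<close>

lemma small_closure:
  fixes F :: "'a \<times> 'a \<Rightarrow> 'a \<times> 'a \<Rightarrow> 'a set" and B :: "'b set"
  assumes B: "infinite B" and X: "|X| \<le>o |B|" and F: "\<And>p q. |F p q| \<le>o |B|"
  shows "\<exists>M. X \<subseteq> M \<and> |M| \<le>o |B| \<and> (\<forall>p\<in>M \<times> M. \<forall>q\<in>M \<times> M. F p q \<subseteq> M)"
proof -
  have times: "|A \<times> A| \<le>o |B|" if "|A| \<le>o |B|" for A :: "'c set"
  proof -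
    have "|A \<times> A| \<le>o |A \<times> B|" by (rule card_of_Times_mono2[OF that])
    also have "|A \<times> B| \<le>o |B \<times> B|" by (rule card_of_Times_mono1[OF that])
    also have "|B \<times> B| =o |B|" by (rule card_of_Times_same_infinite[OF B])
    finally show ?thesis .
  qed
  have union: "|A \<union> C| \<le>o |B|" if "|A| \<le>o |B|" "|C| \<le>o |B|" for A C :: "'a set"
    by (rule card_of_Un_ordLeq_infinite_Field[OF _ that card_of_Card_order])
      (use B in \<open>simp add: Field_card_of\<close>)
  define step where "step M = M \<union> (\<Union>z\<in>(M \<times> M) \<times> (M \<times> M). F (fst z) (snd z))" for M
  define M where "M n = (step ^^ n) X" for n
  have M0: "M 0 = X" and MS: "M (Suc n) = step (M n)" for n by (simp_all add: M_def)
  have small: "|M n| \<le>o |B|" for n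
  proof (induction n)
    case 0 show ?case using X by (simp add: M0)
  next
    case (Suc n)
    have "|\<Union>z\<in>(M n \<times> M n) \<times> (M n \<times> M n). F (fst z) (snd z)| \<le>o |B|"
      by (rule card_of_UNION_ordLeq_infinite[OF B times[OF times[OF Suc]]]) (use F in blast)
    then show ?case unfolding MS step_def by (rule union[OF Suc])
  qed
  have mono: "M n \<subseteq> M (Suc n)" for n by (auto simp: MS step_def)
  have mono': "n \<le> k \<Longrightarrow> M n \<subseteq> M k" for n k by (rule lift_Suc_mono_le[of M, OF mono])
  have "|UNIV :: nat set| \<le>o |B|" using B infinite_iff_card_of_nat by blast
  then have "|\<Union>n. M n| \<le>o |B|"
    by (intro card_of_UNION_ordLeq_infinite[OF B] ballI small)
  moreover have "X \<subseteq> (\<Union>n. M n)" using M0 by blast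
  moreover have "F p q \<subseteq> (\<Union>n. M n)" if pq: "p \<in> (\<Union>n. M n) \<times> (\<Union>n. M n)" "q \<in> (\<Union>n. M n) \<times> (\<Union>n. M n)" for p q
  proof -
    obtain a b c d where n: "fst p \<in> M a" "snd p \<in> M b" "fst q \<in> M c" "snd q \<in> M d"
      using pq by (auto simp: mem_Times_iff)
    define k where "k = max (max a b) (max c d)"
    have k: "a \<le> k" "b \<le> k" "c \<le> k" "d \<le> k" by (auto simp: k_def)
    have "fst p \<in> M k" "snd p \<in> M k" "fst q \<in> M k" "snd q \<in> M k"
      using n mono'[OF k(1)] mono'[OF k(2)] mono'[OF k(3)] mono'[OF k(4)] by blast+
    then have "(p, q) \<in> (M k \<times> M k) \<times> (M k \<times> M k)" by (simp add: mem_Times_iff)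
    then have "F p q \<subseteq> M (Suc k)" unfolding MS step_def by force
    then show ?thesis by blast
  qed
  ultimately show ?thesis by (intro exI[of _ "\<Union>n. M n"] conjI ballI)
qed

section \<open>Heights and the trees \<open>\<Upsilon>\<close>\<close>

lemma Field_Restr_Well_order:
  assumes "Well_order r" "A \<subseteq> Field r"
  shows "Field (Restr r A) = A"
proof -
  have "(a, a) \<in> Restr r A" if "a \<in> A" for a
    using assms that by (auto simp: order_on_defs refl_on_def)
  then show ?thesis by (force simp: Field_def)
qed

text \<open>
  Otherwise \<open>f\<close> would induce a strictly increasing map from \<open>r\<close> into a proper initial segment of
  \<open>r\<close>, and the least element that it moves down would give a contradiction.
\<close>

lemma strict_mono_imp_ordLeq:
  assumes r: "Well_order r" and r': "Well_order r'"
    and f: "\<And>a. a \<in> Field r \<Longrightarrow> f a \<in> Field r'"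
    and mono: "\<And>a b. (a, b) \<in> r \<Longrightarrow> a \<noteq> b \<Longrightarrow> (f a, f b) \<in> r' \<and> f a \<noteq> f b"
  shows "r \<le>o r'"
proof (rule ccontr)
  assume "\<not> r \<le>o r'"
  then have "r' <o r" using not_ordLeq_iff_ordLess[OF r' r] by simp
  then obtain a where a: "a \<in> Field r" "r' =o Restr r (underS r a)"
    unfolding ordLess_iff_ordIso_Restr[OF r r'] by blast
  then obtain e where e: "iso r' (Restr r (underS r a)) e" unfolding ordIso_def by auto
  then have bij: "bij_betw e (Field r') (Field (Restr r (underS r a)))" by (simp add: iso_def)
  have sub: "Field (Restr r (underS r a)) \<subseteq> underS r a" by (auto simp: Field_def)
  define g where "g b = e (f b)" for b
  have g: "g b \<in> underS r a" if "b \<in> Field r" for b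
    using bij_betwE[OF bij] f[OF that] sub by (auto simp: g_def)
  have gm: "(g b, g c) \<in> r \<and> g b \<noteq> g c" if bc: "(b, c) \<in> r" "b \<noteq> c" for b c
  proof
    have fb: "(f b, f c) \<in> r'" "f b \<noteq> f c" using mono[OF bc] by auto
    show "(g b, g c) \<in> r" using iso_forward[OF fb(1) e] by (simp add: g_def)
    have "f b \<in> Field r'" "f c \<in> Field r'" using fb(1) by (auto simp: Field_def)
    then show "g b \<noteq> g c" using fb(2) bij by (auto simp: g_def bij_betw_def inj_on_def)
  qed
  define Q where "Q = {b. (g b, b) \<in> r \<and> g b \<noteq> b}"
  have aQ: "a \<in> Q" using g[OF a(1)] by (simp add: Q_def underS_def)
  have wf: "wf (r - Id)" using r by (simp add: well_order_on_def)
  have "\<exists>b\<in>Q. \<forall>c. (c, b) \<in> r - Id \<longrightarrow> c \<notin> Q"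
    by (rule wf_eq_minimal[THEN iffD1, OF wf, THEN spec, THEN spec, THEN mp, OF aQ])
  then obtain b where b: "b \<in> Q" "\<forall>c. (c, b) \<in> r - Id \<longrightarrow> c \<notin> Q" by blast
  have "(g b, b) \<in> r" "g b \<noteq> b" using b(1) by (simp_all add: Q_def)
  then have "g b \<in> Q" using gm[of "g b" b] by (simp add: Q_def)
  moreover have "g b \<notin> Q" using b(2) \<open>(g b, b) \<in> r\<close> \<open>g b \<noteq> b\<close> by blast
  ultimately show False by blast
qed

text \<open>
  If the set below \<open>t\<close> had at least the order type \<open>h\<close>, a node of that set or \<open>t\<close> itself would lie on
  the level \<open>h\<close>, which is empty.
\<close>

lemma (in order_tree) below_height:
  assumes h: "tree_height T h" and t: "t \<in> Field T"
  shows "Restr T (underS T t) <o h"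
proof (rule ccontr)
  let ?W = "Restr T (underS T t)"
  have W: "Well_order ?W" by (rule well_order_below[OF t])
  have wh: "Well_order h" and empty: "tree_level T h = {}" using h by (auto simp: tree_height_def)
  assume "\<not> ?W <o h"
  then have "h \<le>o ?W" using not_ordLess_iff_ordLeq[OF wh W] by simp
  then have "h <o ?W \<or> h =o ?W" unfolding ordLeq_iff_ordLess_or_ordIso .
  then consider "h <o ?W" | "h =o ?W" by (rule disjE)
  then show False
  proof cases
    case 1
    then obtain s where s: "s \<in> Field ?W" "h =o Restr ?W (underS ?W s)"
      unfolding ordLess_iff_ordIso_Restr[OF W wh] by blast
    have st: "s \<in> underS T t" using s(1) unfolding Field_Restr_underS .
    have sT: "(s, t) \<in> T" "s \<noteq> t" using st by (auto simp: underS_def)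
    have "underS ?W s = underS T s"
    proof -
      have "u \<in> underS T t" if "u \<in> underS T s" for u
        using that sT trans[of u s t] antisym[of s t] by (auto simp: underS_def)
      then show ?thesis using st by (auto simp: underS_def)
    qed
    moreover have "Restr ?W (underS T s) = Restr T (underS T s)"
    proof -
      have "underS T s \<subseteq> underS T t"
        using sT trans[of _ s t] antisym[of s t] by (auto simp: underS_def)
      then show ?thesis by blast
    qed
    ultimately have "h =o Restr T (underS T s)" using s(2) by simp
    then have "s \<in> tree_level T h"
      using in_Field[OF sT(1)] ordIso_symmetric by (auto simp: tree_level_def)
    then show False using empty by blast
  next
    case 2
    then have "t \<in> tree_level T h" using t ordIso_symmetric by (auto simp: tree_level_def)
    then show False using empty by blast
  qed
qed

text \<open>
  \<open>C'\<close> consists of the first \<open>h2 + 1\<close> elements of the chain. In a strictly increasing image, the set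
  below the last element would have at least the order type \<open>h2\<close> of the height.
\<close>

lemma chain_obstruction:
  fixes B :: "'b set" and T1 :: "'n rel" and T2 :: "'m rel" and h1 :: "'c rel" and h2 :: "'d rel"
  assumes T2: "order_tree T2" "tree_height T2 h2"
    and C: "Restr T1 C =o h1" and lt: "h2 <o h1"
    and B: "infinite B" "|Field h2| \<le>o |B|"
  shows "\<exists>C'\<subseteq>C. |C'| \<le>o |B| \<and> (\<forall>f. (\<forall>t\<in>C'. f t \<in> Field T2) \<longrightarrow>
      (\<exists>t\<in>C'. \<exists>t'\<in>C'. (t, t') \<in> T1 \<and> t \<noteq> t' \<and> \<not> ((f t, f t') \<in> T2 \<and> f t \<noteq> f t')))"
proof -
  interpret T2: order_tree T2 by (rule T2(1))
  let ?R = "Restr T1 C"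
  have R: "Well_order ?R" and wh2: "Well_order h2"
    using C lt by (auto simp: ordIso_def ordLess_def)
  have "h2 <o ?R" by (rule ordLess_ordIso_trans[OF lt ordIso_symmetric[OF C]])
  then obtain n where n: "n \<in> Field ?R" "h2 =o Restr ?R (underS ?R n)"
    unfolding ordLess_iff_ordIso_Restr[OF R wh2] by blast
  let ?Rn = "Restr ?R (underS ?R n)"
  have Rn: "Well_order ?Rn" using n(2) by (simp add: ordIso_def)
  have "underS ?R n \<subseteq> Field ?R" by (auto simp: underS_def Field_def)
  then have FRn: "Field ?Rn = underS ?R n" by (rule Field_Restr_Well_order[OF R])
  define C' where "C' = underS ?R n \<union> {n}"
  have nC: "n \<in> C" using n(1) by (auto simp: Field_def)
  have "underS ?R n \<subseteq> C" by (auto simp: underS_def)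
  then have sub: "C' \<subseteq> C" using nC by (simp add: C'_def)
  have card: "|C'| \<le>o |B|"
    unfolding C'_def
  proof (rule card_of_Un_ordLeq_infinite_Field[OF _ _ _ card_of_Card_order])
    show "infinite (Field |B| )" using B(1) by (simp add: Field_card_of)
    have "|Field ?Rn| =o |Field h2|" by (rule ordIso_symmetric[OF card_of_cong[OF n(2)]])
    then have "|underS ?R n| =o |Field h2|" unfolding FRn .
    then show "|underS ?R n| \<le>o |B|" using B(2) by (rule ordIso_ordLeq_trans)
    show "|{n}| \<le>o |B|"
      by (rule ordLess_imp_ordLeq[OF finite_ordLess_infinite[OF card_of_Well_order card_of_Well_order]])
        (use B(1) in \<open>simp_all add: Field_card_of\<close>)
  qed
  have obs: "\<exists>t\<in>C'. \<exists>t'\<in>C'. (t, t') \<in> T1 \<and> t \<noteq> t' \<and> \<not> ((f t, f t') \<in> T2 \<and> f t \<noteq> f t')"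
    if f': "\<forall>t\<in>C'. f t \<in> Field T2" for f
  proof (rule ccontr)
    assume neg: "\<not> ?thesis"
    note f = f'[rule_format]
    have mono: "(f t, f t') \<in> T2 \<and> f t \<noteq> f t'" if "t \<in> C'" "t' \<in> C'" "(t, t') \<in> T1" "t \<noteq> t'" for t t'
      using neg that by blast
    have nC: "n \<in> C'" by (simp add: C'_def)
    let ?W = "Restr T2 (underS T2 (f n))"
    have W: "Well_order ?W" by (rule T2.well_order_below[OF f[OF nC]])
    have below: "f a \<in> underS T2 (f n)" if a: "a \<in> underS ?R n" for a
    proof -
      have "a \<in> C'" "(a, n) \<in> T1" "a \<noteq> n" using a by (auto simp: C'_def underS_def)
      then show ?thesis using mono[OF _ nC, of a] by (simp add: underS_def)
    qed
    have "?Rn \<le>o ?W"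
    proof (rule strict_mono_imp_ordLeq[OF Rn W])
      show "f a \<in> Field ?W" if "a \<in> Field ?Rn" for a
        unfolding T2.Field_Restr_underS using that unfolding FRn by (rule below)
      fix a b assume ab: "(a, b) \<in> ?Rn" "a \<noteq> b"
      then have u: "a \<in> underS ?R n" "b \<in> underS ?R n" "(a, b) \<in> T1" by auto
      then have "(f a, f b) \<in> T2 \<and> f a \<noteq> f b" using mono[of a b] ab(2) by (auto simp: C'_def)
      then show "(f a, f b) \<in> ?W \<and> f a \<noteq> f b" using below[OF u(1)] below[OF u(2)] by simp
    qed
    with n(2) have "h2 \<le>o ?W" by (rule ordIso_ordLeq_trans)
    moreover have "?W <o h2" by (rule T2.below_height[OF T2(2) f[OF nC]])
    ultimately have "h2 <o h2" by (rule ordLeq_ordLess_trans)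
    then show False using ordLess_irreflexive by blast
  qed
  show ?thesis by (intro exI[of _ C'] conjI allI impI sub card obs)
qed

lemma Field_ord_below:
  "Well_order r \<Longrightarrow> Field (ord_below r a) = underS r a"
  unfolding ord_below_def
  by (rule Field_Restr_Well_order) (auto simp: underS_def Field_def)

lemma natLeq_iff: "(x, y) \<in> natLeq \<longleftrightarrow> x \<le> y"
  by (simp add: natLeq_def)

lemma Field_ord_prod_natLeq:
  assumes "Well_order s"
  shows "Field (ord_prod natLeq s) = UNIV \<times> Field s"
proof -
  have "((x, y), (x, y)) \<in> ord_prod natLeq s" if "y \<in> Field s" for x y
    using that by (simp add: ord_prod_def Field_natLeq natLeq_iff)
  then have "UNIV \<times> Field s \<subseteq> Field (ord_prod natLeq s)" by (force simp: Field_def)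
  moreover have "Field (ord_prod natLeq s) \<subseteq> UNIV \<times> Field s"
    by (auto simp: ord_prod_def Field_def)
  ultimately show ?thesis by blast
qed

text \<open>
  The product \<open>\<omega> \<cdot> \<gamma>\<close> is the initial segment of \<open>\<omega> \<cdot> \<delta>\<close> below \<open>(0, \<gamma>)\<close>.
\<close>

lemma omega_times_mono:
  assumes k: "Well_order kappa" and lt: "\<gamma> \<in> underS kappa \<delta>"
    and wo: "Well_order (ord_prod natLeq (ord_below kappa \<gamma>))"
      "Well_order (ord_prod natLeq (ord_below kappa \<delta>))"
  shows "ord_prod natLeq (ord_below kappa \<gamma>) <o ord_prod natLeq (ord_below kappa \<delta>)"
proof -
  let ?P' = "ord_prod natLeq (ord_below kappa \<gamma>)" and ?P = "ord_prod natLeq (ord_below kappa \<delta>)"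
  have tr: "(a, c) \<in> kappa" if "(a, b) \<in> kappa" "(b, c) \<in> kappa" for a b c
    using k that by (auto simp: order_on_defs dest: transD)
  have as: "a = b" if "(a, b) \<in> kappa" "(b, a) \<in> kappa" for a b
    using k that by (auto simp: order_on_defs dest: antisymD)
  have \<gamma>\<delta>: "(\<gamma>, \<delta>) \<in> kappa" "\<gamma> \<noteq> \<delta>" using lt by (auto simp: underS_def)
  have sub: "underS kappa \<gamma> \<subseteq> underS kappa \<delta>"
    using \<gamma>\<delta> tr as by (auto simp: underS_def)
  have F: "Field (ord_below kappa \<gamma>) = underS kappa \<gamma>" "Field (ord_below kappa \<delta>) = underS kappa \<delta>"
    by (rule Field_ord_below[OF k])+
  have memP: "((x, y), (x', y')) \<in> ord_prod natLeq (ord_below kappa \<beta>) \<longleftrightarrow>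
      y \<in> underS kappa \<beta> \<and> y' \<in> underS kappa \<beta> \<and> ((y, y') \<in> kappa \<and> y \<noteq> y' \<or> y = y' \<and> x \<le> x')"
    for x y x' y' \<beta>
    unfolding ord_prod_def using Field_ord_below[OF k, of \<beta>]
    by (auto simp: Field_natLeq natLeq_iff ord_below_def)
  have under: "underS ?P (0, \<gamma>) = UNIV \<times> underS kappa \<gamma>"
  proof -
    have "(x, y) \<in> underS ?P (0, \<gamma>) \<longleftrightarrow> y \<in> underS kappa \<gamma>" for x y
      using lt sub by (auto simp: underS_def[of ?P] memP) (auto simp: underS_def)
    then show ?thesis by auto
  qed
  have "?P' = Restr ?P (underS ?P (0, \<gamma>))"
  proof -
    have "((x, y), (x', y')) \<in> ?P' \<longleftrightarrow> ((x, y), (x', y')) \<in> Restr ?P (underS ?P (0, \<gamma>))" for x y x' y'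
      unfolding under using sub by (auto simp: memP)
    then show ?thesis by auto
  qed
  then have "?P' =o Restr ?P (underS ?P (0, \<gamma>))" using wo(1) ordIso_reflexive by metis
  moreover have "(0, \<gamma>) \<in> Field ?P"
    using lt memP[of 0 \<gamma> 0 \<gamma> \<delta>] by (auto simp: Field_def)
  ultimately show ?thesis unfolding ordLess_iff_ordIso_Restr[OF wo(2) wo(1)] by blast
qed

locale upsilon_family =
  fixes kappa :: "'a rel" and Ups :: "'a \<Rightarrow> 'a rel"
  assumes kappa: "Card_order kappa" "uncountable (Field kappa)"
    and Ups: "\<And>\<alpha>. \<alpha> \<in> Field kappa \<Longrightarrow> \<alpha> \<noteq> ord_zero kappa \<Longrightarrow> upsilon_tree kappa \<alpha> (Ups \<alpha>)"
begin

lemma well_order_kappa: "Well_order kappa"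
  using kappa(1) by (simp add: card_order_on_def)

text \<open>
  A set of cardinality \<open>max (|\<alpha>|, \<omega>)\<close>, the bound for all sets of coordinates that occur.
\<close>

abbreviation small_set :: "'a \<Rightarrow> (nat + 'a) set" where
  "small_set \<alpha> \<equiv> (UNIV :: nat set) <+> underS kappa \<alpha>"

lemma infinite_small_set: "infinite (small_set \<alpha>)"
proof
  assume "finite (small_set \<alpha>)"
  then have "finite (UNIV :: nat set)" by (metis card_of_Plus1 card_of_ordLeq_finite)
  then show False by simp
qed

lemma natLeq_le_small: "natLeq \<le>o |small_set \<alpha>|"
  using infinite_small_set infinite_iff_natLeq_ordLeq by blast

lemma infinite_kappa: "infinite (Field kappa)"
  using kappa(2) countable_finite by blast

lemma small_set_less:
  assumes \<alpha>: "\<alpha> \<in> Field kappa"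
  shows "|small_set \<alpha>| <o kappa"
proof (rule card_of_Plus_ordLess_infinite_Field[OF infinite_kappa kappa(1)])
  show "|underS kappa \<alpha>| <o kappa" by (rule card_of_underS[OF kappa(1) \<alpha>])
  have "\<not> |Field kappa| \<le>o |UNIV :: nat set|"
    using kappa(2) by (metis card_of_ordLeq countableI)
  then have "|UNIV :: nat set| <o |Field kappa|"
    using not_ordLeq_iff_ordLess[OF card_of_Well_order card_of_Well_order] by blast
  then show "|UNIV :: nat set| <o kappa"
    by (rule ordLess_ordIso_trans[OF _ card_of_Field_ordIso[OF kappa(1)]])
qed

lemma upsilonD:
  assumes a: "a \<in> Field kappa - {ord_zero kappa}"
  shows "order_tree (Ups a)" "is_root (Ups a) a" "ever_branching (Ups a)"
    "tree_height (Ups a) (ord_prod natLeq (ord_below kappa a))"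
    "\<exists>C\<in>branches (Ups a). Restr (Ups a) C =o ord_prod natLeq (ord_below kappa a)"
    "|Field (Ups a)| \<le>o |small_set a|"
proof -
  have u: "upsilon_tree kappa a (Ups a)" using Ups a by blast
  show "order_tree (Ups a)" "is_root (Ups a) a" "ever_branching (Ups a)"
    "tree_height (Ups a) (ord_prod natLeq (ord_below kappa a))"
    "\<exists>C\<in>branches (Ups a). Restr (Ups a) C =o ord_prod natLeq (ord_below kappa a)"
    using u by (simp_all add: upsilon_tree_def order_tree_def)
  have c: "if finite (underS kappa a) then |Field (Ups a)| =o natLeq
      else |Field (Ups a)| =o |underS kappa a|"
    using u by (simp add: upsilon_tree_def)
  show "|Field (Ups a)| \<le>o |small_set a|"
  proof (cases "finite (underS kappa a)")
    case True
    then have "|Field (Ups a)| =o natLeq" using c by simp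
    then show ?thesis using natLeq_le_small by (rule ordIso_ordLeq_trans)
  next
    case False
    then have "|Field (Ups a)| =o |underS kappa a|" using c by simp
    then show ?thesis using card_of_Plus2 by (rule ordIso_ordLeq_trans)
  qed
qed

lemma underS_trans: "b \<in> underS kappa a \<Longrightarrow> underS kappa b \<subseteq> underS kappa a"
  using well_order_kappa
  by (auto simp: underS_def order_on_defs dest: transD antisymD)

lemma small_set_mono:
  assumes "b = a \<or> b \<in> underS kappa a"
  shows "|small_set b| \<le>o |small_set a|"
proof -
  have "underS kappa b \<subseteq> underS kappa a" using assms underS_trans by auto
  then have "small_set b \<subseteq> small_set a"
    unfolding Plus_def by (intro Un_mono image_mono order_refl)
  then show ?thesis by (rule card_of_mono1)
qed

lemma omega_times_small:
  "|Field (ord_prod natLeq (ord_below kappa a))| \<le>o |small_set a|"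
proof -
  have wo: "Well_order (ord_below kappa a)"
    unfolding ord_below_def by (rule Well_order_Restr[OF well_order_kappa])
  have F: "Field (ord_prod natLeq (ord_below kappa a)) = (UNIV :: nat set) \<times> underS kappa a"
    unfolding Field_ord_prod_natLeq[OF wo] Field_ord_below[OF well_order_kappa] ..
  have "|(UNIV :: nat set) \<times> underS kappa a| \<le>o |small_set a \<times> underS kappa a|"
    by (rule card_of_Times_mono1[OF card_of_Plus1])
  also have "|small_set a \<times> underS kappa a| \<le>o |small_set a \<times> small_set a|"
    by (rule card_of_Times_mono2[OF card_of_Plus2])
  also have "|small_set a \<times> small_set a| =o |small_set a|"
    by (rule card_of_Times_same_infinite[OF infinite_small_set])
  finally show ?thesis unfolding F .
qed

end

locale upsilon_sum_tree = upsilon_family kappa Ups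
  for kappa :: "'a rel" and Ups +
  fixes A :: "'a set" and T :: "'a rel"
  assumes A: "A \<subseteq> Field kappa - {ord_zero kappa}" "|A| =o kappa"
    and sum: "upsilon_sum kappa Ups A T"
begin

abbreviation "r \<equiv> ord_zero kappa"

sublocale order_tree T
  using sum by (simp add: upsilon_sum_def order_tree_def)

lemma root: "is_root T r" and children: "imm_succs T r = A"
  and cone_eq: "a \<in> A \<Longrightarrow> Restr T (above T a) = Ups a"
  using sum by (simp_all add: upsilon_sum_def)

lemma child_Field: "a \<in> A \<Longrightarrow> a \<in> Field T"
  using imm_succsD(1)[of a r] in_Field children by blast

lemma Field_Ups:
  assumes a: "a \<in> A"
  shows "Field (Ups a) = above T a"
proof -
  have "(s, s) \<in> Restr T (above T a)" if "s \<in> above T a" for s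
    using that refl in_Field by (auto simp: above_def)
  then have "Field (Restr T (above T a)) = above T a" by (force simp: Field_def)
  then show ?thesis unfolding cone_eq[OF a] .
qed

lemma Ups_iff: "a \<in> A \<Longrightarrow> (s, t) \<in> Ups a \<longleftrightarrow> (a, s) \<in> T \<and> (a, t) \<in> T \<and> (s, t) \<in> T"
  using cone_eq by (force simp: above_def)

lemma infinite_A: "infinite A"
proof -
  have "|Field kappa| \<le>o |A|"
    by (rule ordIso_imp_ordLeq[OF ordIso_symmetric[OF ordIso_transitive[OF A(2)
      ordIso_symmetric[OF card_of_Field_ordIso[OF kappa(1)]]]]])
  then show ?thesis using infinite_kappa card_of_ordLeq_infinite by blast
qed

lemma two_children:
  assumes t: "t \<in> Field T"
  obtains c c' where "c \<noteq> c'" "c \<in> imm_succs T t" "c' \<in> imm_succs T t"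
proof (cases "t = r")
  case True
  have "A \<noteq> {}" using infinite_A by auto
  then obtain c where c: "c \<in> A" by blast
  have "infinite (A - {c})" using infinite_A by simp
  then obtain c' where "c' \<in> A - {c}" using infinite_imp_nonempty by blast
  then show ?thesis using that[of c c'] c children True by blast
next
  case False
  have "(r, t) \<in> T" using root t by (simp add: is_root_def)
  then obtain a where a: "a \<in> imm_succs T r" "(a, t) \<in> T" using child_exists False by blast
  then have aA: "a \<in> A" using children by blast
  have tU: "t \<in> Field (Ups a)" using a(2) by (simp add: Field_Ups[OF aA] above_def)
  have "ever_branching (Ups a)" using upsilonD(3) aA A(1) by blast
  then obtain c c' where c: "c \<in> imm_succs (Ups a) t" "c' \<in> imm_succs (Ups a) t" "c \<noteq> c'"
    using tU unfolding ever_branching_def by blast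
  have "d \<in> imm_succs T t" if d: "d \<in> imm_succs (Ups a) t" for d
  proof -
    have 1: "(t, d) \<in> Ups a" "d \<noteq> t" using d by (auto simp: imm_succs_def aboveS_def)
    have 2: "u = t \<or> u = d" if u: "(t, u) \<in> T" "(u, d) \<in> T" for u
    proof -
      have "(a, u) \<in> T" using trans[OF a(2) u(1)] .
      then have "(t, u) \<in> Ups a" "(u, d) \<in> Ups a"
        using u 1(1) a(2) by (simp_all add: Ups_iff[OF aA])
      then show ?thesis using d by (auto simp: imm_succs_def aboveS_def underS_def)
    qed
    have "(t, d) \<in> T" using 1(1) by (simp add: Ups_iff[OF aA])
    then show ?thesis using 1(2) 2 by (auto simp: imm_succs_def aboveS_def underS_def)
  qed
  then show ?thesis using that[of c c'] c by blast
qed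

lemma cone_small:
  assumes "a \<in> A" "a = \<alpha> \<or> a \<in> underS kappa \<alpha>"
  shows "|above T a| \<le>o |small_set \<alpha>|"
proof -
  have "|Field (Ups a)| \<le>o |small_set a|" using upsilonD(6) assms(1) A(1) by blast
  then have "|above T a| \<le>o |small_set a|" unfolding Field_Ups[OF assms(1)] .
  then show ?thesis using small_set_mono[OF assms(2)] by (rule ordLeq_transitive)
qed

end

text \<open>
  As \<open>\<omega> \<cdot> \<gamma> < \<omega> \<cdot> \<delta>\<close>, a branch of \<open>\<Upsilon>\<^sub>\<delta>\<close> of length \<open>\<omega> \<cdot> \<delta>\<close> is longer than the height of
  \<open>\<Upsilon>\<^sub>\<gamma>\<close>. An initial piece that is too long has only the size of \<open>\<gamma>\<close>, which matters because it
  must fit into a small window.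
\<close>

lemma upsilon_chain_obstruction:
  assumes T1: "upsilon_sum_tree kappa Ups A1 T1" and T2: "upsilon_sum_tree kappa Ups A2 T2"
    and \<delta>: "\<delta> \<in> A1" and \<gamma>: "\<gamma> \<in> A2" and lt: "\<gamma> \<in> underS kappa \<delta>"
  shows "\<exists>C\<subseteq>above T1 \<delta>. |C| \<le>o |(UNIV :: nat set) <+> underS kappa \<gamma>| \<and>
    (\<forall>f. (\<forall>t\<in>C. (\<gamma>, f t) \<in> T2) \<longrightarrow>
      (\<exists>t\<in>C. \<exists>t'\<in>C. (t, t') \<in> T1 \<and> t \<noteq> t' \<and> \<not> ((f t, f t') \<in> T2 \<and> f t \<noteq> f t')))"
proof -
  interpret T1: upsilon_sum_tree kappa Ups A1 T1 by (rule T1)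
  interpret T2: upsilon_sum_tree kappa Ups A2 T2 by (rule T2)
  have \<delta>F: "\<delta> \<in> Field kappa - {ord_zero kappa}" using \<delta> T1.A(1) by blast
  have \<gamma>F: "\<gamma> \<in> Field kappa - {ord_zero kappa}" using \<gamma> T2.A(1) by blast
  obtain C0 where C0: "C0 \<in> branches (Ups \<delta>)" "Restr (Ups \<delta>) C0 =o ord_prod natLeq (ord_below kappa \<delta>)"
    using T1.upsilonD(5)[OF \<delta>F] by blast
  have wo: "Well_order (ord_prod natLeq (ord_below kappa \<gamma>))"
    "Well_order (ord_prod natLeq (ord_below kappa \<delta>))"
    using T1.upsilonD(4)[OF \<gamma>F] T1.upsilonD(4)[OF \<delta>F] by (simp_all add: tree_height_def)
  note less = omega_times_mono[OF T1.well_order_kappa lt wo]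
  have "\<exists>C\<subseteq>C0. |C| \<le>o |T1.small_set \<gamma>| \<and> (\<forall>f. (\<forall>t\<in>C. f t \<in> Field (Ups \<gamma>)) \<longrightarrow>
      (\<exists>t\<in>C. \<exists>t'\<in>C. (t, t') \<in> Ups \<delta> \<and> t \<noteq> t' \<and> \<not> ((f t, f t') \<in> Ups \<gamma> \<and> f t \<noteq> f t')))"
    by (rule chain_obstruction[OF T1.upsilonD(1)[OF \<gamma>F] T1.upsilonD(4)[OF \<gamma>F] C0(2) less
        T1.infinite_small_set T1.omega_times_small])
  then obtain C where C: "C \<subseteq> C0" "|C| \<le>o |T1.small_set \<gamma>|"
    and obs: "\<forall>f. (\<forall>t\<in>C. f t \<in> Field (Ups \<gamma>)) \<longrightarrow>
      (\<exists>t\<in>C. \<exists>t'\<in>C. (t, t') \<in> Ups \<delta> \<and> t \<noteq> t' \<and> \<not> ((f t, f t') \<in> Ups \<gamma> \<and> f t \<noteq> f t'))"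
    by (elim exE conjE)
  have "C0 \<subseteq> Field (Ups \<delta>)"
  proof
    fix s assume "s \<in> C0"
    then have "(s, s) \<in> Ups \<delta>" using C0(1) by (auto simp: branches_def Chains_def)
    then show "s \<in> Field (Ups \<delta>)" by (auto simp: Field_def)
  qed
  then have sub: "C \<subseteq> above T1 \<delta>" using C(1) unfolding T1.Field_Ups[OF \<delta>] by blast
  have "\<exists>t\<in>C. \<exists>t'\<in>C. (t, t') \<in> T1 \<and> t \<noteq> t' \<and> \<not> ((f t, f t') \<in> T2 \<and> f t \<noteq> f t')"
    if f: "\<forall>t\<in>C. (\<gamma>, f t) \<in> T2" for f
  proof -
    have "\<forall>t\<in>C. f t \<in> Field (Ups \<gamma>)"
      using f unfolding T2.Field_Ups[OF \<gamma>] by (simp add: above_def)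
    from obs[THEN spec, THEN mp, OF this]
    obtain t t' where t: "t \<in> C" "t' \<in> C" "(t, t') \<in> Ups \<delta>" "t \<noteq> t'"
      "\<not> ((f t, f t') \<in> Ups \<gamma> \<and> f t \<noteq> f t')" by (elim bexE conjE)
    have "(t, t') \<in> T1" using t(3) by (simp add: T1.Ups_iff[OF \<delta>])
    moreover have "\<not> ((f t, f t') \<in> T2 \<and> f t \<noteq> f t')"
      using t(5) f t(1,2) by (simp add: T2.Ups_iff[OF \<gamma>])
    ultimately show ?thesis using t(1,2,4) by blast
  qed
  then show ?thesis by (intro exI[of _ C] conjI allI impI sub C(2))
qed

section \<open>The invariant separates the spaces\<close>

text \<open>
  One set \<open>M\<close> cuts out both the nodes and the labels of a window, so that a single closure argument
  serves both trees.
\<close>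

lemma (in upsilon_sum_tree) tree_windowsI:
  assumes rM: "r \<in> M" and MM': "M \<subseteq> M'"
    and succ: "\<And>t. t \<in> M \<Longrightarrow> t \<in> Field T \<Longrightarrow>
      \<exists>c\<in>M. \<exists>c'\<in>M. c \<noteq> c' \<and> c \<in> imm_succs T t \<and> c' \<in> imm_succs T t"
    and anc: "\<And>a s. a \<in> A \<Longrightarrow> s \<in> M \<Longrightarrow> (a, s) \<in> T \<Longrightarrow> a \<in> M"
    and inf: "infinite (M \<inter> \<Gamma>)" and out: "\<Gamma> - M' \<noteq> {}"
    and \<gamma>0: "\<gamma>0 \<in> \<Gamma>" "\<gamma>0 \<in> M'" "\<gamma>0 \<notin> M"
    and \<nu>: "\<nu> \<in> pmfs_on (KT \<Gamma>)"
  shows "tree_windows T \<Gamma> (M \<inter> Field T) (M \<inter> \<Gamma>) r (M' \<inter> Field T) (M' \<inter> \<Gamma>) \<gamma>0 \<nu>"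
proof -
  have rF: "r \<in> Field T" using root by (simp add: is_root_def)
  have succF: "\<exists>c\<in>M \<inter> Field T. \<exists>c'\<in>M \<inter> Field T. c \<noteq> c' \<and> c \<in> imm_succs T t \<and> c' \<in> imm_succs T t"
    if t: "t \<in> M \<inter> Field T" for t
  proof -
    obtain c c' where c: "c \<in> M" "c' \<in> M" "c \<noteq> c'" "c \<in> imm_succs T t" "c' \<in> imm_succs T t"
      using succ[of t] t by blast
    have "c \<in> Field T" "c' \<in> Field T" using in_Field imm_succsD(1) c(4,5) by blast+
    then show ?thesis using c by blast
  qed
  have win: "window (Field T) (tree_cmp T) \<Gamma> (L \<inter> Field T) (L \<inter> \<Gamma>) r"
    if L: "M \<subseteq> L" "\<Gamma> - L \<noteq> {}" for L
  proof (intro window.intro window_axioms.intro compat_nodes.intro)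
    show "tree_cmp T s s" if "s \<in> Field T" for s using refl[OF that] by (simp add: tree_cmp_def)
    show "tree_cmp T t s" if "tree_cmp T s t" for s t using that by (auto simp: tree_cmp_def)
    show "infinite (L \<inter> \<Gamma>)" using inf L(1) by (meson Int_mono finite_subset order_refl)
    show "\<Gamma> - (L \<inter> \<Gamma>) \<noteq> {}" using L(2) by blast
    obtain c c' where c: "c \<in> M \<inter> Field T" "c' \<in> M \<inter> Field T" "c \<noteq> c'"
      "c \<in> imm_succs T r" "c' \<in> imm_succs T r" using succF[of r] rM rF by blast
    have "\<not> tree_cmp T c c'" using children_eq[OF c(4,5)] c(3) by blast
    then show "\<exists>s\<in>L \<inter> Field T. \<exists>s'\<in>L \<inter> Field T. \<not> tree_cmp T s s'" using c(1,2) L(1) by blast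
    show "r \<in> L \<inter> Field T" using rM L(1) rF by blast
    show "tree_cmp T r t" if "t \<in> Field T" for t
      using root that by (simp add: is_root_def tree_cmp_def)
  qed auto
  have out': "\<Gamma> - M \<noteq> {}" using out MM' by blast
  show ?thesis
  proof (intro tree_windows.intro two_windows.intro two_windows_axioms.intro tree_windows_axioms.intro
      win order_refl MM' out out')
    show "order_tree T" by (rule order_tree_axioms)
    show "M \<inter> Field T \<subseteq> M' \<inter> Field T" "M \<inter> \<Gamma> \<subseteq> M' \<inter> \<Gamma>" using MM' by auto
    show "\<gamma>0 \<in> M' \<inter> \<Gamma>" "\<gamma>0 \<notin> M \<inter> \<Gamma>" using \<gamma>0 by auto
    show "\<nu> \<in> pmfs_on (compat_sets (Field T) (tree_cmp T) \<Gamma>)" by (rule \<nu>)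
    show "is_root T r" by (rule root)
    show "\<exists>c\<in>M \<inter> Field T. \<exists>c'\<in>M \<inter> Field T. c \<noteq> c' \<and> c \<in> imm_succs T t \<and> c' \<in> imm_succs T t"
      if "t \<in> M \<inter> Field T" for t by (rule succF[OF that])
    show "a \<in> M \<inter> Field T" if "a \<in> imm_succs T r" "s \<in> M \<inter> Field T" "(a, s) \<in> T" for a s
      using anc[of a s] that in_Field[OF that(3)] children by blast
  qed
qed

lemma fiber_homeo_sym:
  assumes "fiber_homeo X Y h g E E' E2 E2'"
  shows "fiber_homeo Y X g h E2 E2' E E'"
proof -
  interpret H: fiber_homeo X Y h g E E' E2 E2' by (rule assms)
  show ?thesis
  proof
    show "homeomorphic_maps Y X g h" by (rule homeomorphic_maps_sym[THEN iffD1, OF H.h])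
    show "E2 x y \<longleftrightarrow> E (g x) (g y)" "E2' x y \<longleftrightarrow> E' (g x) (g y)"
      if "x \<in> topspace Y" "y \<in> topspace Y" for x y
      using H.E[OF H.maps(2)[OF that(1)] H.maps(2)[OF that(2)]]
        H.E'[OF H.maps(2)[OF that(1)] H.maps(2)[OF that(2)]] that by (simp_all add: H.maps(4))
  qed
qed

text \<open>
  A homeomorphism \<open>h\<close> and its inverse determine, for each coordinate, countably many coordinates on
  which it depends. A small set \<open>M\<close> closed under these dependencies yields windows that \<open>h\<close> matches,
  and a small closed \<open>M' \<supseteq> M\<close> the larger ones; both omit labels as they have fewer than \<open>\<kappa>\<close> elements.
  So \<open>h\<close> carries the node points of one tree to those of the other, and coatoms to coatoms: the
  child \<open>\<alpha>\<close> of the root of the first tree corresponds to a child \<open>\<beta>\<close> of the root of the second, with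
  \<open>\<beta> \<in> B\<close> and hence \<open>\<beta> \<noteq> \<alpha>\<close>. Chains in one cone then map strictly increasingly into the other, and
  the longer of \<open>\<Upsilon>\<^sub>\<alpha>\<close> and \<open>\<Upsilon>\<^sub>\<beta>\<close> contains a chain that does not fit. The two cases are not symmetric:
  the cones for \<open>\<beta> < \<alpha>\<close> are small and lie in \<open>M\<close>, but those for \<open>\<beta> > \<alpha>\<close> can be too large for that.
  Of each of the latter only a chain of the size of \<open>\<alpha>\<close> is included in \<open>M\<close>.
\<close>

lemma pmf_spaces_not_homeomorphic:
  fixes kappa :: "'a rel" and A B :: "'a set" and TA TB :: "'a rel"
  assumes UA: "upsilon_sum_tree kappa Ups A TA" and UB: "upsilon_sum_tree kappa Ups B TB"
    and \<alpha>: "\<alpha> \<in> A" "\<alpha> \<notin> B"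
  shows "\<not> pmf_space (compat_sets (Field TA) (tree_cmp TA) (Field kappa)) homeomorphic_space
    pmf_space (compat_sets (Field TB) (tree_cmp TB) (Field kappa))"
proof
  interpret A: upsilon_sum_tree kappa Ups A TA by (rule UA)
  interpret B: upsilon_sum_tree kappa Ups B TB by (rule UB)
  define \<Gamma> where "\<Gamma> = Field kappa"
  define KA where "KA = A.KT \<Gamma>"
  define KB where "KB = B.KT \<Gamma>"
  define r where "r = ord_zero kappa"
  assume "pmf_space (compat_sets (Field TA) (tree_cmp TA) (Field kappa)) homeomorphic_space
    pmf_space (compat_sets (Field TB) (tree_cmp TB) (Field kappa))"
  then obtain h g where hg: "homeomorphic_maps (pmf_space KA) (pmf_space KB) h g"
    unfolding homeomorphic_space_def KA_def KB_def \<Gamma>_def by blast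
  have ch: "continuous_map (pmf_space KA) (pmf_space KB) h"
    and cg: "continuous_map (pmf_space KB) (pmf_space KA) g"
    and gh: "\<And>x. x \<in> pmfs_on KA \<Longrightarrow> g (h x) = x"
    and hK: "\<And>x. x \<in> pmfs_on KA \<Longrightarrow> h x \<in> pmfs_on KB"
    using hg by (simp_all add: homeomorphic_maps_def continuous_map_def Pi_iff)
  have CA: "compact_pair_family KA (K_space TA \<Gamma>)" unfolding KA_def by (rule A.compact_pair_family_K_space)
  have CB: "compact_pair_family KB (K_space TB \<Gamma>)" unfolding KB_def by (rule B.compact_pair_family_K_space)
  \<comment> \<open>at most as large as \<open>\<alpha>\<close> or countable, in particular smaller than \<open>\<kappa>\<close>\<close>
  define small where "small X \<longleftrightarrow> |X| \<le>o |A.small_set \<alpha>|" for X :: "'a set"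
  note inf0 = A.infinite_small_set[of \<alpha>]
  have \<alpha>F: "\<alpha> \<in> Field kappa" using \<alpha>(1) A.A(1) by blast
  have small_Un: "small (X \<union> Y)" if "small X" "small Y" for X Y
    unfolding small_def
    by (rule card_of_Un_ordLeq_infinite_Field[OF _ that[unfolded small_def] card_of_Card_order])
      (use inf0 in \<open>simp add: Field_card_of\<close>)
  have small_countable: "small X" if "countable X" for X
  proof -
    have "|X| \<le>o |UNIV :: nat set|" using that unfolding countable_def card_of_ordLeq[symmetric] by simp
    also have "|UNIV :: nat set| \<le>o |A.small_set \<alpha>|" by (rule card_of_Plus1)
    finally show ?thesis unfolding small_def .
  qed
  have small_UN: "small (\<Union>i\<in>I. X i)" if "|I| \<le>o |A.small_set \<alpha>|" "\<And>i. i \<in> I \<Longrightarrow> small (X i)" for I :: "'a set" and X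
    unfolding small_def
    by (rule card_of_UNION_ordLeq_infinite[OF inf0 that(1)]) (use that(2) in \<open>simp add: small_def\<close>)
  have outside: "\<Gamma> - X \<noteq> {}" if X: "small X" for X
  proof
    assume "\<Gamma> - X = {}"
    then have "|\<Gamma>| \<le>o |X|" by (intro card_of_mono1) blast
    also have "|X| \<le>o |A.small_set \<alpha>|" using X unfolding small_def .
    also have "|A.small_set \<alpha>| <o kappa" by (rule A.small_set_less[OF \<alpha>F])
    finally have "|\<Gamma>| <o kappa" .
    moreover have "|\<Gamma>| =o kappa" unfolding \<Gamma>_def by (rule card_of_Field_ordIso[OF A.kappa(1)])
    ultimately show False using not_ordLess_ordIso by blast
  qed
  obtain NA where NA_countable: "\<forall>p q. countable (NA p q)" and NA: "\<forall>D1 D2 x y.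
      (\<forall>p\<in>D2. \<forall>q\<in>D2. NA p q \<inter> \<Union>KA \<subseteq> D1) \<longrightarrow>
      x \<in> pmfs_on KA \<longrightarrow> y \<in> pmfs_on KA \<longrightarrow> same_restr D1 x y \<longrightarrow> same_restr D2 (h x) (h y)"
    using dependence_transfer[OF CA compact_pair_family.axioms(1)[OF CB] ch] by (elim exE conjE)
  obtain NB where NB_countable: "\<forall>p q. countable (NB p q)" and NB: "\<forall>D1 D2 x y.
      (\<forall>p\<in>D2. \<forall>q\<in>D2. NB p q \<inter> \<Union>KB \<subseteq> D1) \<longrightarrow>
      x \<in> pmfs_on KB \<longrightarrow> y \<in> pmfs_on KB \<longrightarrow> same_restr D1 x y \<longrightarrow> same_restr D2 (g x) (g y)"
    using dependence_transfer[OF CB compact_pair_family.axioms(1)[OF CA] cg] by (elim exE conjE)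
  \<comment> \<open>two immediate successors of each node\<close>
  define twoA where "twoA t P \<longleftrightarrow> (\<exists>c c'. P = {c, c'} \<and> c \<noteq> c' \<and> c \<in> imm_succs TA t \<and> c' \<in> imm_succs TA t)" for t P
  define twoB where "twoB t P \<longleftrightarrow> (\<exists>c c'. P = {c, c'} \<and> c \<noteq> c' \<and> c \<in> imm_succs TB t \<and> c' \<in> imm_succs TB t)" for t P
  define succA where "succA t = (if t \<in> Field TA then SOME P. twoA t P else {})" for t
  define succB where "succB t = (if t \<in> Field TB then SOME P. twoB t P else {})" for t
  have succA: "twoA t (succA t)" if t: "t \<in> Field TA" for t
  proof -
    have "\<exists>P. twoA t P" using A.two_children[OF t] unfolding twoA_def by metis
    then show ?thesis unfolding succA_def if_P[OF t] by (rule someI_ex)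
  qed
  have succB: "twoB t (succB t)" if t: "t \<in> Field TB" for t
  proof -
    have "\<exists>P. twoB t P" using B.two_children[OF t] unfolding twoB_def by metis
    then show ?thesis unfolding succB_def if_P[OF t] by (rule someI_ex)
  qed
  have succA_small: "small (succA t)" for t
  proof (cases "t \<in> Field TA")
    case True
    then obtain c c' where "succA t = {c, c'}" using succA[OF True] unfolding twoA_def by blast
    then show ?thesis by (intro small_countable) simp
  next
    case False then show ?thesis by (intro small_countable) (simp add: succA_def)
  qed
  have succB_small: "small (succB t)" for t
  proof (cases "t \<in> Field TB")
    case True
    then obtain c c' where "succB t = {c, c'}" using succB[OF True] unfolding twoB_def by blast
    then show ?thesis by (intro small_countable) simp
  next
    case False then show ?thesis by (intro small_countable) (simp add: succB_def)
  qed
  \<comment> \<open>the child of the root below a node\<close>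
  define ancA where "ancA t = {a \<in> A. (a, t) \<in> TA}" for t
  define ancB where "ancB t = {b \<in> B. (b, t) \<in> TB}" for t
  have ancA_eq: "a = a'" if "a \<in> ancA t" "a' \<in> ancA t" for a a' t
    using A.children_eq[of a r a'] A.below_linear[of a t a'] that
    by (auto simp: ancA_def A.children r_def)
  have ancB_eq: "b = b'" if "b \<in> ancB t" "b' \<in> ancB t" for b b' t
    using B.children_eq[of b r b'] B.below_linear[of b t b'] that
    by (auto simp: ancB_def B.children r_def)
  have single: "countable X" if "\<And>a a'. a \<in> X \<Longrightarrow> a' \<in> X \<Longrightarrow> a = a'" for X :: "'a set"
  proof (cases "X = {}")
    case False
    then obtain a where "a \<in> X" by blast
    then have "X \<subseteq> {a}" using that by blast
    then show ?thesis using countable_subset by blast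
  qed simp
  have ancA_countable: "countable (ancA t)" for t by (rule single) (rule ancA_eq)
  have ancB_countable: "countable (ancB t)" for t by (rule single) (rule ancB_eq)
  \<comment> \<open>chains in the larger cones that are too long for \<open>\<Upsilon>\<^sub>\<alpha>\<close>\<close>
  define long where "long \<beta> C \<longleftrightarrow> C \<subseteq> above TB \<beta> \<and> small C \<and>
    (\<forall>f. (\<forall>t\<in>C. (\<alpha>, f t) \<in> TA) \<longrightarrow>
      (\<exists>t\<in>C. \<exists>t'\<in>C. (t, t') \<in> TB \<and> t \<noteq> t' \<and> \<not> ((f t, f t') \<in> TA \<and> f t \<noteq> f t')))" for \<beta> C
  define Ch where "Ch \<beta> = (if \<beta> \<in> B \<and> \<alpha> \<in> underS kappa \<beta> then SOME C. long \<beta> C else {})" for \<beta>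
  have Ch: "long \<beta> (Ch \<beta>)" if \<beta>: "\<beta> \<in> B \<and> \<alpha> \<in> underS kappa \<beta>" for \<beta>
    unfolding Ch_def if_P[OF \<beta>]
  proof (rule someI_ex)
    have "\<exists>C\<subseteq>above TB \<beta>. |C| \<le>o |A.small_set \<alpha>| \<and> (\<forall>f. (\<forall>t\<in>C. (\<alpha>, f t) \<in> TA) \<longrightarrow>
      (\<exists>t\<in>C. \<exists>t'\<in>C. (t, t') \<in> TB \<and> t \<noteq> t' \<and> \<not> ((f t, f t') \<in> TA \<and> f t \<noteq> f t')))"
      by (rule upsilon_chain_obstruction[OF UB UA _ \<alpha>(1)]) (use \<beta> in simp_all)
    then obtain C where "long \<beta> C" unfolding long_def small_def by (elim exE) simp
    then show "\<exists>C. long \<beta> C" ..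
  qed
  have Ch_small: "small (Ch \<beta>)" for \<beta>
  proof (cases "\<beta> \<in> B \<and> \<alpha> \<in> underS kappa \<beta>")
    case True then show ?thesis using Ch[OF True] by (simp add: long_def)
  next
    case False then show ?thesis by (intro small_countable) (simp only: Ch_def if_False countable_empty)
  qed
  \<comment> \<open>what a closed set has to contain besides the coordinates of \<open>p\<close> and \<open>q\<close>\<close>
  define F where "F p q = fst ` NA p q \<union> snd ` NA p q \<union> fst ` NB p q \<union> snd ` NB p q \<union>
    succA (fst p) \<union> succB (fst p) \<union> ancA (fst p) \<union> ancB (fst p) \<union> (\<Union>\<beta>\<in>ancB (fst p). Ch \<beta>)"
    for p q :: "'a \<times> 'a"
  have anc_index: "|ancB t| \<le>o |A.small_set \<alpha>|" for t
    using small_countable[OF ancB_countable[of t]] unfolding small_def .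
  have F_small: "small (F p q)" for p q
    unfolding F_def
    by (intro small_Un small_countable countable_image NA_countable[rule_format] NB_countable[rule_format] succA_small succB_small
        ancA_countable ancB_countable small_UN[OF anc_index] Ch_small)
  obtain \<Delta>0 where \<Delta>0: "\<Delta>0 \<subseteq> \<Gamma>" "countable \<Delta>0" "infinite \<Delta>0"
    using infinite_countable_subset'[OF A.infinite_kappa] unfolding \<Gamma>_def by blast
  \<comment> \<open>the root, infinitely many labels, and the cones that are small\<close>
  define X0 where "X0 = {r} \<union> \<Delta>0 \<union> above TA \<alpha> \<union> (\<Union>\<beta>\<in>B \<inter> underS kappa \<alpha>. above TB \<beta>)"
  have "|B \<inter> underS kappa \<alpha>| \<le>o |A.small_set \<alpha>|"
    by (rule ordLeq_transitive[OF card_of_mono1 card_of_Plus2]) simp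
  then have "small (\<Union>\<beta>\<in>B \<inter> underS kappa \<alpha>. above TB \<beta>)"
    by (rule small_UN) (use B.cone_small[of _ \<alpha>] in \<open>simp add: small_def\<close>)
  moreover have "small (above TA \<alpha>)" unfolding small_def by (rule A.cone_small[OF \<alpha>(1)]) simp
  ultimately have X0_small: "small X0"
    unfolding X0_def using \<Delta>0(2) by (intro small_Un) (auto intro: small_countable)
  obtain M where M: "X0 \<subseteq> M" "small M" "\<forall>p\<in>M \<times> M. \<forall>q\<in>M \<times> M. F p q \<subseteq> M"
    using small_closure[where F = F, OF inf0 X0_small[unfolded small_def] F_small[unfolded small_def]]
    unfolding small_def by (elim exE conjE)
  obtain \<gamma>0 where \<gamma>0: "\<gamma>0 \<in> \<Gamma>" "\<gamma>0 \<notin> M" using outside[OF M(2)] by blast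
  have X0'_small: "small (M \<union> {\<gamma>0})" by (rule small_Un[OF M(2) small_countable]) simp
  obtain M' where M': "M \<union> {\<gamma>0} \<subseteq> M'" "small M'" "\<forall>p\<in>M' \<times> M'. \<forall>q\<in>M' \<times> M'. F p q \<subseteq> M'"
    using small_closure[where F = F, OF inf0 X0'_small[unfolded small_def] F_small[unfolded small_def]]
    unfolding small_def by (elim exE conjE)
  have MM': "M \<subseteq> M'" using M'(1) by blast
  have FM: "F (t, t) (t, t) \<subseteq> M" if "t \<in> M" for t by (rule M(3)[rule_format]) (use that in auto)
  have rM: "r \<in> M" using M(1) by (auto simp: X0_def)
  have succM_A: "\<exists>c\<in>M. \<exists>c'\<in>M. c \<noteq> c' \<and> c \<in> imm_succs TA t \<and> c' \<in> imm_succs TA t"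
    if t: "t \<in> M" "t \<in> Field TA" for t
  proof -
    have "succA t \<subseteq> M" using FM[OF t(1)] by (simp add: F_def)
    then show ?thesis using succA[OF t(2)] unfolding twoA_def by blast
  qed
  have succM_B: "\<exists>c\<in>M. \<exists>c'\<in>M. c \<noteq> c' \<and> c \<in> imm_succs TB t \<and> c' \<in> imm_succs TB t"
    if t: "t \<in> M" "t \<in> Field TB" for t
  proof -
    have "succB t \<subseteq> M" using FM[OF t(1)] by (simp add: F_def)
    then show ?thesis using succB[OF t(2)] unfolding twoB_def by blast
  qed
  have ancM_A: "a \<in> M" if a: "a \<in> A" "s \<in> M" "(a, s) \<in> TA" for a s
  proof -
    have "ancA s \<subseteq> M" using FM[OF a(2)] by (simp add: F_def)
    then show ?thesis using a by (auto simp: ancA_def)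
  qed
  have ancM_B: "b \<in> M" if b: "b \<in> B" "s \<in> M" "(b, s) \<in> TB" for b s
  proof -
    have "ancB s \<subseteq> M" using FM[OF b(2)] by (simp add: F_def)
    then show ?thesis using b by (auto simp: ancB_def)
  qed
  have inf: "infinite (M \<inter> \<Gamma>)"
  proof -
    have "\<Delta>0 \<subseteq> M \<inter> \<Gamma>" using M(1) \<Delta>0(1) by (auto simp: X0_def)
    then show ?thesis using \<Delta>0(3) finite_subset by blast
  qed
  have out: "\<Gamma> - M' \<noteq> {}" by (rule outside[OF M'(2)])
  \<comment> \<open>all mass at the empty set is available for the node points in the fiber of \<open>\<nu>\<close>\<close>
  define \<nu> where "\<nu> = return_pmf ({} :: ('a \<times> 'a) set)"
  have \<nu>K: "\<nu> \<in> pmfs_on KA"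
    using pair_family.empty_mem[OF compact_pair_family.axioms(1)[OF CA]] by (simp add: \<nu>_def pmfs_on_def)
  define SA SA' SB SB' \<Delta> \<Delta>' where "SA = M \<inter> Field TA" and "SA' = M' \<inter> Field TA"
    and "SB = M \<inter> Field TB" and "SB' = M' \<inter> Field TB" and "\<Delta> = M \<inter> \<Gamma>" and "\<Delta>' = M' \<inter> \<Gamma>"
  note defs = SA_def SA'_def SB_def SB'_def \<Delta>_def \<Delta>'_def
  have \<gamma>0M': "\<gamma>0 \<in> M'" using M'(1) by blast
  have WA: "tree_windows TA \<Gamma> SA \<Delta> r SA' \<Delta>' \<gamma>0 \<nu>"
    unfolding defs r_def \<Gamma>_def
    by (rule A.tree_windowsI[OF rM[unfolded r_def] MM' succM_A ancM_A inf[unfolded \<Gamma>_def] out[unfolded \<Gamma>_def]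
          \<gamma>0(1)[unfolded \<Gamma>_def] \<gamma>0M' \<gamma>0(2) \<nu>K[unfolded KA_def \<Gamma>_def]])
  have WB: "tree_windows TB \<Gamma> SB \<Delta> r SB' \<Delta>' \<gamma>0 (h \<nu>)"
    unfolding defs r_def \<Gamma>_def
    by (rule B.tree_windowsI[OF rM[unfolded r_def] MM' succM_B ancM_B inf[unfolded \<Gamma>_def] out[unfolded \<Gamma>_def]
          \<gamma>0(1)[unfolded \<Gamma>_def] \<gamma>0M' \<gamma>0(2) hK[OF \<nu>K, unfolded KB_def \<Gamma>_def]])
  have KA_sub: "\<Union>KA \<subseteq> Field TA \<times> \<Gamma>" and KB_sub: "\<Union>KB \<subseteq> Field TB \<times> \<Gamma>"
    unfolding KA_def KB_def using A.KT_sub[of \<Gamma>] B.KT_sub[of \<Gamma>] by blast+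
  \<comment> \<open>the homeomorphism matches the windows cut out by a closed set\<close>
  have same: "same_restr ((L \<inter> Field TA) \<times> (L \<inter> \<Gamma>)) x y \<longleftrightarrow>
      same_restr ((L \<inter> Field TB) \<times> (L \<inter> \<Gamma>)) (h x) (h y)"
    if L: "\<forall>p\<in>L \<times> L. \<forall>q\<in>L \<times> L. F p q \<subseteq> L" and x: "x \<in> pmfs_on KA" and y: "y \<in> pmfs_on KA"
    for L x y
  proof
    assume s: "same_restr ((L \<inter> Field TA) \<times> (L \<inter> \<Gamma>)) x y"
    show "same_restr ((L \<inter> Field TB) \<times> (L \<inter> \<Gamma>)) (h x) (h y)"
    proof (rule NA[rule_format, OF _ x y s])
      fix p q assume "p \<in> (L \<inter> Field TB) \<times> (L \<inter> \<Gamma>)" "q \<in> (L \<inter> Field TB) \<times> (L \<inter> \<Gamma>)"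
      then have "F p q \<subseteq> L" by (intro L[rule_format]) (auto simp: mem_Times_iff)
      then have "fst ` NA p q \<subseteq> L" "snd ` NA p q \<subseteq> L" by (simp_all add: F_def)
      then have "NA p q \<subseteq> L \<times> L" by (auto simp: mem_Times_iff)
      then show "NA p q \<inter> \<Union>KA \<subseteq> (L \<inter> Field TA) \<times> (L \<inter> \<Gamma>)" using KA_sub by blast
    qed
  next
    assume s: "same_restr ((L \<inter> Field TB) \<times> (L \<inter> \<Gamma>)) (h x) (h y)"
    have "same_restr ((L \<inter> Field TA) \<times> (L \<inter> \<Gamma>)) (g (h x)) (g (h y))"
    proof (rule NB[rule_format, OF _ hK[OF x] hK[OF y] s])
      fix p q assume "p \<in> (L \<inter> Field TA) \<times> (L \<inter> \<Gamma>)" "q \<in> (L \<inter> Field TA) \<times> (L \<inter> \<Gamma>)"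
      then have "F p q \<subseteq> L" by (intro L[rule_format]) (auto simp: mem_Times_iff)
      then have "fst ` NB p q \<subseteq> L" "snd ` NB p q \<subseteq> L" by (simp_all add: F_def)
      then have "NB p q \<subseteq> L \<times> L" by (auto simp: mem_Times_iff)
      then show "NB p q \<inter> \<Union>KB \<subseteq> (L \<inter> Field TB) \<times> (L \<inter> \<Gamma>)" using KB_sub by blast
    qed
    then show "same_restr ((L \<inter> Field TA) \<times> (L \<inter> \<Gamma>)) x y" by (simp add: gh x y)
  qed
  have H: "fiber_homeo (pmf_space KA) (pmf_space KB) h g (same_restr (SA \<times> \<Delta>)) (same_restr (SA' \<times> \<Delta>'))
      (same_restr (SB \<times> \<Delta>)) (same_restr (SB' \<times> \<Delta>'))"
    unfolding defs
    by (rule fiber_homeo.intro[OF hg]; unfold topspace_pmf_space; rule same; (rule M(3) M'(3) | assumption))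
  interpret WA: tree_windows TA \<Gamma> SA \<Delta> r SA' \<Delta>' \<gamma>0 \<nu> by (rule WA)
  interpret WB: tree_windows TB \<Gamma> SB \<Delta> r SB' \<Delta>' \<gamma>0 "h \<nu>" by (rule WB)
  interpret H: fiber_homeo "pmf_space KA" "pmf_space KB" h g "same_restr (SA \<times> \<Delta>)"
    "same_restr (SA' \<times> \<Delta>')" "same_restr (SB \<times> \<Delta>)" "same_restr (SB' \<times> \<Delta>')" by (rule H)
  have "WA.\<epsilon> = pmf (restr_pmf (SA \<times> \<Delta>) \<nu>) {}" by (rule WA.\<epsilon>_def)
  also have "\<dots> = 1" by (simp add: \<nu>_def restr_pmf_def)
  finally have posA: "WA.\<epsilon> > 0" by simp
  have \<alpha>r: "\<alpha> \<in> imm_succs TA r" using A.children \<alpha>(1) by (simp add: r_def)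
  have fullA: "above TA \<alpha> \<subseteq> SA"
    using M(1) A.in_Field by (auto simp: X0_def SA_def above_def)
  have \<alpha>S: "\<alpha> \<in> SA" using fullA A.refl[OF A.child_Field[OF \<alpha>(1)]] by (auto simp: above_def)
  have NP: "WB.NP = h ` WA.NP"
    using H.node_points_image[of \<nu>] \<nu>K unfolding KA_def KB_def by simp
  have NPtop: "WA.NP \<subseteq> topspace (pmf_space KA)"
    using WA.node_point(2) unfolding KA_def linear_fiber_def linear_points_def by blast
  have "h (WA.real \<alpha>) \<in> coatoms WB.NP WB.le"
    using H.coatoms_image[OF NPtop] WA.coatom_real[OF \<alpha>r \<alpha>S posA] unfolding NP KA_def KB_def by blast
  then obtain \<beta> where \<beta>: "\<beta> \<in> imm_succs TB r" "\<beta> \<in> SB"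
    and le: "WB.le (h (WA.real \<alpha>)) (WB.real \<beta>)" "WB.le (WB.real \<beta>) (h (WA.real \<alpha>))" and posB: "WB.\<epsilon> > 0"
    by (rule WB.coatomD)
  have \<beta>B: "\<beta> \<in> B" using \<beta>(1) B.children by (simp add: r_def)
  have \<beta>F: "\<beta> \<in> Field kappa" using \<beta>B B.A(1) by blast
  have "\<alpha> \<noteq> \<beta>" using \<alpha>(2) \<beta>B by blast
  moreover have "Total kappa" using A.well_order_kappa by (simp add: order_on_defs)
  ultimately consider "\<beta> \<in> underS kappa \<alpha>" | "\<alpha> \<in> underS kappa \<beta>"
    using \<alpha>F \<beta>F unfolding total_on_def underS_def by blast
  then show False
  proof cases
    case 1
    \<comment> \<open>a branch of \<open>\<Upsilon>\<^sub>\<alpha>\<close> would map into \<open>\<Upsilon>\<^sub>\<beta>\<close>\<close>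
    have fullB: "above TB \<beta> \<subseteq> SB"
    proof -
      have "above TB \<beta> \<subseteq> X0" using 1 \<beta>B by (auto simp: X0_def)
      then show ?thesis using M(1) B.in_Field by (auto simp: SB_def above_def)
    qed
    obtain f where f: "\<forall>t\<in>SA. (\<alpha>, t) \<in> TA \<longrightarrow> (\<beta>, f t) \<in> TB"
      "\<forall>t\<in>SA. \<forall>t'\<in>SA. (\<alpha>, t) \<in> TA \<longrightarrow> (t, t') \<in> TA \<longrightarrow> t \<noteq> t' \<longrightarrow>
        (f t, f t') \<in> TB \<and> f t \<noteq> f t'"
      using chain_transfer[OF WA WB H[unfolded KA_def KB_def] HOL.refl \<alpha>r \<alpha>S \<beta> le(1) posA fullB]
      by (elim exE conjE)
    have "\<exists>C\<subseteq>above TA \<alpha>. |C| \<le>o |A.small_set \<beta>| \<and> (\<forall>f. (\<forall>t\<in>C. (\<beta>, f t) \<in> TB) \<longrightarrow>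
      (\<exists>t\<in>C. \<exists>t'\<in>C. (t, t') \<in> TA \<and> t \<noteq> t' \<and> \<not> ((f t, f t') \<in> TB \<and> f t \<noteq> f t')))"
      by (rule upsilon_chain_obstruction[OF UA UB \<alpha>(1) \<beta>B 1])
    then obtain C where C: "C \<subseteq> above TA \<alpha>"
      and obs: "\<forall>f. (\<forall>t\<in>C. (\<beta>, f t) \<in> TB) \<longrightarrow>
        (\<exists>t\<in>C. \<exists>t'\<in>C. (t, t') \<in> TA \<and> t \<noteq> t' \<and> \<not> ((f t, f t') \<in> TB \<and> f t \<noteq> f t'))"
      by (elim exE conjE)
    have CS: "t \<in> SA" "(\<alpha>, t) \<in> TA" if "t \<in> C" for t using that C fullA by (auto simp: above_def)
    have "\<forall>t\<in>C. (\<beta>, f t) \<in> TB" using f(1) CS by blast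
    from obs[THEN spec, THEN mp, OF this]
    obtain t t' where t: "t \<in> C" "t' \<in> C" "(t, t') \<in> TA" "t \<noteq> t'"
      "\<not> ((f t, f t') \<in> TB \<and> f t \<noteq> f t')" by (elim bexE conjE)
    show False using f(2)[rule_format, OF CS(1)[OF t(1)] CS(1)[OF t(2)] CS(2)[OF t(1)] t(3,4)] t(5) by blast
  next
    case 2
    \<comment> \<open>the chosen chain in \<open>\<Upsilon>\<^sub>\<beta>\<close> would map into \<open>\<Upsilon>\<^sub>\<alpha>\<close>\<close>
    have \<beta>T: "\<beta> \<in> ancB \<beta>" using \<beta>B B.refl[OF B.child_Field[OF \<beta>B]] by (simp add: ancB_def)
    have "\<beta> \<in> M" using \<beta>(2) by (simp add: SB_def)
    then have "Ch \<beta> \<subseteq> M" using FM[of \<beta>] \<beta>T by (auto simp: F_def)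
    moreover have long: "long \<beta> (Ch \<beta>)" by (rule Ch) (use \<beta>B 2 in blast)
    ultimately have CS: "t \<in> SB" "(\<beta>, t) \<in> TB" if "t \<in> Ch \<beta>" for t
      using that B.in_Field by (auto simp: long_def above_def SB_def)
    have le': "WA.le (g (WB.real \<beta>)) (WA.real \<alpha>)"
    proof -
      have top: "WA.real \<alpha> \<in> topspace (pmf_space KA)" "g (WB.real \<beta>) \<in> topspace (pmf_space KA)"
        "WB.real \<beta> \<in> topspace (pmf_space KB)"
      proof -
        show "WA.real \<alpha> \<in> topspace (pmf_space KA)" using NPtop WA.real_node(1)[OF \<alpha>S posA] by blast
        have "WB.real \<beta> \<in> h ` WA.NP" using WB.real_node(1)[OF \<beta>(2) posB] NP by simp
        then obtain z where z: "z \<in> WA.NP" "WB.real \<beta> = h z" by blast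
        have "h z \<in> topspace (pmf_space KB)" by (rule H.maps(1)) (use NPtop z(1) in blast)
        then show t: "WB.real \<beta> \<in> topspace (pmf_space KB)" using z(2) by simp
        show "g (WB.real \<beta>) \<in> topspace (pmf_space KA)" by (rule H.maps(2)[OF t])
      qed
      show ?thesis
        using H.fiber_le_iff[OF top(2,1)] le(2) unfolding H.maps(4)[OF top(3)] KA_def KB_def by simp
    qed
    have \<nu>g: "\<nu> = g (h \<nu>)" using gh[OF \<nu>K] by simp
    obtain f where f: "\<forall>t\<in>SB. (\<beta>, t) \<in> TB \<longrightarrow> (\<alpha>, f t) \<in> TA"
      "\<forall>t\<in>SB. \<forall>t'\<in>SB. (\<beta>, t) \<in> TB \<longrightarrow> (t, t') \<in> TB \<longrightarrow> t \<noteq> t' \<longrightarrow>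
        (f t, f t') \<in> TA \<and> f t \<noteq> f t'"
      using chain_transfer[OF WB WA fiber_homeo_sym[OF H, unfolded KA_def KB_def] \<nu>g \<beta> \<alpha>r \<alpha>S le' posB fullA]
      by (elim exE conjE)
    have "\<forall>t\<in>Ch \<beta>. (\<alpha>, f t) \<in> TA" using f(1) CS by blast
    from long[unfolded long_def, THEN conjunct2, THEN conjunct2, THEN spec, THEN mp, OF this]
    obtain t t' where t: "t \<in> Ch \<beta>" "t' \<in> Ch \<beta>" "(t, t') \<in> TB" "t \<noteq> t'"
      "\<not> ((f t, f t') \<in> TA \<and> f t \<noteq> f t')" by (elim bexE conjE)
    show False using f(2)[rule_format, OF CS(1)[OF t(1)] CS(1)[OF t(2)] CS(2)[OF t(1)] t(3,4)] t(5) by blast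
  qed
qed

theorem theorem6:
  fixes kappa :: "'a rel"
    and Ups :: "'a \<Rightarrow> 'a rel"
    and A B :: "'a set"
    and TA TB :: "'a rel"
  assumes kappa: "Card_order kappa" "uncountable (Field kappa)"
    and Ups: "\<And>\<alpha>. \<alpha> \<in> Field kappa \<Longrightarrow> \<alpha> \<noteq> ord_zero kappa \<Longrightarrow> upsilon_tree kappa \<alpha> (Ups \<alpha>)"
    and A: "A \<subseteq> Field kappa - {ord_zero kappa}" "|A| =o kappa"
    and B: "B \<subseteq> Field kappa - {ord_zero kappa}" "|B| =o kappa"
    and TA: "upsilon_sum kappa Ups A TA"
    and TB: "upsilon_sum kappa Ups B TB"
    and neq: "A \<noteq> B"
  shows "\<not> (P_space (K_space TA (Field kappa)) homeomorphic_space
             P_space (K_space TB (Field kappa)))"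
proof
  assume hom: "P_space (K_space TA (Field kappa)) homeomorphic_space P_space (K_space TB (Field kappa))"
  have UA: "upsilon_sum_tree kappa Ups A TA"
    by (intro upsilon_sum_tree.intro upsilon_family.intro upsilon_sum_tree_axioms.intro kappa Ups A TA)
  have UB: "upsilon_sum_tree kappa Ups B TB"
    by (intro upsilon_sum_tree.intro upsilon_family.intro upsilon_sum_tree_axioms.intro kappa Ups B TB)
  interpret TA: upsilon_sum_tree kappa Ups A TA by (rule UA)
  interpret TB: upsilon_sum_tree kappa Ups B TB by (rule UB)
  let ?QA = "pmf_space (TA.KT (Field kappa))" and ?QB = "pmf_space (TB.KT (Field kappa))"
  have QA: "?QA homeomorphic_space P_space (K_space TA (Field kappa))"
    by (rule compact_pair_family.pmf_space_homeomorphic[OF TA.compact_pair_family_K_space])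
  have QB: "?QB homeomorphic_space P_space (K_space TB (Field kappa))"
    by (rule compact_pair_family.pmf_space_homeomorphic[OF TB.compact_pair_family_K_space])
  have AB: "?QA homeomorphic_space ?QB"
    using homeomorphic_space_trans[OF homeomorphic_space_trans[OF QA hom]
        homeomorphic_space_sym[THEN iffD1, OF QB]] .
  then have BA: "?QB homeomorphic_space ?QA" by (rule homeomorphic_space_sym[THEN iffD1])
  consider \<alpha> where "\<alpha> \<in> A" "\<alpha> \<notin> B" | \<alpha> where "\<alpha> \<in> B" "\<alpha> \<notin> A" using neq by blast
  then show False
  proof cases
    case (1 \<alpha>)
    then show False using pmf_spaces_not_homeomorphic[OF UA UB] AB by blast
  next
    case (2 \<alpha>)
    then show False using pmf_spaces_not_homeomorphic[OF UB UA] BA by blast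
  qed
qed

end
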